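(* Let $\mathcal{B}$ be a unital $C^*$-algebra and let $E^\odot=(E_t)_{t\in\mathbb{R}_+}$ be a product system of $\mathcal{B}$-correspondences. Suppose $S$ is a set of units for $E^\odot$ that generates $E^\odot$, and suppose $\xi^\odot\in S$ is unital. If for all $\zeta^\odot,\zeta'^\odot\in S$ and $b\in\mathcal{B}$ the map $t\mapsto\langle\zeta_t,b\zeta'_t\rangle$ is continuous, then the $E_0$-semigroup $\vartheta^\xi$ is strongly continuous. Moreover, the continuous structure induced on $E^\odot$ by $\vartheta^\xi$ is the unique one making all $\zeta^\odot\in S$ continuous sections.
   Context: A correspondence over $\mathcal{B}$ is a Hilbert $\mathcal{B}$-module with a nondegenerate left action of $\mathcal{B}$ by adjointable operators; $\odot$ is the interior tensor product; $\mathscr{B}^a(E)$ denotes the adjointable operators. A product system of $\mathcal{B}$-correspondences is a family $E^\odot=(E_t)_{t\in\mathbb{R}_+}$ of correspondences over $\mathcal{B}$ with $E_0=\mathcal{B}$ and bilinear unitaries $u_{s,t}\colon E_s\odot E_t\to E_{s+t}$ such that $x_sy_t:=u_{s,t}(x_s\odot y_t)$ is associative and $u_{0,t},u_{t,0}$ are the canonical left and right action. A unit is a family $\xi^\odot=(\xi_t)_{t\in\mathbb{R}_+}$, $\xi_t\in E_t$, with $\xi_s\xi_t=\xi_{s+t}$ and $\xi_0=\mathbf{1}$; it is unital if $\langle\xi_t,\xi_t\rangle=\mathbf{1}$ for all $t$. A set $S$ of units generates $E^\odot$ if no proper product subsystem contains all units of $S$; equivalently, for every $t>0$, $E_t$ is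 the closed span of all $b_n\xi^n_{t_n}\cdots b_1\xi^1_{t_1}b_0$ with $n\in\mathbb{N}$, $b_i\in\mathcal{B}$, ${\xi^i}^\odot\in S$, $t_i>0$, $t_1+\dots+t_n=t$. For a unital unit $\xi^\odot$, the isometries $E_t\to E_{s+t}$, $x_t\mapsto\xi_sx_t$, form an inductive system; let $E^\xi$ be its (completed) inductive limit, a Hilbert $\mathcal{B}$-module, and let $\xi\in E^\xi$ be the common image of all $\xi_t$ (a unit vector). The identifications $E_s\odot E_t=E_{s+t}$ induce unitaries $v_t\colon E^\xi\odot E_t\to E^\xi$, $xy_t:=v_t(x\odot y_t)$, with $(xy_s)z_t=x(y_sz_t)$ and $\xi\xi_t=\xi$; the canonical image of $x_t\in E_t$ in $E^\xi$ is $\xi x_t$. The $E_0$-semigroup $\vartheta^\xi$ on $\mathscr{B}^a(E^\xi)$ is $\vartheta^\xi_t(a)=v_t(a\odot\mathrm{id}_{E_t})v_t^*$. It is strongly continuous if $t\mapsto\vartheta^\xi_t(a)x$ is continuous for all $a\in\mathscr{B}^a(E^\xi)$, $x\in E^\xi$. A continuous structure on $E^\odot$ is a family of isometric right $\mathcal{B}$-linear embeddings $i_t\colon E_t\to\hat E$ into a fixed Hilbert $\mathcal{B}$-module such that, with $CS_i(E^\odot)$ the set of sections $(x_t)$, $x_t\in E_t$, with $t\mapsto i_tx_t$ continuous (continuous sections): $\{x_s\colon(x_t)\in CS_i(E^\odot)\}=E_s$ for all $s$, and $(s,t)\mapsto i_{s+t}(x_sy_t)$ is continuous for all $x,y\in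 CS_i(E^\odot)$. Two continuous structures are considered equal if they have the same continuous sections. The continuous structure induced by $\vartheta^\xi$ (when strongly continuous) is given by the embeddings $i_t\colon E_t\to E^\xi$, $x_t\mapsto\xi x_t$. *)

theory Defs
  imports "HOL-Analysis.Analysis"
begin

section \<open>Unital C*-algebras\<close>

(* real_normed_algebra + monoid_mult rather than real_normed_algebra_1: the latter
   would exclude the zero algebra. *)
class unital_cstar_algebra = real_normed_algebra + monoid_mult + banach +
  fixes scaleC :: "complex \<Rightarrow> 'a \<Rightarrow> 'a"  (infixr "*\<^sub>C" 75)
    and star :: "'a \<Rightarrow> 'a"
  assumes scaleC_add_right: "c *\<^sub>C (a + b) = c *\<^sub>C a + c *\<^sub>C b"
    and scaleC_add_left: "(c + d) *\<^sub>C a = c *\<^sub>C a + d *\<^sub>C a"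
    and scaleC_scaleC: "c *\<^sub>C d *\<^sub>C a = (c * d) *\<^sub>C a"
    and scaleR_scaleC: "r *\<^sub>R a = complex_of_real r *\<^sub>C a"
    and mult_scaleC_left: "(c *\<^sub>C a) * b = c *\<^sub>C (a * b)"
    and mult_scaleC_right: "a * (c *\<^sub>C b) = c *\<^sub>C (a * b)"
    and norm_scaleC: "norm (c *\<^sub>C a) = cmod c * norm a"
    and star_add: "star (a + b) = star a + star b"
    and star_scaleC: "star (c *\<^sub>C a) = cnj c *\<^sub>C star a"
    and star_mult: "star (a * b) = star b * star a"
    and star_star: "star (star a) = a"
    and cstar_identity: "norm (star a * a) = (norm a)\<^sup>2"

definition cpositive :: "'b::unital_cstar_algebra \<Rightarrow> bool" where
  "cpositive a \<longleftrightarrow> (\<exists>c. a = star c * c)"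

section \<open>Hilbert modules and correspondences\<close>

(* Modules live on explicit carriers, so that the members of a family (E_t) may be
   unrelated modules.  Scalar multiplication by a complex number c is the right action
   of c *\<^sub>C 1; in particular -x is ract x (-1). *)
record ('b, 'e) hmod =
  car :: "'e set"
  hzero :: 'e
  hadd :: "'e \<Rightarrow> 'e \<Rightarrow> 'e"
  ract :: "'e \<Rightarrow> 'b \<Rightarrow> 'e"
  ip :: "'e \<Rightarrow> 'e \<Rightarrow> 'b"

record ('b, 'e) corr = "('b, 'e) hmod" +
  lact :: "'b \<Rightarrow> 'e \<Rightarrow> 'e"

definition hnorm :: "('b::unital_cstar_algebra, 'e, 'm) hmod_scheme \<Rightarrow> 'e \<Rightarrow> real" where
  "hnorm M x = sqrt (norm (ip M x x))"

definition hdist :: "('b::unital_cstar_algebra, 'e, 'm) hmod_scheme \<Rightarrow> 'e \<Rightarrow> 'e \<Rightarrow> real" where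
  "hdist M x y = hnorm M (hadd M x (ract M y (- 1)))"

definition hCauchy :: "('b::unital_cstar_algebra, 'e, 'm) hmod_scheme \<Rightarrow> (nat \<Rightarrow> 'e) \<Rightarrow> bool" where
  "hCauchy M X \<longleftrightarrow> (\<forall>n. X n \<in> car M) \<and>
     (\<forall>e>0. \<exists>N. \<forall>m\<ge>N. \<forall>n\<ge>N. hdist M (X m) (X n) < e)"

locale hilbert_module =
  fixes M :: "('b::unital_cstar_algebra, 'e, 'm) hmod_scheme"
  assumes zero_closed: "hzero M \<in> car M"
    and add_closed: "\<lbrakk>x \<in> car M; y \<in> car M\<rbrakk> \<Longrightarrow> hadd M x y \<in> car M"
    and add_assoc: "\<lbrakk>x \<in> car M; y \<in> car M; z \<in> car M\<rbrakk>
          \<Longrightarrow> hadd M (hadd M x y) z = hadd M x (hadd M y z)"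
    and add_commute: "\<lbrakk>x \<in> car M; y \<in> car M\<rbrakk> \<Longrightarrow> hadd M x y = hadd M y x"
    and add_zero: "x \<in> car M \<Longrightarrow> hadd M x (hzero M) = x"
    and add_inverse: "x \<in> car M \<Longrightarrow> \<exists>y\<in>car M. hadd M x y = hzero M"
    and ract_closed: "x \<in> car M \<Longrightarrow> ract M x b \<in> car M"
    and ract_add: "\<lbrakk>x \<in> car M; y \<in> car M\<rbrakk>
          \<Longrightarrow> ract M (hadd M x y) b = hadd M (ract M x b) (ract M y b)"
    and ract_plus: "x \<in> car M \<Longrightarrow> ract M x (b + c) = hadd M (ract M x b) (ract M x c)"
    and ract_mult: "x \<in> car M \<Longrightarrow> ract M x (b * c) = ract M (ract M x b) c"
    and ract_one: "x \<in> car M \<Longrightarrow> ract M x 1 = x"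
    and ip_add: "\<lbrakk>x \<in> car M; y \<in> car M; z \<in> car M\<rbrakk>
          \<Longrightarrow> ip M x (hadd M y z) = ip M x y + ip M x z"
    and ip_ract: "\<lbrakk>x \<in> car M; y \<in> car M\<rbrakk> \<Longrightarrow> ip M x (ract M y b) = ip M x y * b"
    and ip_star: "\<lbrakk>x \<in> car M; y \<in> car M\<rbrakk> \<Longrightarrow> star (ip M x y) = ip M y x"
    and ip_positive: "x \<in> car M \<Longrightarrow> cpositive (ip M x x)"
    and ip_definite: "\<lbrakk>x \<in> car M; ip M x x = 0\<rbrakk> \<Longrightarrow> x = hzero M"
    and complete: "hCauchy M X \<Longrightarrow> \<exists>x\<in>car M. (\<lambda>n. hdist M (X n) x) \<longlonglongrightarrow> 0"

inductive_set clin_span ::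
    "('b::unital_cstar_algebra, 'e, 'm) hmod_scheme \<Rightarrow> 'e set \<Rightarrow> 'e set"
  for M A where
  zero: "hzero M \<in> clin_span M A"
| base: "x \<in> A \<Longrightarrow> x \<in> clin_span M A"
| add: "\<lbrakk>x \<in> clin_span M A; y \<in> clin_span M A\<rbrakk> \<Longrightarrow> hadd M x y \<in> clin_span M A"
| scale: "x \<in> clin_span M A \<Longrightarrow> ract M x (c *\<^sub>C 1) \<in> clin_span M A"

definition closed_span ::
    "('b::unital_cstar_algebra, 'e, 'm) hmod_scheme \<Rightarrow> 'e set \<Rightarrow> 'e set" where
  "closed_span M A = {x \<in> car M. \<forall>e>0. \<exists>y\<in>clin_span M A. hdist M x y < e}"

definition is_adjoint ::
    "('b::unital_cstar_algebra, 'e, 'm) hmod_scheme \<Rightarrow> ('b, 'f, 'n) hmod_scheme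
      \<Rightarrow> ('e \<Rightarrow> 'f) \<Rightarrow> ('f \<Rightarrow> 'e) \<Rightarrow> bool" where
  "is_adjoint M N f g \<longleftrightarrow> f \<in> car M \<rightarrow> car N \<and> g \<in> car N \<rightarrow> car M \<and>
     (\<forall>x\<in>car M. \<forall>y\<in>car N. ip N (f x) y = ip M x (g y))"

definition adjointable :: "('b::unital_cstar_algebra, 'e, 'm) hmod_scheme \<Rightarrow> ('e \<Rightarrow> 'e) \<Rightarrow> bool" where
  "adjointable M a \<longleftrightarrow> (\<exists>g. is_adjoint M M a g)"

(* As a function on the whole type the adjoint is determined only on the carrier. *)
definition hadjoint ::
    "('b::unital_cstar_algebra, 'e, 'm) hmod_scheme \<Rightarrow> ('b, 'f, 'n) hmod_scheme
      \<Rightarrow> ('e \<Rightarrow> 'f) \<Rightarrow> 'f \<Rightarrow> 'e" where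
  "hadjoint M N f = (SOME g. is_adjoint M N f g)"

(* The left action is a nondegenerate *-homomorphism into the adjointable operators;
   right linearity of the individual operators follows from adjointability. *)
locale correspondence = hilbert_module M
  for M :: "('b::unital_cstar_algebra, 'e, 'm) corr_scheme" +
  assumes lact_adjoint: "is_adjoint M M (lact M b) (lact M (star b))"
    and lact_plus: "x \<in> car M \<Longrightarrow> lact M (b + c) x = hadd M (lact M b x) (lact M c x)"
    and lact_scaleC: "x \<in> car M \<Longrightarrow> lact M (z *\<^sub>C b) x = ract M (lact M b x) (z *\<^sub>C 1)"
    and lact_mult: "x \<in> car M \<Longrightarrow> lact M (b * c) x = lact M b (lact M c x)"
    and nondegenerate: "closed_span M {lact M b x | b x. x \<in> car M} = car M"

definition trivial_corr :: "('b::unital_cstar_algebra, 'b) corr" where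
  "trivial_corr = \<lparr>car = UNIV, hzero = 0, hadd = (+), ract = (*),
     ip = (\<lambda>a b. star a * b), lact = (*)\<rparr>"

definition isometric_embedding ::
    "('b::unital_cstar_algebra, 'e, 'm) hmod_scheme \<Rightarrow> ('b, 'f, 'n) hmod_scheme
      \<Rightarrow> ('e \<Rightarrow> 'f) \<Rightarrow> bool" where
  "isometric_embedding M N f \<longleftrightarrow> f \<in> car M \<rightarrow> car N \<and>
     (\<forall>x\<in>car M. \<forall>y\<in>car M. f (hadd M x y) = hadd N (f x) (f y)) \<and>
     (\<forall>x\<in>car M. \<forall>b. f (ract M x b) = ract N (f x) b) \<and>
     (\<forall>x\<in>car M. \<forall>y\<in>car M. ip N (f x) (f y) = ip M x y)"

definition unitary ::
    "('b::unital_cstar_algebra, 'e, 'm) hmod_scheme \<Rightarrow> ('b, 'f, 'n) hmod_scheme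
      \<Rightarrow> ('e \<Rightarrow> 'f) \<Rightarrow> bool" where
  "unitary M N f \<longleftrightarrow> isometric_embedding M N f \<and> f ` car M = car N"

definition bilinear_unitary ::
    "('b::unital_cstar_algebra, 'e, 'm) corr_scheme \<Rightarrow> ('b, 'f, 'n) corr_scheme
      \<Rightarrow> ('e \<Rightarrow> 'f) \<Rightarrow> bool" where
  "bilinear_unitary M N f \<longleftrightarrow> unitary M N f \<and>
     (\<forall>b. \<forall>x\<in>car M. f (lact M b x) = lact N b (f x))"

section \<open>Hausdorff completion\<close>

(* M is a module with a B-valued semi-inner product, in which the module laws may hold
   only up to elements of length zero.  The points of the completion are the classes of
   Cauchy sequences modulo sequences at distance tending to 0, so elements of length
   zero are divided out as well. *)
definition cclass :: "('b::unital_cstar_algebra, 'x, 'm) hmod_scheme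
      \<Rightarrow> (nat \<Rightarrow> 'x) \<Rightarrow> (nat \<Rightarrow> 'x) set" where
  "cclass M X = {Y. hCauchy M Y \<and> (\<lambda>n. hdist M (X n) (Y n)) \<longlonglongrightarrow> 0}"

definition crep :: "(nat \<Rightarrow> 'x) set \<Rightarrow> nat \<Rightarrow> 'x" where
  "crep P = (SOME X. X \<in> P)"

definition completion :: "('b::unital_cstar_algebra, 'x, 'm) hmod_scheme
      \<Rightarrow> ('b, (nat \<Rightarrow> 'x) set) hmod" where
  "completion M =
     \<lparr>car = cclass M ` {X. hCauchy M X},
      hzero = cclass M (\<lambda>_. hzero M),
      hadd = (\<lambda>P Q. cclass M (\<lambda>n. hadd M (crep P n) (crep Q n))),
      ract = (\<lambda>P b. cclass M (\<lambda>n. ract M (crep P n) b)),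
      ip = (\<lambda>P Q. lim (\<lambda>n. ip M (crep P n) (crep Q n)))\<rparr>"

definition embed :: "('b::unital_cstar_algebra, 'x, 'm) hmod_scheme \<Rightarrow> 'x \<Rightarrow> (nat \<Rightarrow> 'x) set" where
  "embed M x = cclass M (\<lambda>_. x)"

section \<open>Interior tensor product\<close>

type_synonym ('e, 'f) tens = "(nat \<Rightarrow> ('e \<times> 'f) list) set"

(* The list [(x1, y1), ..., (xn, yn)] stands for the sum of the elementary tensors xi (.) yi. *)
definition alg_tensor :: "('b::unital_cstar_algebra, 'e, 'm) hmod_scheme \<Rightarrow> ('b, 'f, 'n) corr_scheme
      \<Rightarrow> ('b, ('e \<times> 'f) list) hmod" where
  "alg_tensor E F =
     \<lparr>car = lists (car E \<times> car F),
      hzero = [],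
      hadd = (@),
      ract = (\<lambda>xs b. map (\<lambda>(x, y). (x, ract F y b)) xs),
      ip = (\<lambda>xs xs'. \<Sum>(x, y)\<leftarrow>xs. \<Sum>(x', y')\<leftarrow>xs'. ip F y (lact F (ip E x x') y'))\<rparr>"

definition interior_tensor :: "('b::unital_cstar_algebra, 'e, 'm) hmod_scheme
      \<Rightarrow> ('b, 'f, 'n) corr_scheme \<Rightarrow> ('b, ('e, 'f) tens) hmod" where
  "interior_tensor E F = completion (alg_tensor E F)"

definition tensor :: "('b::unital_cstar_algebra, 'e, 'm) hmod_scheme
      \<Rightarrow> ('b, 'f, 'n) corr_scheme \<Rightarrow> 'e \<Rightarrow> 'f \<Rightarrow> ('e, 'f) tens" where
  "tensor E F x y = embed (alg_tensor E F) [(x, y)]"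

(* The operator a (.) id_F for an adjointable operator a on E. *)
definition tensor_id :: "('b::unital_cstar_algebra, 'e, 'm) hmod_scheme
      \<Rightarrow> ('b, 'f, 'n) corr_scheme \<Rightarrow> ('e \<Rightarrow> 'e) \<Rightarrow> ('e, 'f) tens \<Rightarrow> ('e, 'f) tens" where
  "tensor_id E F a P = cclass (alg_tensor E F) (\<lambda>n. map (\<lambda>(x, y). (a x, y)) (crep P n))"

definition corr_tensor :: "('b::unital_cstar_algebra, 'e, 'm) corr_scheme
      \<Rightarrow> ('b, 'f, 'n) corr_scheme \<Rightarrow> ('b, ('e, 'f) tens) corr" where
  "corr_tensor E F = hmod.extend (interior_tensor E F)
     (corr.fields (\<lambda>b. tensor_id E F (lact E b)))"

section \<open>Product systems and units\<close>

(* Only the fibres and structure maps at indices t \<ge> 0 are meaningful.  The map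
   "iota" is the identification of B with the fibre at 0. *)
record ('b, 'e) psys =
  fib :: "real \<Rightarrow> ('b, 'e) corr"
  umul :: "real \<Rightarrow> real \<Rightarrow> ('e, 'e) tens \<Rightarrow> 'e"
  iota :: "'b \<Rightarrow> 'e"

definition pmul :: "('b::unital_cstar_algebra, 'e) psys \<Rightarrow> real \<Rightarrow> real \<Rightarrow> 'e \<Rightarrow> 'e \<Rightarrow> 'e" where
  "pmul E s t x y = umul E s t (tensor (fib E s) (fib E t) x y)"

locale product_system =
  fixes E :: "('b::unital_cstar_algebra, 'e) psys"
  assumes fib_corr: "t \<ge> 0 \<Longrightarrow> correspondence (fib E t)"
    and iota_unitary: "bilinear_unitary trivial_corr (fib E 0) (iota E)"
    and umul_unitary: "\<lbrakk>s \<ge> 0; t \<ge> 0\<rbrakk>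
          \<Longrightarrow> bilinear_unitary (corr_tensor (fib E s) (fib E t)) (fib E (s + t)) (umul E s t)"
    and pmul_assoc: "\<lbrakk>r \<ge> 0; s \<ge> 0; t \<ge> 0; x \<in> car (fib E r); y \<in> car (fib E s); z \<in> car (fib E t)\<rbrakk>
          \<Longrightarrow> pmul E (r + s) t (pmul E r s x y) z = pmul E r (s + t) x (pmul E s t y z)"
    and pmul_left: "\<lbrakk>t \<ge> 0; x \<in> car (fib E t)\<rbrakk> \<Longrightarrow> pmul E 0 t (iota E b) x = lact (fib E t) b x"
    and pmul_right: "\<lbrakk>t \<ge> 0; x \<in> car (fib E t)\<rbrakk> \<Longrightarrow> pmul E t 0 x (iota E b) = ract (fib E t) x b"

definition ps_unit :: "('b::unital_cstar_algebra, 'e) psys \<Rightarrow> (real \<Rightarrow> 'e) \<Rightarrow> bool" where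
  "ps_unit E \<xi> \<longleftrightarrow> (\<forall>t\<ge>0. \<xi> t \<in> car (fib E t)) \<and>
     (\<forall>s\<ge>0. \<forall>t\<ge>0. pmul E s t (\<xi> s) (\<xi> t) = \<xi> (s + t)) \<and> \<xi> 0 = iota E 1"

definition unital_ps_unit :: "('b::unital_cstar_algebra, 'e) psys \<Rightarrow> (real \<Rightarrow> 'e) \<Rightarrow> bool" where
  "unital_ps_unit E \<xi> \<longleftrightarrow> ps_unit E \<xi> \<and> (\<forall>t\<ge>0. ip (fib E t) (\<xi> t) (\<xi> t) = 1)"

(* unit_word E S t x: the element x of the fibre at t is a product
   b_n \<xi>^n_{t_n} ... b_1 \<xi>^1_{t_1} b_0 with t_i > 0 summing up to t. *)
inductive unit_word ::
    "('b::unital_cstar_algebra, 'e) psys \<Rightarrow> (real \<Rightarrow> 'e) set \<Rightarrow> real \<Rightarrow> 'e \<Rightarrow> bool"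
  for E S where
  Nil: "unit_word E S 0 (iota E b)"
| Cons: "\<lbrakk>unit_word E S t x; \<zeta> \<in> S; s > 0\<rbrakk>
      \<Longrightarrow> unit_word E S (s + t) (lact (fib E (s + t)) b (pmul E s t (\<zeta> s) x))"

definition generates :: "('b::unital_cstar_algebra, 'e) psys \<Rightarrow> (real \<Rightarrow> 'e) set \<Rightarrow> bool" where
  "generates E S \<longleftrightarrow> (\<forall>t>0. closed_span (fib E t) {x. unit_word E S t x} = car (fib E t))"

section \<open>The inductive limit of a unital unit and its semigroup\<close>

(* The algebraic inductive limit along x_t \<mapsto> \<xi>_s x_t: pairs (t, x) with x in the
   fibre at t, computed with after transport to a common index.  Since the connecting
   maps are isometric, identifying a pair with its transports is the same as dividing
   out the elements of length zero, which completion does. *)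
definition transport :: "('b::unital_cstar_algebra, 'e) psys \<Rightarrow> (real \<Rightarrow> 'e) \<Rightarrow> real \<Rightarrow> real \<times> 'e \<Rightarrow> 'e" where
  "transport E \<xi> r = (\<lambda>(t, x). pmul E (r - t) t (\<xi> (r - t)) x)"

definition alg_indlim :: "('b::unital_cstar_algebra, 'e) psys \<Rightarrow> (real \<Rightarrow> 'e) \<Rightarrow> ('b, real \<times> 'e) hmod" where
  "alg_indlim E \<xi> =
     \<lparr>car = {(t, x). t \<ge> 0 \<and> x \<in> car (fib E t)},
      hzero = (0, hzero (fib E 0)),
      hadd = (\<lambda>p q. let r = max (fst p) (fst q)
                    in (r, hadd (fib E r) (transport E \<xi> r p) (transport E \<xi> r q))),
      ract = (\<lambda>(t, x) b. (t, ract (fib E t) x b)),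
      ip = (\<lambda>p q. let r = max (fst p) (fst q)
                  in ip (fib E r) (transport E \<xi> r p) (transport E \<xi> r q))\<rparr>"

type_synonym 'e ilim = "(nat \<Rightarrow> real \<times> 'e) set"

definition indlim :: "('b::unital_cstar_algebra, 'e) psys \<Rightarrow> (real \<Rightarrow> 'e) \<Rightarrow> ('b, 'e ilim) hmod" where
  "indlim E \<xi> = completion (alg_indlim E \<xi>)"

(* The canonical embedding x_t \<mapsto> \<xi> x_t of the fibre at t. *)
definition ilim_embed :: "('b::unital_cstar_algebra, 'e) psys \<Rightarrow> (real \<Rightarrow> 'e) \<Rightarrow> real \<Rightarrow> 'e \<Rightarrow> 'e ilim" where
  "ilim_embed E \<xi> t x = embed (alg_indlim E \<xi>) (t, x)"

(* v_t is determined on the carrier by (\<xi> x_s) y_t = \<xi> (x_s y_t). *)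
definition ilim_unitary :: "('b::unital_cstar_algebra, 'e) psys \<Rightarrow> (real \<Rightarrow> 'e) \<Rightarrow> real
      \<Rightarrow> ('e ilim, 'e) tens \<Rightarrow> 'e ilim" where
  "ilim_unitary E \<xi> t =
     (SOME v. unitary (interior_tensor (indlim E \<xi>) (fib E t)) (indlim E \<xi>) v \<and>
        (\<forall>s\<ge>0. \<forall>x\<in>car (fib E s). \<forall>y\<in>car (fib E t).
           v (tensor (indlim E \<xi>) (fib E t) (ilim_embed E \<xi> s x) y)
             = ilim_embed E \<xi> (s + t) (pmul E s t x y)))"

definition vartheta :: "('b::unital_cstar_algebra, 'e) psys \<Rightarrow> (real \<Rightarrow> 'e) \<Rightarrow> real
      \<Rightarrow> ('e ilim \<Rightarrow> 'e ilim) \<Rightarrow> 'e ilim \<Rightarrow> 'e ilim" where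
  "vartheta E \<xi> t a = ilim_unitary E \<xi> t \<circ> tensor_id (indlim E \<xi>) (fib E t) a
     \<circ> hadjoint (interior_tensor (indlim E \<xi>) (fib E t)) (indlim E \<xi>) (ilim_unitary E \<xi> t)"

section \<open>Continuity\<close>

definition hcontinuous_on :: "('b::unital_cstar_algebra, 'e, 'm) hmod_scheme
      \<Rightarrow> 'p::topological_space set \<Rightarrow> ('p \<Rightarrow> 'e) \<Rightarrow> bool" where
  "hcontinuous_on M A f \<longleftrightarrow> f \<in> A \<rightarrow> car M \<and>
     (\<forall>p\<in>A. ((\<lambda>q. hdist M (f q) (f p)) \<longlongrightarrow> 0) (at p within A))"

definition strongly_continuous_vartheta :: "('b::unital_cstar_algebra, 'e) psys \<Rightarrow> (real \<Rightarrow> 'e) \<Rightarrow> bool" where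
  "strongly_continuous_vartheta E \<xi> \<longleftrightarrow>
     (\<forall>a x. adjointable (indlim E \<xi>) a \<longrightarrow> x \<in> car (indlim E \<xi>) \<longrightarrow>
        hcontinuous_on (indlim E \<xi>) {0..} (\<lambda>t. vartheta E \<xi> t a x))"

(* Sections are functions on all reals; their values at negative indices are unconstrained
   and irrelevant. *)
definition cont_sections :: "('b::unital_cstar_algebra, 'e) psys \<Rightarrow> ('b, 'h) hmod
      \<Rightarrow> (real \<Rightarrow> 'e \<Rightarrow> 'h) \<Rightarrow> (real \<Rightarrow> 'e) set" where
  "cont_sections E H i = {x. (\<forall>t\<ge>0. x t \<in> car (fib E t)) \<and> hcontinuous_on H {0..} (\<lambda>t. i t (x t))}"

definition continuous_structure :: "('b::unital_cstar_algebra, 'e) psys \<Rightarrow> ('b, 'h) hmod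
      \<Rightarrow> (real \<Rightarrow> 'e \<Rightarrow> 'h) \<Rightarrow> bool" where
  "continuous_structure E H i \<longleftrightarrow> hilbert_module H \<and>
     (\<forall>t\<ge>0. isometric_embedding (fib E t) H (i t)) \<and>
     (\<forall>s\<ge>0. {x s | x. x \<in> cont_sections E H i} = car (fib E s)) \<and>
     (\<forall>x\<in>cont_sections E H i. \<forall>y\<in>cont_sections E H i.
        hcontinuous_on H ({0..} \<times> {0..}) (\<lambda>(s, t). i (s + t) (pmul E s t (x s) (y t))))"

end

theory Submission
  imports Defs
begin


text \<open>Write h y for the action of y in E_t on h in the inductive limit, so that
  \<theta>_t(a)(h y) = (a h) y. All the analysis takes place near time 0. For units in S,
  <\<zeta>_r, b \<zeta>'_r> tends to b as r decreases to 0. Expanding squared distances turns this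
  into norm statements: \<zeta>_r - \<xi>_r and b \<zeta>_r - \<zeta>_r b tend to 0
  (\<open>unit_near\<close>, \<open>unit_commutes\<close>). Since \<zeta>_s \<zeta>_r = \<zeta>_r
  \<zeta>_s, the elements b \<zeta>_s \<xi>_r and \<xi>_r b \<zeta>_s become close. This property
  passes to products and closed spans; as S generates, x \<xi>_r - \<xi>_r x tends to 0 for every x
  in every fibre (\<open>asym_all\<close>). The inductive limit identifies \<xi>_r x with x, hence h
  \<xi>_r, and likewise h \<zeta>_r, tends to h (\<open>right_shift\<close>,
  \<open>right_shift_unit\<close>).

  For fixed a the operators \<theta>_t(a) are bounded uniformly in t, so strong continuity has to be
  checked only on total sets (\<open>theta_conv_total\<close>). From the right, h y is replaced by
  the nearby vector h \<xi>_r y, which \<theta>_(r+s)(a) sends to (a h) \<xi>_r y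
  (\<open>theta_right_cont\<close>). From the left, vectors h \<zeta>_u y are used: the
  factorisation \<zeta>_u = \<zeta>_r \<zeta>_(u-r) lets the two operators be compared on a common
  right factor (\<open>theta_left_cont\<close>).

  Rank-one operators convert strong continuity into statements about sections. The projection onto
  \<xi> is sent by \<theta>_t to an operator with values in \<xi> E_t that fixes \<xi> E_t; applied
  to a fixed vector \<xi> y it yields a continuous section through y
  (\<open>section_through\<close>). The operator taking \<xi> to h turns \<xi> y_t into h y_t,
  whence the joint continuity of products (\<open>product_continuous\<close>).

  For uniqueness, take any continuous structure in which the units of S are continuous. Varying the
  length of the first factor of a word gives a section through that word, continuous at that time,
  by a formula that is the same for all such structures (\<open>word_section\<close>). How far a
  given section is from a linear combination of these is a distance in a fibre, which no embedding
  changes; so continuity carries over from one structure to another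
  (\<open>cont_sections_subset\<close>).

  The objects themselves need groundwork. Being of the form c* c is equivalent to a norm condition
  that is stable under sums and limits (\<open>cpositive_iff_norm_pos\<close>); this yields the
  Cauchy-Schwarz inequality. A Schur complement argument (\<open>pos_kernel_imp_cpositive\<close>)
  gives both the positivity of the semi-inner product on tensors and the bound for a \<odot> id,
  adjointable operators being bounded (\<open>adjoint_bounded\<close>). The unitaries v_t come from
  total families with equal Gram matrices (\<open>unitary_of_total_families\<close>).\<close>

section \<open>Positive elements of unital C*-algebras\<close>

lemma scaleC_minus_right [simp]: "c *\<^sub>C (- a) = - (c *\<^sub>C (a::'b::unital_cstar_algebra))"
  by (metis add.right_inverse add_eq_0_iff scaleC_add_right add_cancel_right_left)

lemma scaleC_diff_right: "c *\<^sub>C (a - b) = c *\<^sub>C a - c *\<^sub>C (b::'b::unital_cstar_algebra)"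
  using scaleC_add_right[of c a "- b"] by simp

lemma scaleC_minus_left [simp]: "(- c) *\<^sub>C a = - (c *\<^sub>C (a::'b::unital_cstar_algebra))"
  by (metis add.right_inverse add_eq_0_iff scaleC_add_left add_cancel_right_left)

lemma scaleC_ii_ii [simp]: "\<i> *\<^sub>C \<i> *\<^sub>C a = - (a::'b::unital_cstar_algebra)"
proof -
  have "\<i> *\<^sub>C \<i> *\<^sub>C a = complex_of_real (- 1) *\<^sub>C a" by (simp add: scaleC_scaleC)
  then show ?thesis by (simp only: scaleR_scaleC[symmetric]) simp
qed

lemma star_zero [simp]: "star (0::'b::unital_cstar_algebra) = 0"
  using star_add[of "0::'b" 0] by simp

lemma star_minus [simp]: "star (- a) = - star (a::'b::unital_cstar_algebra)"
  using star_add[of a "- a"] by (simp add: eq_neg_iff_add_eq_0 add.commute)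

lemma star_diff [simp]: "star (a - b) = star a - star (b::'b::unital_cstar_algebra)"
  using star_add[of a "- b"] by simp

lemma star_one [simp]: "star (1::'b::unital_cstar_algebra) = 1"
  by (metis mult.left_neutral mult.right_neutral star_mult star_star)

lemma star_scaleR [simp]: "star (r *\<^sub>R a) = r *\<^sub>R star (a::'b::unital_cstar_algebra)"
  by (simp add: scaleR_scaleC star_scaleC)

text \<open>The C*-identity bounds |a|^2 by |a*| |a|, which gives one inequality; the other is the
  same one for the adjoint.\<close>

lemma norm_star [simp]: "norm (star a) = norm (a::'b::unital_cstar_algebra)"
proof -
  have le: "norm (a::'b) \<le> norm (star a)" for a
  proof (cases "a = 0")
    case False
    have "norm a * norm a \<le> norm (star a) * norm a"
      using cstar_identity[of a] norm_mult_ineq[of "star a" a] by (simp add: power2_eq_square)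
    then show ?thesis using False by simp
  qed simp
  from le[of a] le[of "star a"] show ?thesis by (simp add: star_star)
qed

lemma bounded_linear_star: "bounded_linear (star :: 'b::unital_cstar_algebra \<Rightarrow> 'b)"
  by (rule bounded_linear_intro[where K=1]) (auto simp: star_add)

lemmas tendsto_star [tendsto_intros] = bounded_linear.tendsto[OF bounded_linear_star]

lemma norm_square_selfadjoint:
  "star a = a \<Longrightarrow> norm (a * a) = (norm (a::'b::unital_cstar_algebra))\<^sup>2"
  using cstar_identity[of a] by simp

lemma norm_mult_star: "norm (a * star a) = (norm (a::'b::unital_cstar_algebra))\<^sup>2"
  using cstar_identity[of "star a"] by (simp add: star_star)

lemma norm_one_le: "norm (1::'b::unital_cstar_algebra) \<le> 1"
proof -
  have "norm (1::'b) = (norm (1::'b))\<^sup>2" using cstar_identity[of "1::'b"] by simp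
  then have "norm (1::'b) * (norm (1::'b) - 1) = 0" by (simp add: power2_eq_square algebra_simps)
  then show ?thesis by auto
qed

lemma norm_unitary_le: "star u * u = 1 \<Longrightarrow> norm (u::'b::unital_cstar_algebra) \<le> 1"
  using cstar_identity[of u] norm_one_le[where 'b='b]
  by (metis norm_ge_zero power2_le_imp_le one_power2 zero_le_one)

text \<open>The iteration y' = (x + y y)/2 for 1 - sqrt (1 - x) is dominated termwise by the same
  iteration started with the real number 1, which increases to 1.\<close>

lemma sqrt_one_minus:
  fixes x :: "'b::unital_cstar_algebra"
  assumes x: "norm x \<le> 1" and sx: "star x = x"
  shows "\<exists>h. star h = h \<and> norm (1 - h) \<le> 1 \<and> h * h = 1 - x \<and> (\<forall>c. c * x = x * c \<longrightarrow> c * h = h * c)"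
proof -
  define y where "y = rec_nat 0 (\<lambda>_ z. (1/2) *\<^sub>R (x + z * z))"
  define r where "r = rec_nat 0 (\<lambda>_ z::real. (1 + z * z) / 2)"
  have y0: "y 0 = 0" and yS: "y (Suc n) = (1/2) *\<^sub>R (x + y n * y n)" for n by (auto simp: y_def)
  have r0: "r 0 = 0" and rS: "r (Suc n) = (1 + r n * r n) / 2" for n by (auto simp: r_def)
  have comm: "c * x = x * c \<Longrightarrow> c * y n = y n * c" for c n
  proof (induction n)
    case (Suc n)
    then have "c * y n = y n * c" by simp
    then have "c * (y n * y n) = y n * y n * c" by (metis mult.assoc)
    with Suc.prems show ?case by (simp add: yS distrib_left distrib_right)
  qed (simp add: y0)
  have yx: "y n * x = x * y n" for n using comm[of x n] by simp
  then have yy: "y n * y m = y m * y n" for n m using comm[of "y n" m] by simp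
  have r01: "0 \<le> r n \<and> r n \<le> 1" for n
  proof (induction n)
    case (Suc n)
    then have "r n * r n \<le> 1 * 1" by (intro mult_mono) auto
    then show ?case by (simp add: rS)
  qed (simp add: r0)
  \<comment> \<open>The increment is (1 - r n)^2 / 2.\<close>
  have rinc: "r n \<le> r (Suc n)" for n
  proof -
    have "0 \<le> (1 - r n) * (1 - r n)" by simp
    then show ?thesis by (simp add: rS algebra_simps)
  qed
  have ny: "norm (y n) \<le> r n" for n
  proof (induction n)
    case (Suc n)
    have "norm (y n * y n) \<le> r n * r n"
      by (rule order_trans[OF norm_mult_ineq]) (intro mult_mono Suc r01[THEN conjunct1] norm_ge_zero)
    then have "norm (x + y n * y n) \<le> 1 + r n * r n" using x norm_triangle_ineq[of x "y n * y n"] by linarith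
    then show ?case by (simp add: yS rS)
  qed (simp add: y0 r0)
  have ndiff: "norm (y (Suc n) - y n) \<le> r (Suc n) - r n" for n
  proof (induction n)
    case 0 then show ?case using x by (simp add: yS rS y0 r0)
  next
    case (Suc n)
    \<comment> \<open>All iterates commute, so the difference of squares factorises as for
      numbers.\<close>
    have "y (Suc (Suc n)) - y (Suc n) = (1/2) *\<^sub>R ((y (Suc n) - y n) * (y (Suc n) + y n))"
    proof -
      have "y (Suc (Suc n)) - y (Suc n) = (1/2) *\<^sub>R (y (Suc n) * y (Suc n) - y n * y n)"
        unfolding yS[of "Suc n"] by (subst (3) yS[of n]) (simp flip: scaleR_diff_right)
      then show ?thesis using yy[of n "Suc n"] by (simp add: algebra_simps)
    qed
    also have "norm \<dots> \<le> 1/2 * ((r (Suc n) - r n) * (r (Suc n) + r n))"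
      unfolding norm_scaleR
      by (intro mult_mono order_trans[OF norm_mult_ineq] order_trans[OF norm_triangle_ineq] add_mono Suc ny)
         (use rinc[of n] r01[of n] in auto)
    also have "\<dots> = r (Suc (Suc n)) - r (Suc n)"
      by (simp add: rS[of "Suc n"] rS[of n] algebra_simps)
    finally show ?case .
  qed
  have "convergent r"
    by (rule Bseq_mono_convergent)
       (use r01 in \<open>auto intro!: BseqI'[of _ 1] incseq_SucI rinc lift_Suc_mono_le simp: mono_def\<close>)
  then have "summable (\<lambda>n. r (Suc n) - r n)"
    unfolding convergent_def using telescope_summable by blast
  then have "summable (\<lambda>n. y (Suc n) - y n)"
    using ndiff by (rule summable_comparison_test')
  then have "convergent (\<lambda>n. \<Sum>k<n. y (Suc k) - y k)"
    by (simp add: summable_iff_convergent)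
  then have "convergent y" by (simp add: sum_lessThan_telescope y0)
  then obtain l where l: "y \<longlonglongrightarrow> l" by (auto simp: convergent_def)
  have "(\<lambda>n. (1/2) *\<^sub>R (x + y n * y n)) \<longlonglongrightarrow> (1/2) *\<^sub>R (x + l * l)"
    by (intro tendsto_intros l)
  moreover have "(\<lambda>n. (1/2) *\<^sub>R (x + y n * y n)) \<longlonglongrightarrow> l"
    using LIMSEQ_Suc[OF l] by (simp add: yS)
  ultimately have "(1/2) *\<^sub>R (x + l * l) = l" by (rule LIMSEQ_unique)
  then have "2 *\<^sub>R ((1/2) *\<^sub>R (x + l * l)) = 2 *\<^sub>R l" by simp
  \<comment> \<open>The fixed-point equation of the iteration, which says (1 - l)^2 = 1 - x.\<close>
  then have ll: "x + l * l = l + l" by (simp add: scaleR_2)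
  have sy: "star (y n) = y n" for n
    by (induction n) (auto simp: y0 yS sx star_add star_mult)
  have "(\<lambda>n. star (y n)) \<longlonglongrightarrow> star l" by (intro tendsto_intros l)
  then have sl: "star l = l" using l LIMSEQ_unique by (simp add: sy)
  have cl: "c * l = l * c" if "c * x = x * c" for c
  proof -
    have "(\<lambda>n. c * y n) \<longlonglongrightarrow> c * l" "(\<lambda>n. y n * c) \<longlonglongrightarrow> l * c" by (intro tendsto_intros l)+
    then show ?thesis using comm[OF that] LIMSEQ_unique by simp
  qed
  have "(1 - l) * (1 - l) = 1 - x"
    using ll by (simp add: algebra_simps)
  moreover have "norm l \<le> 1"
    by (rule LIMSEQ_le_const2[OF tendsto_norm[OF l]]) (use order_trans[OF ny r01[THEN conjunct2]] in blast)
  then have "norm (1 - (1 - l)) \<le> 1" by simp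
  moreover have "star (1 - l) = 1 - l" by (simp add: sl)
  moreover have "\<forall>c. c * x = x * c \<longrightarrow> c * (1 - l) = (1 - l) * c"
    by (simp add: cl right_diff_distrib left_diff_distrib)
  ultimately show ?thesis by blast
qed

text \<open>Positivity expressed by the norm: for self-adjoint \<open>a\<close> the spectrum lies in
  [0, 2 l]. Sums and limits are easy in this form, whereas they are not for the form
  \<open>star c * c\<close> of \<open>cpositive\<close>.\<close>

definition norm_pos :: "'b::unital_cstar_algebra \<Rightarrow> bool" where
  "norm_pos a \<longleftrightarrow> star a = a \<and> (\<exists>l\<ge>0. norm (l *\<^sub>R 1 - a) \<le> l)"

text \<open>Rescaling makes a / l of the form 1 - x with x of norm at most 1, where
  \<open>sqrt_one_minus\<close> applies. The commutation clause takes the place of functional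
  calculus: roots of commuting elements can be multiplied.\<close>

lemma norm_pos_sqrt:
  fixes a :: "'b::unital_cstar_algebra"
  assumes "norm_pos a"
  shows "\<exists>h. norm_pos h \<and> star h = h \<and> h * h = a \<and> (\<forall>c. c * a = a * c \<longrightarrow> c * h = h * c)"
proof -
  obtain l where l: "l \<ge> 0" "norm (l *\<^sub>R 1 - a) \<le> l" and sa: "star a = a"
    using assms by (auto simp: norm_pos_def)
  show ?thesis
  proof (cases "l = 0")
    case True
    then have "a = 0" using l by simp
    then show ?thesis by (intro exI[of _ 0]) (auto simp: norm_pos_def)
  next
    case False
    define x where "x = (1/l) *\<^sub>R (l *\<^sub>R 1 - a)"
    have "norm x \<le> 1" using l False by (simp add: x_def divide_le_eq)
    moreover have "star x = x" by (simp add: x_def sa)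
    ultimately obtain h where h: "star h = h" "h * h = 1 - x" "\<And>c. c * x = x * c \<Longrightarrow> c * h = h * c"
      and h1: "norm (1 - h) \<le> 1"
      using sqrt_one_minus by metis
    have "norm (sqrt l *\<^sub>R (1 - h)) \<le> sqrt l * 1"
      unfolding norm_scaleR using l h1 by (intro mult_mono) auto
    then have "norm_pos (sqrt l *\<^sub>R h)"
      using h(1) l by (auto simp: norm_pos_def scaleR_diff_right intro!: exI[of _ "sqrt l"])
    moreover have "l *\<^sub>R (1 - x) = a" using False by (simp add: x_def algebra_simps)
    then have "(sqrt l *\<^sub>R h) * (sqrt l *\<^sub>R h) = a" using h(2) l by simp
    moreover have "c * h = h * c" if "c * a = a * c" for c
      using that by (intro h(3)) (simp add: x_def algebra_simps)
    then have "\<forall>c. c * a = a * c \<longrightarrow> c * (sqrt l *\<^sub>R h) = (sqrt l *\<^sub>R h) * c" by simp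
    moreover have "star (sqrt l *\<^sub>R h) = sqrt l *\<^sub>R h" by (simp add: h(1))
    ultimately show ?thesis by blast
  qed
qed

text \<open>If h and g are commuting and self-adjoint with h h + g g = 1, then h + i g is unitary, so h
  and g are contractions.\<close>

lemma norm_le_one_of_squares:
  fixes g h :: "'b::unital_cstar_algebra"
  assumes "star h = h" "star g = g" "h * g = g * h" "h * h + g * g = 1"
  shows "norm h \<le> 1" "norm g \<le> 1"
proof -
  have *: "norm h \<le> 1" if sg: "star g = g" "star h = h" "h * g = g * h" "h * h + g * g = 1" for g h :: 'b
  proof -
    define u where "u = h + \<i> *\<^sub>C g"
    have su: "star u = h + (- \<i>) *\<^sub>C g" by (simp add: u_def star_add star_scaleC sg)
    have "star u * u = h * h + g * g"
    proof -
      have "star u * u = (h - \<i> *\<^sub>C g) * (h + \<i> *\<^sub>C g)" by (simp add: su) (simp add: u_def)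
      then show ?thesis by (simp add: algebra_simps mult_scaleC_left mult_scaleC_right scaleC_diff_right sg)
    qed
    then have "norm u \<le> 1" using norm_unitary_le sg by simp
    moreover have "2 *\<^sub>R h = u + star u" by (simp only: su) (simp add: u_def scaleR_2)
    then have "norm (2 *\<^sub>R h) \<le> norm u + norm u" using norm_triangle_ineq[of u "star u"] by simp
    ultimately show ?thesis by simp
  qed
  from *[of g h] *[of h g] assms show "norm h \<le> 1" "norm g \<le> 1" by (auto simp: add.commute)
qed

text \<open>After rescaling to k = h / sqrt l, the root g of 1 - k k commutes with k and k k + g g =
  1. Hence g is a contraction, and so is g g = 1 - k k.\<close>

lemma norm_square_pos_aux:
  fixes h :: "'b::unital_cstar_algebra"
  assumes sh: "star h = h" and l: "norm (h * h) \<le> l"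
  shows "norm (l *\<^sub>R 1 - h * h) \<le> l"
proof (cases "l = 0")
  case True then show ?thesis using l by simp
next
  case False
  then have l0: "l > 0" using l norm_ge_zero[of "h * h"] by linarith
  define k where "k = (1 / sqrt l) *\<^sub>R h"
  have kk: "k * k = (1/l) *\<^sub>R (h * h)" using l0 by (simp add: k_def)
  have "norm (k * k) \<le> 1" using l l0 by (simp add: kk field_simps)
  moreover have "star (k * k) = k * k" by (simp add: kk star_mult sh)
  ultimately obtain g where g: "star g = g" "g * g = 1 - k * k" and gc: "\<forall>c. c * (k * k) = k * k * c \<longrightarrow> c * g = g * c"
    using sqrt_one_minus[of "k * k"] by blast
  have "k * g = g * k" using gc by (simp add: mult.assoc)
  then have "norm g \<le> 1"
    using norm_le_one_of_squares(2)[of k g] g sh by (simp add: k_def)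
  then have "norm (g * g) \<le> 1" using norm_square_selfadjoint[OF g(1)] by (simp add: power_le_one)
  then have "norm (l *\<^sub>R (1 - k * k)) \<le> l" using l0 g(2) by simp
  then show ?thesis using l0 by (simp add: kk algebra_simps)
qed

lemma norm_pos_iff_square: "norm_pos a \<longleftrightarrow> (\<exists>h. star h = h \<and> h * h = (a::'b::unital_cstar_algebra))"
proof
  assume "\<exists>h. star h = h \<and> h * h = a"
  then obtain h where h: "star h = h" "h * h = a" by blast
  then show "norm_pos a" unfolding norm_pos_def
    using norm_square_pos_aux[OF h(1), of "norm a"] by (auto simp: star_mult intro!: exI[of _ "norm a"])
qed (use norm_pos_sqrt in blast)

lemma norm_pos_norm_diff:
  assumes "norm_pos a" "norm a \<le> l"
  shows "norm (l *\<^sub>R 1 - a) \<le> (l::real)"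
  using assms norm_square_pos_aux unfolding norm_pos_iff_square by blast

lemma norm_pos_add: "norm_pos a \<Longrightarrow> norm_pos b \<Longrightarrow> norm_pos (a + b)"
proof -
  assume "norm_pos a" "norm_pos b"
  then obtain l m where *: "l \<ge> 0" "m \<ge> 0" "norm (l *\<^sub>R 1 - a) \<le> l" "norm (m *\<^sub>R 1 - b) \<le> m" "star a = a" "star b = b"
    by (auto simp: norm_pos_def)
  have "norm ((l + m) *\<^sub>R 1 - (a + b)) \<le> l + m"
    using norm_triangle_ineq[of "l *\<^sub>R 1 - a" "m *\<^sub>R 1 - b"] * by (simp add: algebra_simps)
  then show ?thesis using * by (auto simp: norm_pos_def star_add intro!: exI[of _ "l + m"])
qed

lemma norm_pos_scaleR: "norm_pos a \<Longrightarrow> r \<ge> 0 \<Longrightarrow> norm_pos (r *\<^sub>R a)"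
proof -
  assume "norm_pos a" and r: "r \<ge> 0"
  then obtain h where h: "star h = h" "h * h = a" unfolding norm_pos_iff_square by blast
  then show ?thesis unfolding norm_pos_iff_square
    using r by (intro exI[of _ "sqrt r *\<^sub>R h"]) auto
qed

lemma norm_pos_norm_minus:
  assumes "star a = a" "norm a \<le> l"
  shows "norm_pos (l *\<^sub>R 1 - a)"
  using assms order_trans[OF norm_ge_zero assms(2)] by (auto simp: norm_pos_def intro!: exI[of _ l])

text \<open>For l slightly above the norm of b, l - a = (b - a) + (l - b) is positive. Commuting
  roots h of a / l and g of 1 - a / l satisfy h h + g g = 1, so h is a contraction and the norm of a
  is at most l.\<close>

lemma norm_pos_mono:
  fixes a b :: "'b::unital_cstar_algebra"
  assumes a: "norm_pos a" and ba: "norm_pos (b - a)"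
  shows "norm a \<le> norm b"
proof (rule field_le_epsilon)
  fix e :: real assume "e > 0"
  define l where "l = norm b + e"
  have l: "l > 0" using \<open>e > 0\<close> norm_ge_zero[of b] unfolding l_def by linarith
  have sb: "star b = b" using a ba by (auto simp: norm_pos_def)
  have "norm_pos ((b - a) + (l *\<^sub>R 1 - b))"
    by (intro norm_pos_add ba norm_pos_norm_minus sb) (use \<open>e > 0\<close> in \<open>simp add: l_def\<close>)
  then have "norm_pos ((1/l) *\<^sub>R (l *\<^sub>R 1 - a))" using l by (intro norm_pos_scaleR) auto
  then have *: "norm_pos (1 - (1/l) *\<^sub>R a)" using l by (simp add: algebra_simps)
  obtain h0 where h0: "star h0 = h0" "h0 * h0 = a" using norm_pos_sqrt[OF a] by blast
  define h where "h = (1 / sqrt l) *\<^sub>R h0"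
  have hh: "h * h = (1/l) *\<^sub>R a" using l by (simp add: h_def h0)
  have sh: "star h = h" by (simp add: h_def h0)
  from * obtain g where g: "star g = g" "g * g = 1 - h * h" and gc: "\<forall>c. c * (1 - h * h) = (1 - h * h) * c \<longrightarrow> c * g = g * c"
    using norm_pos_sqrt[of "1 - h * h"] unfolding hh by blast
  have "h * g = g * h" using gc by (simp add: algebra_simps)
  then have "norm h \<le> 1" using norm_le_one_of_squares(1)[of h g] g sh by simp
  then have "norm (h * h) \<le> 1" using norm_square_selfadjoint[OF sh] by (simp add: power_le_one)
  then show "norm a \<le> norm b + e" using l by (simp add: hh field_simps l_def)
qed

text \<open>The constant in \<open>norm_pos\<close> can always be taken to be the norm of the
  element (\<open>norm_pos_norm_diff\<close>), and this choice is continuous.\<close>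

lemma norm_pos_closed:
  assumes "\<And>n. norm_pos (a n)" "a \<longlonglongrightarrow> l"
  shows "norm_pos (l::'b::unital_cstar_algebra)"
proof -
  have "(\<lambda>n. star (a n)) \<longlonglongrightarrow> star l" by (intro tendsto_intros assms)
  then have "star l = l" using assms LIMSEQ_unique by (simp add: norm_pos_def)
  moreover have "(\<lambda>n. norm (norm (a n) *\<^sub>R 1 - a n)) \<longlonglongrightarrow> norm (norm l *\<^sub>R 1 - l)"
    by (intro tendsto_intros assms)
  then have "norm (norm l *\<^sub>R 1 - l) \<le> norm l"
    by (rule LIMSEQ_le[OF _ tendsto_norm[OF assms(2)]]) (use assms(1) norm_pos_norm_diff in auto)
  ultimately show ?thesis unfolding norm_pos_def using norm_ge_zero by blast
qed

text \<open>If both d d* and - d* d are positive and d has norm 1, then q = d d* satisfies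
  q (1 + q)^2 = d (1 + d* d)^2 d*, whose norm is at most 1, although q (1 + q)^2 dominates 2 q^2,
  which has norm 2.\<close>

lemma neg_norm_pos_imp_zero_aux:
  fixes d :: "'b::unital_cstar_algebra"
  assumes p: "norm_pos (- (star d * d))" and q: "norm_pos (d * star d)" and d: "norm d = 1"
  shows False
proof -
  define q where "q = d * star d"
  have sq: "star q = q" by (simp add: q_def star_mult star_star)
  have nq: "norm q = 1" using d by (simp add: q_def norm_mult_star)
  have "norm (1 *\<^sub>R 1 - (- (star d * d))) \<le> 1"
    by (rule norm_pos_norm_diff[OF p]) (simp add: cstar_identity d)
  then have n1: "norm (1 + star d * d) \<le> 1" by simp
  have eq: "q + q * q + q * q + q * q * q = d * ((1 + star d * d) * (1 + star d * d)) * star d"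
    by (simp add: q_def algebra_simps)
  have "norm (d * ((1 + star d * d) * (1 + star d * d)) * star d) \<le> norm d * (1 * 1) * norm (star d)"
    by (intro order_trans[OF norm_mult_ineq] mult_mono n1 mult_nonneg_nonneg norm_ge_zero order.refl) auto
  then have le: "norm (q + q * q + q * q + q * q * q) \<le> 1" by (simp add: eq d)
  obtain h where h: "star h = h" "h * h = q" using norm_pos_sqrt[of q] q by (auto simp: q_def)
  \<comment> \<open>The cube of \<open>q\<close> is positive, being the square of the self-adjoint
    element \<open>h * q\<close>.\<close>
  have "q * q * q = (h * q) * (q * h)" using h(2) by (metis mult.assoc)
  moreover have "h * q = q * h" using h(2) by (metis mult.assoc)
  ultimately have "q * q * q = (h * q) * (h * q)" by simp
  moreover have "star (h * q) = h * q" using \<open>h * q = q * h\<close> h(1) sq by (simp add: star_mult)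
  ultimately have p3: "norm_pos (q * q * q)" unfolding norm_pos_iff_square by metis
  have p2: "norm_pos (q * q)" using sq norm_pos_iff_square by blast
  have "norm (q * q + q * q) \<le> norm (q + q * q + q * q + q * q * q)"
  proof (rule norm_pos_mono)
    have "norm_pos (q + q * q * q)" using q p3 by (simp add: norm_pos_add q_def)
    then show "norm_pos (q + q * q + q * q + q * q * q - (q * q + q * q))" by (simp add: algebra_simps)
  qed (intro norm_pos_add p2)
  also have "q * q + q * q = 2 *\<^sub>R (q * q)" by (simp add: scaleR_2)
  finally show False using le nq norm_square_selfadjoint[OF sq] by simp
qed

lemma neg_norm_pos_imp_zero:
  fixes d :: "'b::unital_cstar_algebra"
  assumes p: "norm_pos (- (star d * d))"
  shows "d = 0"
proof (rule ccontr)
  assume d0: "d \<noteq> 0"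
  define e where "e = (1 / norm d) *\<^sub>R d"
  have ne: "norm e = 1" using d0 by (simp add: e_def)
  have "- (star e * e) = (1 / norm d * (1 / norm d)) *\<^sub>R (- (star d * d))" by (simp add: e_def)
  then have pe: "norm_pos (- (star e * e))" using p by (metis norm_pos_scaleR zero_le_square)
  define x where "x = e + star e"
  define y where "y = \<i> *\<^sub>C (e - star e)"
  have sx: "star x = x" by (simp add: x_def star_add star_star)
  have sy: "star y = y"
    by (simp add: y_def star_scaleC star_star scaleC_diff_right)
  have "x * x + y * y = 2 *\<^sub>R (star e * e + e * star e)"
    by (simp add: x_def y_def mult_scaleC_left mult_scaleC_right algebra_simps scaleC_diff_right scaleR_2)
  moreover have "norm_pos (x * x + y * y)"
    by (intro norm_pos_add) (use sx sy in \<open>auto simp: norm_pos_iff_square\<close>)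
  ultimately have "norm_pos ((1/2) *\<^sub>R (2 *\<^sub>R (star e * e + e * star e)))"
    by (metis norm_pos_scaleR zero_le_divide_1_iff zero_le_numeral)
  then have "norm_pos (star e * e + e * star e + - (star e * e))"
    using pe by (intro norm_pos_add[of "star e * e + e * star e"]) simp_all
  then have "norm_pos (e * star e)" by simp
  with neg_norm_pos_imp_zero_aux[OF pe] ne show False by blast
qed

text \<open>With n = |a| - a one has n a = - |a| n, so for a = c* c and d = c n the element - d* d = |a| n n is
  positive; hence d = 0, which forces n = 0.\<close>

lemma cpositive_iff_norm_pos: "cpositive a \<longleftrightarrow> norm_pos (a::'b::unital_cstar_algebra)"
proof
  assume "cpositive a"
  then obtain c where c: "a = star c * c" by (auto simp: cpositive_def)
  have sa: "star a = a" by (simp add: c star_mult star_star)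
  have "norm_pos (a * a)" using sa norm_pos_iff_square by blast
  then obtain m where m: "star m = m" "m * m = a * a" and mc: "\<forall>x. x * (a * a) = a * a * x \<longrightarrow> x * m = m * x"
    and m_pos: "norm_pos m"
    using norm_pos_sqrt by blast
  have am: "a * m = m * a" using mc by (simp add: mult.assoc)
  define n where "n = m - a"
  have sn: "star n = n" by (simp add: n_def m sa)
  have na: "n * a = - (m * n)" using am m(2) by (simp add: n_def algebra_simps)
  have mn: "m * n = n * m" using am by (simp add: n_def algebra_simps)
  have nn: "n * n = 2 *\<^sub>R (m * n)" using am m(2) by (simp add: n_def algebra_simps scaleR_2)
  \<comment> \<open>\<open>m\<close> is the absolute value of \<open>a\<close>; its root
    \<open>k\<close> exhibits m n n as the square of the self-adjoint element
    \<open>k * n\<close>.\<close>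
  obtain k where k: "star k = k" "k * k = m" and kc: "\<forall>x. x * m = m * x \<longrightarrow> x * k = k * x"
    using norm_pos_sqrt[OF m_pos] by blast
  have nk: "n * k = k * n" using kc by (simp add: mn)
  define d where "d = c * n"
  have "star d * d = n * a * n" by (simp add: d_def star_mult sn c mult.assoc)
  also have "\<dots> = - (k * k * n * n)" by (simp add: na k(2))
  also have "k * k * n * n = (k * n) * (k * n)" using nk by (metis mult.assoc)
  finally have dd: "- (star d * d) = (k * n) * (k * n)" by simp
  have skn: "star (k * n) = k * n" by (simp add: star_mult sn k(1) nk)
  then have "norm_pos (- (star d * d))" unfolding norm_pos_iff_square dd by blast
  then have "d = 0" by (rule neg_norm_pos_imp_zero)
  then have "(k * n) * (k * n) = 0" using dd by simp
  then have "k * n = 0" using norm_square_selfadjoint[OF skn] by simp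
  then have "n * n = 0" using nn k(2) by (metis mult.assoc mult_zero_right scaleR_zero_right)
  then have "n = 0" using norm_square_selfadjoint[OF sn] by simp
  then show "norm_pos a" using m_pos by (simp add: n_def)
next
  assume "norm_pos a"
  then show "cpositive a" unfolding norm_pos_iff_square cpositive_def by metis
qed


section \<open>The positive cone and invertible perturbations\<close>

lemma cpositive_add: "cpositive a \<Longrightarrow> cpositive b \<Longrightarrow> cpositive (a + b)"
  by (simp add: cpositive_iff_norm_pos norm_pos_add)

lemma cpositive_scaleR: "cpositive a \<Longrightarrow> r \<ge> 0 \<Longrightarrow> cpositive (r *\<^sub>R a)"
  by (simp add: cpositive_iff_norm_pos norm_pos_scaleR)

lemma cpositive_zero [simp]: "cpositive 0"
  by (auto simp: cpositive_def intro!: exI[of _ 0])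

lemma cpositive_conj: "cpositive a \<Longrightarrow> cpositive (star c * a * c)"
  unfolding cpositive_def by (metis star_mult mult.assoc)

lemma cpositive_lim: "(\<And>n. cpositive (a n)) \<Longrightarrow> a \<longlonglongrightarrow> l \<Longrightarrow> cpositive l"
  unfolding cpositive_iff_norm_pos by (rule norm_pos_closed)

lemma cpositive_norm_mono: "cpositive a \<Longrightarrow> cpositive (b - a) \<Longrightarrow> norm a \<le> norm b"
  unfolding cpositive_iff_norm_pos by (rule norm_pos_mono)

lemma cpositive_norm_minus: "star a = a \<Longrightarrow> norm a \<le> l \<Longrightarrow> cpositive (l *\<^sub>R 1 - a)"
  unfolding cpositive_iff_norm_pos by (rule norm_pos_norm_minus)

text \<open>The closedness of the cone in the form needed for perturbation arguments, in which a
  positive element is first made invertible by adding a small multiple of \<open>1\<close>.\<close>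

lemma cpositive_of_eps:
  assumes "\<And>e. e > 0 \<Longrightarrow> cpositive (a + e *\<^sub>R b)"
  shows "cpositive a"
proof (rule cpositive_lim)
  show "cpositive (a + (1 / real (Suc n)) *\<^sub>R b)" for n by (rule assms) simp
  have "(\<lambda>n. a + (1 / real (Suc n)) *\<^sub>R b) \<longlonglongrightarrow> a + 0 *\<^sub>R b"
    by (intro tendsto_intros LIMSEQ_Suc[OF lim_1_over_n])
  then show "(\<lambda>n. a + (1 / real (Suc n)) *\<^sub>R b) \<longlonglongrightarrow> a" by simp
qed

text \<open>a + e equals m (1 - q) with m = |a| + e and q of norm below 1. One-sided inverses of 1 -
  q are fixed points of the contractions c -> 1 + q c and c -> 1 + c q. A root of an invertible
  element is invertible.\<close>

lemma cpositive_plus_eps_invertible_sqrt: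
  fixes a :: "'b::unital_cstar_algebra"
  assumes a: "cpositive a" and e: "e > 0"
  shows "\<exists>h k. star h = h \<and> star k = k \<and> h * k = 1 \<and> k * h = 1 \<and> h * h = a + e *\<^sub>R 1"
proof -
  define p where "p = a + e *\<^sub>R 1"
  define m where "m = norm a + e"
  have m: "m > 0" using e norm_ge_zero[of a] unfolding m_def by linarith
  define q where "q = (1/m) *\<^sub>R (norm a *\<^sub>R 1 - a)"
  have "norm (norm a *\<^sub>R 1 - a) \<le> norm a"
    using a norm_pos_norm_diff[of a "norm a"] by (simp add: cpositive_iff_norm_pos)
  then have "norm q \<le> norm a / m" using m by (simp add: q_def divide_right_mono)
  also have "\<dots> < 1" using m e by (simp add: m_def)
  finally have q: "norm q < 1" .
  have "m *\<^sub>R q = norm a *\<^sub>R 1 - a" using m by (simp add: q_def)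
  then have q1: "m *\<^sub>R (1 - q) = p"
    by (simp add: p_def m_def scaleR_diff_right scaleR_add_left)
  have "\<exists>!c\<in>UNIV. 1 + q * c = c"
    by (rule Banach_fix[of UNIV "norm q"])
      (use q in \<open>auto simp: complete_UNIV dist_norm norm_mult_ineq right_diff_distrib[symmetric]\<close>)
  then obtain c where c: "1 + q * c = c" by blast
  have "\<exists>!c\<in>UNIV. 1 + c * q = c"
    by (rule Banach_fix[of UNIV "norm q"])
      (use q in \<open>auto simp: complete_UNIV dist_norm mult.commute[of "norm q"] norm_mult_ineq left_diff_distrib[symmetric]\<close>)
  then obtain d where d: "1 + d * q = d" by blast
  have "p * ((1/m) *\<^sub>R c) = 1" using c m unfolding q1[symmetric] by (simp add: algebra_simps)
  moreover have "((1/m) *\<^sub>R d) * p = 1" using d m unfolding q1[symmetric] by (simp add: algebra_simps)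
  moreover have "cpositive (e *\<^sub>R (1::'b))"
    using e by (intro cpositive_scaleR) (auto simp: cpositive_def intro!: exI[of _ 1])
  then have "norm_pos p" using a by (simp add: p_def cpositive_add flip: cpositive_iff_norm_pos)
  then obtain h where h: "star h = h" "h * h = p" using norm_pos_iff_square by blast
  \<comment> \<open>\<open>h * u\<close> is a right inverse of \<open>h\<close> and
    \<open>v * h\<close> a left inverse, so they coincide.\<close>
  ultimately obtain u v where u: "h * (h * u) = 1" and v: "(v * h) * h = 1" by (metis mult.assoc)
  have uv: "v * h = h * u" by (metis u v mult.assoc mult.left_neutral mult.right_neutral)
  have "star (h * u) * h = 1" using u by (metis h(1) star_mult star_one)
  then have "star (h * u) = h * u" by (metis u mult.assoc mult.left_neutral mult.right_neutral)
  then show ?thesis using h u v uv unfolding p_def by metis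
qed


section \<open>Modules with a semi-inner product\<close>

text \<open>The common core of Hilbert modules, lists of elementary tensors and pairs (t, x) of the
  algebraic inductive limit. In the last two the module laws fail as equations, so only the rules
  for the semi-inner product are demanded.\<close>

locale prehilbert =
  fixes M :: "('b::unital_cstar_algebra, 'e, 'm) hmod_scheme"
  assumes zero_mem [simp, intro]: "hzero M \<in> car M"
    and add_mem [simp, intro]: "\<lbrakk>x \<in> car M; y \<in> car M\<rbrakk> \<Longrightarrow> hadd M x y \<in> car M"
    and ract_mem [simp, intro]: "x \<in> car M \<Longrightarrow> ract M x b \<in> car M"
    and ip_add_right [simp]: "\<lbrakk>x \<in> car M; y \<in> car M; z \<in> car M\<rbrakk>
          \<Longrightarrow> ip M x (hadd M y z) = ip M x y + ip M x z"
    and ip_ract_right [simp]: "\<lbrakk>x \<in> car M; y \<in> car M\<rbrakk> \<Longrightarrow> ip M x (ract M y b) = ip M x y * b"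
    and ip_zero_right [simp]: "x \<in> car M \<Longrightarrow> ip M x (hzero M) = 0"
    and ip_sym: "\<lbrakk>x \<in> car M; y \<in> car M\<rbrakk> \<Longrightarrow> star (ip M x y) = ip M y x"
    and ip_pos: "x \<in> car M \<Longrightarrow> cpositive (ip M x x)"
begin

lemma ip_add_left [simp]: "\<lbrakk>x \<in> car M; y \<in> car M; z \<in> car M\<rbrakk>
    \<Longrightarrow> ip M (hadd M y z) x = ip M y x + ip M z x"
  using arg_cong[OF ip_add_right[of x y z], of star]
  by (simp add: star_add ip_sym del: ip_add_right)

lemma ip_ract_left [simp]: "\<lbrakk>x \<in> car M; y \<in> car M\<rbrakk> \<Longrightarrow> ip M (ract M y b) x = star b * ip M y x"
  using arg_cong[OF ip_ract_right[of x y b], of star]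
  by (simp add: star_mult ip_sym del: ip_ract_right)

lemma ip_zero_left [simp]: "x \<in> car M \<Longrightarrow> ip M (hzero M) x = 0"
  using arg_cong[OF ip_zero_right[of x], of star]
  by (simp add: ip_sym del: ip_zero_right)

lemma hnorm_nonneg [simp]: "hnorm M x \<ge> 0" by (simp add: hnorm_def)

lemma hnorm_sq: "(hnorm M x)\<^sup>2 = norm (ip M x x)" by (simp add: hnorm_def)

lemma hnorm_zero [simp]: "hnorm M (hzero M) = 0" by (simp add: hnorm_def)

lemma hnorm_leI: "norm (ip M x x) \<le> r\<^sup>2 \<Longrightarrow> r \<ge> 0 \<Longrightarrow> hnorm M x \<le> r"
  by (metis hnorm_sq power2_le_imp_le)

text \<open>Let a = <x, y> and let l be the norm of <x, x>. Positivity of <z, z> for z = y - x a /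
  (l + e), combined with <x, x> <= l + e, gives a* a <= (l + e) <y, y>. Taking e > 0 covers the case
  l = 0; then e tends to 0.\<close>

lemma cauchy_schwarz:
  assumes x: "x \<in> car M" and y: "y \<in> car M"
  shows "norm (ip M x y) \<le> hnorm M x * hnorm M y"
proof -
  define a where "a = ip M x y"
  have sa: "ip M y x = star a" using ip_sym[OF x y] by (simp add: a_def)
  define l where "l = norm (ip M x x)"
  have key: "(norm a)\<^sup>2 \<le> (l + e) * norm (ip M y y)" if e: "e > 0" for e
  proof -
    have le: "l + e > 0" using e norm_ge_zero[of "ip M x x"] unfolding l_def by linarith
    define m where "m = 1 / (l + e)"
    have m0: "m > 0" and ml: "m * (l + e) = 1" using le by (auto simp: m_def)
    define z where "z = hadd M y (ract M x (- (m *\<^sub>R a)))"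
    have "cpositive (ip M z z)" using x y by (intro ip_pos) (simp add: z_def)
    also have "ip M z z = ip M y y - (2 * m) *\<^sub>R (star a * a) + (m * m) *\<^sub>R (star a * ip M x x * a)"
      using x y sa a_def by (simp add: z_def algebra_simps scaleR_2 flip: scaleR_scaleR)
    finally have 1: "cpositive (ip M y y - (2 * m) *\<^sub>R (star a * a) + (m * m) *\<^sub>R (star a * ip M x x * a))" .
    have "cpositive (star a * ((l + e) *\<^sub>R 1 - ip M x x) * a)"
      by (intro cpositive_conj cpositive_norm_minus) (use ip_sym[OF x x] e in \<open>auto simp: l_def\<close>)
    then have "cpositive ((m * m) *\<^sub>R (star a * ((l + e) *\<^sub>R 1 - ip M x x) * a))"
      by (rule cpositive_scaleR) simp
    from cpositive_add[OF 1 this]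
    have "cpositive (ip M y y - (2 * m) *\<^sub>R (star a * a) + (m * (m * (l + e))) *\<^sub>R (star a * a))"
      by (simp add: algebra_simps)
    moreover have "(2 * m) *\<^sub>R (star a * a) = m *\<^sub>R (star a * a) + m *\<^sub>R (star a * a)"
      by (simp only: mult_2 scaleR_add_left)
    ultimately have "cpositive (ip M y y - m *\<^sub>R (star a * a))" by (simp add: ml)
    moreover have "cpositive (m *\<^sub>R (star a * a))"
      by (rule cpositive_scaleR) (use m0 in \<open>auto simp: cpositive_def\<close>)
    ultimately have "norm (m *\<^sub>R (star a * a)) \<le> norm (ip M y y)" by (rule cpositive_norm_mono[rotated])
    then have "m * (norm a)\<^sup>2 \<le> norm (ip M y y)" using m0 by (simp add: cstar_identity)
    then have "(l + e) * (m * (norm a)\<^sup>2) \<le> (l + e) * norm (ip M y y)" using le by (intro mult_left_mono) auto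
    moreover have "(l + e) * (m * (norm a)\<^sup>2) = (norm a)\<^sup>2"
      using le by (simp add: m_def)
    ultimately show ?thesis by simp
  qed
  have "(norm a)\<^sup>2 \<le> l * norm (ip M y y)"
  proof (rule field_le_epsilon)
    fix d :: real assume d: "d > 0"
    define e where "e = d / (norm (ip M y y) + 1)"
    have pos: "norm (ip M y y) + 1 > 0" using norm_ge_zero[of "ip M y y"] by linarith
    then have e: "e > 0" using d by (simp add: e_def)
    have "e * norm (ip M y y) \<le> d" using d pos by (simp add: e_def divide_le_eq algebra_simps)
    with key[OF e] show "(norm a)\<^sup>2 \<le> l * norm (ip M y y) + d" by (simp add: algebra_simps)
  qed
  then have "(norm a)\<^sup>2 \<le> (hnorm M x * hnorm M y)\<^sup>2"
    by (simp add: power_mult_distrib hnorm_sq l_def)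
  then show ?thesis unfolding a_def by (rule power2_le_imp_le) simp
qed

lemma hnorm_triangle:
  assumes x: "x \<in> car M" and y: "y \<in> car M"
  shows "hnorm M (hadd M x y) \<le> hnorm M x + hnorm M y"
proof (rule hnorm_leI)
  have "norm (ip M (hadd M x y) (hadd M x y))
      \<le> norm (ip M x x) + norm (ip M x y) + norm (ip M y x) + norm (ip M y y)"
    using x y norm_triangle_ineq[of "ip M x x + ip M y x" "ip M x y + ip M y y"]
      norm_triangle_ineq[of "ip M x x" "ip M y x"] norm_triangle_ineq[of "ip M x y" "ip M y y"] by simp
  also have "\<dots> \<le> (hnorm M x + hnorm M y)\<^sup>2"
    using cauchy_schwarz[OF x y] cauchy_schwarz[OF y x]
    by (simp add: power2_sum hnorm_sq algebra_simps)
  finally show "norm (ip M (hadd M x y) (hadd M x y)) \<le> (hnorm M x + hnorm M y)\<^sup>2" .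
qed simp

lemma hnorm_ract:
  assumes x: "x \<in> car M"
  shows "hnorm M (ract M x b) \<le> hnorm M x * norm b"
proof (rule hnorm_leI)
  have "norm (star b * (ip M x x * b)) \<le> norm (star b) * (norm (ip M x x) * norm b)"
    by (intro order_trans[OF norm_mult_ineq] mult_mono mult_nonneg_nonneg order.refl norm_mult_ineq norm_ge_zero)
  then show "norm (ip M (ract M x b) (ract M x b)) \<le> (hnorm M x * norm b)\<^sup>2"
    using x by (simp add: power_mult_distrib hnorm_sq mult.assoc) (simp add: power2_eq_square mult_ac)
qed simp

lemma hnorm_scaleR:
  assumes x: "x \<in> car M"
  shows "hnorm M (ract M x (r *\<^sub>R 1)) = \<bar>r\<bar> * hnorm M x"
proof -
  have "(hnorm M (ract M x (r *\<^sub>R 1)))\<^sup>2 = (\<bar>r\<bar> * hnorm M x)\<^sup>2"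
    using x by (simp add: hnorm_sq power_mult_distrib) (simp add: power2_eq_square abs_mult mult.assoc)
  then show ?thesis by (simp add: power2_eq_iff_nonneg)
qed

text \<open>Module laws are available only up to this relation.\<close>

definition same :: "'e \<Rightarrow> 'e \<Rightarrow> bool" where
  "same x y \<longleftrightarrow> (\<forall>z\<in>car M. ip M z x = ip M z y)"

lemma same_hnorm: "same x y \<Longrightarrow> x \<in> car M \<Longrightarrow> y \<in> car M \<Longrightarrow> hnorm M x = hnorm M y"
  unfolding same_def hnorm_def by (metis ip_sym)

lemma same_hdist: "same x y \<Longrightarrow> x \<in> car M \<Longrightarrow> y \<in> car M \<Longrightarrow> hdist M x y = 0"
  unfolding hdist_def by (subst same_hnorm[of _ "hzero M"]) (auto simp: same_def)

lemma hdist_nonneg [simp]: "hdist M x y \<ge> 0" by (simp add: hdist_def)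

text \<open>Reduces distances to four inner products; this is how limits of inner products become
  norm limits below.\<close>

lemma hdist_sq:
  assumes "x \<in> car M" "y \<in> car M"
  shows "(hdist M x y)\<^sup>2 = norm (ip M x x - ip M x y - ip M y x + ip M y y)"
  using assms by (simp add: hdist_def hnorm_sq algebra_simps)

lemma hdist_self [simp]: "x \<in> car M \<Longrightarrow> hdist M x x = 0"
  by (rule same_hdist) (auto simp: same_def)

lemma hdist_commute: "x \<in> car M \<Longrightarrow> y \<in> car M \<Longrightarrow> hdist M x y = hdist M y x"
proof -
  assume *: "x \<in> car M" "y \<in> car M"
  have "(hdist M x y)\<^sup>2 = (hdist M y x)\<^sup>2"
    using * by (simp add: hdist_sq algebra_simps)
  then show ?thesis by (simp add: power2_eq_iff_nonneg)
qed

lemma hdist_triangle: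
  assumes "x \<in> car M" "y \<in> car M" "z \<in> car M"
  shows "hdist M x z \<le> hdist M x y + hdist M y z"
proof -
  have "hdist M x z = hnorm M (hadd M (hadd M x (ract M y (- 1))) (hadd M y (ract M z (- 1))))"
    unfolding hdist_def by (rule same_hnorm) (use assms in \<open>auto simp: same_def\<close>)
  also have "\<dots> \<le> hdist M x y + hdist M y z"
    unfolding hdist_def by (rule hnorm_triangle) (use assms in auto)
  finally show ?thesis .
qed

lemma hdist_add:
  assumes "x \<in> car M" "y \<in> car M" "x' \<in> car M" "y' \<in> car M"
  shows "hdist M (hadd M x y) (hadd M x' y') \<le> hdist M x x' + hdist M y y'"
proof -
  have "hdist M (hadd M x y) (hadd M x' y')
      = hnorm M (hadd M (hadd M x (ract M x' (- 1))) (hadd M y (ract M y' (- 1))))"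
    unfolding hdist_def by (rule same_hnorm) (use assms in \<open>auto simp: same_def algebra_simps\<close>)
  also have "\<dots> \<le> hdist M x x' + hdist M y y'"
    unfolding hdist_def by (rule hnorm_triangle) (use assms in auto)
  finally show ?thesis .
qed

lemma hdist_ract:
  assumes "x \<in> car M" "y \<in> car M"
  shows "hdist M (ract M x b) (ract M y b) \<le> hdist M x y * norm b"
proof -
  have "hdist M (ract M x b) (ract M y b) = hnorm M (ract M (hadd M x (ract M y (- 1))) b)"
    unfolding hdist_def by (rule same_hnorm) (use assms in \<open>auto simp: same_def algebra_simps\<close>)
  also have "\<dots> \<le> hdist M x y * norm b"
    unfolding hdist_def by (rule hnorm_ract) (use assms in auto)
  finally show ?thesis .
qed

lemma hdist_zero_right: "x \<in> car M \<Longrightarrow> hdist M x (hzero M) = hnorm M x"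
  unfolding hdist_def by (rule same_hnorm) (auto simp: same_def)

lemma hnorm_diff_le: "x \<in> car M \<Longrightarrow> y \<in> car M \<Longrightarrow> \<bar>hnorm M x - hnorm M y\<bar> \<le> hdist M x y"
  using hdist_triangle[of x y "hzero M"] hdist_triangle[of y x "hzero M"] hdist_commute[of x y]
  by (simp add: hdist_zero_right)

lemma ip_diff_right:
  assumes "x \<in> car M" "y \<in> car M" "y' \<in> car M"
  shows "norm (ip M x y - ip M x y') \<le> hnorm M x * hdist M y y'"
  using cauchy_schwarz[of x "hadd M y (ract M y' (- 1))"] assms by (simp add: hdist_def)

lemma ip_diff_left:
  assumes "x \<in> car M" "y \<in> car M" "y' \<in> car M"
  shows "norm (ip M y x - ip M y' x) \<le> hdist M y y' * hnorm M x"
  using cauchy_schwarz[of "hadd M y (ract M y' (- 1))" x] assms by (simp add: hdist_def)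

lemma ip_diff:
  assumes "x \<in> car M" "x' \<in> car M" "y \<in> car M" "y' \<in> car M"
  shows "norm (ip M x y - ip M x' y') \<le> hdist M x x' * hnorm M y + hnorm M x' * hdist M y y'"
  using ip_diff_left[of y x x'] ip_diff_right[of x' y y'] assms
    norm_triangle_ineq[of "ip M x y - ip M x' y" "ip M x' y - ip M x' y'"] by simp

lemma tendsto_hnorm:
  assumes "\<forall>\<^sub>F i in F. X i \<in> car M" "x \<in> car M" "((\<lambda>i. hdist M (X i) x) \<longlongrightarrow> 0) F"
  shows "((\<lambda>i. hnorm M (X i)) \<longlongrightarrow> hnorm M x) F"
proof -
  have "((\<lambda>i. hnorm M (X i) - hnorm M x) \<longlongrightarrow> 0) F"
    by (rule Lim_null_comparison[OF _ assms(3)])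
      (use assms(1) in eventually_elim, use hnorm_diff_le assms(2) in auto)
  then show ?thesis by (simp add: LIM_zero_iff)
qed

lemma tendsto_ip:
  assumes "\<forall>\<^sub>F i in F. X i \<in> car M" "\<forall>\<^sub>F i in F. Y i \<in> car M" "x \<in> car M" "y \<in> car M"
    and X: "((\<lambda>i. hdist M (X i) x) \<longlongrightarrow> 0) F" and Y: "((\<lambda>i. hdist M (Y i) y) \<longlongrightarrow> 0) F"
  shows "((\<lambda>i. ip M (X i) (Y i)) \<longlongrightarrow> ip M x y) F"
proof -
  have "((\<lambda>i. hdist M (X i) x * hnorm M (Y i) + hnorm M x * hdist M (Y i) y) \<longlongrightarrow> 0 * hnorm M y + hnorm M x * 0) F"
    by (intro tendsto_intros X Y tendsto_hnorm assms)
  then have lim: "((\<lambda>i. hdist M (X i) x * hnorm M (Y i) + hnorm M x * hdist M (Y i) y) \<longlongrightarrow> 0) F" by simp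
  have "((\<lambda>i. ip M (X i) (Y i) - ip M x y) \<longlongrightarrow> 0) F"
    by (rule Lim_null_comparison[OF _ lim])
      (use assms(1,2) in eventually_elim, use ip_diff assms(3,4) in auto)
  then show ?thesis by (simp add: LIM_zero_iff)
qed

lemma tendsto_ip_left:
  assumes "\<forall>\<^sub>F i in F. X i \<in> car M" "x \<in> car M" "y \<in> car M" "((\<lambda>i. hdist M (X i) x) \<longlongrightarrow> 0) F"
  shows "((\<lambda>i. ip M (X i) y) \<longlongrightarrow> ip M x y) F"
  using assms by (intro tendsto_ip) auto

lemma tendsto_ip_right:
  assumes "\<forall>\<^sub>F i in F. X i \<in> car M" "x \<in> car M" "y \<in> car M" "((\<lambda>i. hdist M (X i) x) \<longlongrightarrow> 0) F"
  shows "((\<lambda>i. ip M y (X i)) \<longlongrightarrow> ip M y x) F"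
  using assms by (intro tendsto_ip) auto

lemma clin_span_subset: "A \<subseteq> car M \<Longrightarrow> clin_span M A \<subseteq> car M"
proof
  fix x assume "A \<subseteq> car M" "x \<in> clin_span M A"
  from this(2,1) show "x \<in> car M" by induction auto
qed

lemma closed_span_seq:
  assumes "A \<subseteq> car M" "x \<in> closed_span M A"
  obtains X where "\<And>n. X n \<in> clin_span M A" "\<And>n. X n \<in> car M" "(\<lambda>n. hdist M (X n) x) \<longlonglongrightarrow> 0"
proof -
  have x: "x \<in> car M" using assms by (simp add: closed_span_def)
  have "\<exists>y\<in>clin_span M A. hdist M x y < 1 / real (Suc n)" for n
    using assms by (simp add: closed_span_def)
  then obtain X where X: "\<And>n. X n \<in> clin_span M A" "\<And>n. hdist M x (X n) < 1 / real (Suc n)" by metis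
  have Xc: "X n \<in> car M" for n using X(1) clin_span_subset[OF assms(1)] by blast
  have "(\<lambda>n. hdist M (X n) x) \<longlonglongrightarrow> 0"
    by (rule Lim_null_comparison[OF _ LIMSEQ_Suc[OF lim_1_over_n]])
      (use X(2) Xc x hdist_commute in \<open>auto intro!: always_eventually less_imp_le\<close>)
  with X(1) Xc that show thesis by blast
qed

text \<open>The density principle behind most later arguments: what is stable under sums, complex
  multiples and limits of sequences has to be verified on generators only.\<close>

lemma closed_span_induct [consumes 2, case_names zero base add scale lim]:
  assumes A: "A \<subseteq> car M" and x: "x \<in> closed_span M A"
    and zero: "P (hzero M)" and base: "\<And>x. x \<in> A \<Longrightarrow> P x"
    and add: "\<And>x y. x \<in> car M \<Longrightarrow> y \<in> car M \<Longrightarrow> P x \<Longrightarrow> P y \<Longrightarrow> P (hadd M x y)"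
    and scale: "\<And>x c. x \<in> car M \<Longrightarrow> P x \<Longrightarrow> P (ract M x (c *\<^sub>C 1))"
    and lim: "\<And>X x. (\<And>n. X n \<in> car M) \<Longrightarrow> x \<in> car M \<Longrightarrow> (\<And>n. P (X n)) \<Longrightarrow> (\<lambda>n. hdist M (X n) x) \<longlonglongrightarrow> 0 \<Longrightarrow> P x"
  shows "P x"
proof -
  obtain X where X: "\<And>n. X n \<in> clin_span M A" "\<And>n. X n \<in> car M" "(\<lambda>n. hdist M (X n) x) \<longlonglongrightarrow> 0"
    using closed_span_seq[OF A x] by blast
  have "P z" if "z \<in> clin_span M A" for z
    using that by induction (use zero base add scale clin_span_subset[OF A] in blast)+
  then show ?thesis using X x by (intro lim[of X x]) (auto simp: closed_span_def)
qed

lemma same_of_total: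
  assumes A: "A \<subseteq> car M" "closed_span M A = car M" and xy: "x \<in> car M" "y \<in> car M"
    and eq: "\<And>z. z \<in> A \<Longrightarrow> ip M z x = ip M z y"
  shows "same x y"
  unfolding same_def
proof
  fix z assume "z \<in> car M"
  then have "z \<in> closed_span M A" using A by simp
  with A(1) show "ip M z x = ip M z y"
  proof (induction rule: closed_span_induct)
    case (lim X z)
    have "(\<lambda>n. ip M (X n) x) \<longlonglongrightarrow> ip M z x" "(\<lambda>n. ip M (X n) y) \<longlonglongrightarrow> ip M z y"
      by (rule tendsto_ip_left; use lim xy in simp)+
    then show ?case using lim.IH LIMSEQ_unique by simp
  qed (use xy eq in auto)
qed

lemma closed_spanI_dense:
  assumes "\<And>x e. x \<in> car M \<Longrightarrow> e > 0 \<Longrightarrow> \<exists>y\<in>clin_span M A. hdist M x y < e"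
  shows "closed_span M A = car M"
  using assms by (auto simp: closed_span_def)

lemma clin_span_approx:
  assumes A: "A \<subseteq> car M" and B: "B \<subseteq> car M"
    and approx: "\<And>x e. x \<in> A \<Longrightarrow> e > 0 \<Longrightarrow> \<exists>y\<in>clin_span M B. hdist M x y < e"
    and x: "x \<in> clin_span M A" and e: "e > 0"
  shows "\<exists>y\<in>clin_span M B. hdist M x y < e"
  using x e
proof (induction arbitrary: e)
  case zero
  then show ?case by (intro bexI[of _ "hzero M"] clin_span.zero) auto
next
  case (add x y)
  obtain x' y' where *: "x' \<in> clin_span M B" "hdist M x x' < e / 2" "y' \<in> clin_span M B" "hdist M y y' < e / 2"
    using add.IH[of "e / 2"] add.prems by auto
  have "hdist M (hadd M x y) (hadd M x' y') \<le> hdist M x x' + hdist M y y'"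
    using * add clin_span_subset[OF A] clin_span_subset[OF B] by (intro hdist_add) auto
  then show ?case using * by (intro bexI[of _ "hadd M x' y'"] clin_span.add) auto
next
  case (scale x c)
  define n where "n = norm (c *\<^sub>C (1::'b)) + 1"
  have n: "n > 0" using norm_ge_zero[of "c *\<^sub>C (1::'b)"] unfolding n_def by linarith
  obtain x' where *: "x' \<in> clin_span M B" "hdist M x x' < e / n"
    using scale.IH[of "e / n"] scale.prems n by auto
  have "hdist M (ract M x (c *\<^sub>C 1)) (ract M x' (c *\<^sub>C 1)) \<le> hdist M x x' * norm (c *\<^sub>C (1::'b))"
    using * scale clin_span_subset[OF A] clin_span_subset[OF B] by (intro hdist_ract) auto
  also have "\<dots> \<le> hdist M x x' * n" by (intro mult_left_mono) (auto simp: n_def)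
  also have "\<dots> < e" using * n by (simp add: less_divide_eq)
  finally show ?case using * by (intro bexI[of _ "ract M x' (c *\<^sub>C 1)"] clin_span.scale) auto
qed (use approx in blast)

lemma total_of_approx:
  assumes A: "A \<subseteq> car M" "closed_span M A = car M" and B: "B \<subseteq> car M"
    and approx: "\<And>x e. x \<in> A \<Longrightarrow> e > 0 \<Longrightarrow> \<exists>y\<in>clin_span M B. hdist M x y < e"
  shows "closed_span M B = car M"
proof (rule closed_spanI_dense)
  fix x and e :: real assume x: "x \<in> car M" and e: "e > 0"
  then obtain y where y: "y \<in> clin_span M A" "hdist M x y < e / 2"
  proof -
    have "x \<in> closed_span M A" "e / 2 > 0" using A x e by auto
    then show thesis using that unfolding closed_span_def by blast
  qed
  obtain z where z: "z \<in> clin_span M B" "hdist M y z < e / 2"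
    using clin_span_approx[OF A(1) B _ y(1), of "e / 2"] approx e by auto
  have "hdist M x z \<le> hdist M x y + hdist M y z"
    using x y z clin_span_subset[OF A(1)] clin_span_subset[OF B] by (intro hdist_triangle) auto
  then show "\<exists>y\<in>clin_span M B. hdist M x y < e" using y z by force
qed

end

section \<open>Equality and limits in Hilbert modules\<close>

lemma (in hilbert_module) ip_hzero: "x \<in> car M \<Longrightarrow> ip M x (hzero M) = 0"
  using ip_add[OF _ zero_closed zero_closed, of x] add_zero[OF zero_closed] by simp

sublocale hilbert_module \<subseteq> prehilbert M
  using zero_closed add_closed ract_closed ip_add ip_ract ip_hzero ip_star ip_positive
  by (rule prehilbert.intro)

context hilbert_module
begin

text \<open>By definiteness both x + y (-1) and y + y (-1) are zero; additive inverses then allow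
  cancelling y (-1).\<close>

lemma hdist_0_imp_eq:
  assumes x: "x \<in> car M" and y: "y \<in> car M" and d: "hdist M x y = 0"
  shows "x = y"
proof -
  have cancel: "u = v" if c: "u \<in> car M" "v \<in> car M" "w \<in> car M" "hadd M u w = hadd M v w" for u v w
  proof -
    obtain w' where w': "w' \<in> car M" "hadd M w w' = hzero M" using add_inverse[OF c(3)] by blast
    have "u = hadd M (hadd M u w) w'" using c(1-3) w' by (simp add: add_assoc add_zero)
    also have "\<dots> = hadd M (hadd M v w) w'" by (simp only: c(4))
    also have "\<dots> = v" using c(1-3) w' by (simp add: add_assoc add_zero)
    finally show ?thesis .
  qed
  define n where "n = ract M y (- 1)"
  have n: "n \<in> car M" using y by (simp add: n_def)
  have "hadd M x n = hzero M"
    by (rule ip_definite)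
      (use d x n in \<open>simp_all only: hdist_def hnorm_def n_def real_sqrt_eq_0_iff norm_eq_zero add_closed\<close>)
  moreover have "hadd M y n = hzero M"
    by (rule ip_definite) (use y in \<open>simp_all add: n_def\<close>)
  ultimately show ?thesis using cancel[OF x y n] by simp
qed

lemma same_imp_eq: "same x y \<Longrightarrow> x \<in> car M \<Longrightarrow> y \<in> car M \<Longrightarrow> x = y"
  using hdist_0_imp_eq same_hdist by blast

lemma eqI: "x \<in> car M \<Longrightarrow> y \<in> car M \<Longrightarrow> (\<And>z. z \<in> car M \<Longrightarrow> ip M z x = ip M z y) \<Longrightarrow> x = y"
  by (rule same_imp_eq) (auto simp: same_def)

lemma lim_unique:
  assumes "x \<in> car M" "y \<in> car M" "\<And>n. X n \<in> car M"
    and "(\<lambda>n. hdist M (X n) x) \<longlonglongrightarrow> 0" "(\<lambda>n. hdist M (X n) y) \<longlonglongrightarrow> 0"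
  shows "x = y"
proof (rule eqI)
  fix z assume z: "z \<in> car M"
  have "(\<lambda>n. ip M z (X n)) \<longlonglongrightarrow> ip M z x" "(\<lambda>n. ip M z (X n)) \<longlonglongrightarrow> ip M z y"
    using assms z by (auto intro!: tendsto_ip_right)
  then show "ip M z x = ip M z y" by (rule LIMSEQ_unique)
qed (use assms in auto)

end

section \<open>Adjointable operators\<close>

lemma adjoint_mem:
  assumes "is_adjoint M N a g"
  shows "x \<in> car M \<Longrightarrow> a x \<in> car N" "y \<in> car N \<Longrightarrow> g y \<in> car M"
  using assms by (auto simp: is_adjoint_def)

lemma adjoint_ip:
  assumes "is_adjoint M N a g" "x \<in> car M" "y \<in> car N"
  shows "ip N (a x) y = ip M x (g y)"
  using assms by (auto simp: is_adjoint_def)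

lemma adjoint_swap:
  assumes "prehilbert M" "prehilbert N" "is_adjoint M N a g"
  shows "is_adjoint N M g a"
proof -
  have "ip M (g y) x = ip N y (a x)" if "x \<in> car M" "y \<in> car N" for x y
    using adjoint_ip[OF assms(3) that] prehilbert.ip_sym[OF assms(1)] prehilbert.ip_sym[OF assms(2)]
      adjoint_mem[OF assms(3)] that by metis
  then show ?thesis using assms(3) by (auto simp: is_adjoint_def)
qed

lemma adjoint_ip':
  assumes "prehilbert M" "prehilbert N" "is_adjoint M N a g" "x \<in> car M" "y \<in> car N"
  shows "ip N y (a x) = ip M (g y) x"
  using adjoint_ip[OF adjoint_swap[OF assms(1-3)] assms(5,4)] by simp

lemma adjoint_add:
  assumes "prehilbert M" "hilbert_module N" "is_adjoint M N a g" "x \<in> car M" "y \<in> car M"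
  shows "a (hadd M x y) = hadd N (a x) (a y)"
proof -
  interpret M: prehilbert M by fact
  interpret N: hilbert_module N by fact
  note m = adjoint_mem[OF assms(3)]
  show ?thesis
    by (rule N.eqI) (use assms m in \<open>auto simp: adjoint_ip'[OF M.prehilbert_axioms N.prehilbert_axioms assms(3)]\<close>)
qed

lemma adjoint_ract:
  assumes "prehilbert M" "hilbert_module N" "is_adjoint M N a g" "x \<in> car M"
  shows "a (ract M x b) = ract N (a x) b"
proof -
  interpret M: prehilbert M by fact
  interpret N: hilbert_module N by fact
  note m = adjoint_mem[OF assms(3)]
  show ?thesis
    by (rule N.eqI) (use assms m in \<open>auto simp: adjoint_ip'[OF M.prehilbert_axioms N.prehilbert_axioms assms(3)]\<close>)
qed

text \<open>Otherwise there are z_k = a y_k of norm 1 with |y_k| <= 4^(-k); a sum x of terms +-3^(-k) z_k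
  can be arranged with |<z_k, x>| >= 3^(-k)/2, whereas |<z_k, x>| = |<y_k, g x>| <= 4^(-k) |g x|.\<close>

lemma adjoint_bounded:
  fixes M :: "('b::unital_cstar_algebra, 'e, 'm) hmod_scheme" and N :: "('b, 'f, 'n) hmod_scheme"
  assumes "prehilbert M" "hilbert_module N" and ag: "is_adjoint M N a g"
  shows "\<exists>C\<ge>0. \<forall>x\<in>car M. hnorm N (a x) \<le> C * hnorm M x"
proof (rule ccontr)
  assume neg: "\<not> ?thesis"
  interpret M: prehilbert M by fact
  interpret N: hilbert_module N by fact
  note m = adjoint_mem[OF ag]
  have "\<exists>y\<in>car M. hnorm N (a y) = 1 \<and> hnorm M y \<le> (1/4) ^ k" for k :: nat
  proof -
    obtain y where y: "y \<in> car M" "4 ^ k * hnorm M y < hnorm N (a y)"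
      using neg by (metis linorder_not_le zero_le_numeral zero_le_power)
    define n where "n = hnorm N (a y)"
    have n: "n > 0" using y M.hnorm_nonneg[of y] unfolding n_def
      by (metis mult_nonneg_nonneg order_le_less_trans zero_le_numeral zero_le_power)
    define y' where "y' = ract M y ((1/n) *\<^sub>R 1)"
    have "a y' = ract N (a y) ((1/n) *\<^sub>R 1)"
      unfolding y'_def by (rule adjoint_ract[OF assms y(1)])
    then have "hnorm N (a y') = 1" using n m(1)[OF y(1)] by (simp add: N.hnorm_scaleR n_def[symmetric])
    moreover have "hnorm M y' = hnorm M y / n" using n y by (simp add: y'_def M.hnorm_scaleR)
    moreover have "hnorm M y / n \<le> (1/4) ^ k"
      using y n unfolding n_def[symmetric] by (simp add: field_simps power_one_over)
    ultimately show ?thesis using y by (auto simp: y'_def intro!: bexI[of _ y'])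
  qed
  then obtain y where y: "\<And>k. y k \<in> car M" "\<And>k. hnorm N (a (y k)) = 1" "\<And>k. hnorm M (y k) \<le> (1/4) ^ k"
    by metis
  define z where "z k = a (y k)" for k
  have z: "z k \<in> car N" "hnorm N (z k) = 1" for k using y m by (auto simp: z_def)
  define t where "t k = (1/3::real) ^ k" for k :: nat
  have t: "t k > 0" "t (Suc k) = t k / 3" for k by (auto simp: t_def)
  have "\<exists>x'\<in>car N. hdist N x x' \<le> t k \<and> norm (ip N (z k) x') \<ge> t k" if x: "x \<in> car N" for x k
  proof -
    define v where "v s = hadd N x (ract N (z k) (s *\<^sub>R 1))" for s :: real
    have v: "v s \<in> car N" for s using x z by (simp add: v_def)
    have d: "hdist N x (v s) = \<bar>s\<bar>" for s
    proof -
      have "hdist N x (v s) = hnorm N (ract N (z k) ((- s) *\<^sub>R 1))"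
        unfolding hdist_def by (rule N.same_hnorm) (use x z in \<open>auto simp: v_def N.same_def algebra_simps\<close>)
      then show ?thesis using z by (simp only: N.hnorm_scaleR abs_minus_cancel mult_1_right)
    qed
    have ipv: "ip N (z k) (v s) = ip N (z k) x + s *\<^sub>R ip N (z k) (z k)" for s
      using x z by (simp add: v_def)
    \<comment> \<open>The two candidates x + t z_k and x - t z_k have inner products with z_k that
      differ by 2 t in norm, so one of them has norm at least t.\<close>
    have "norm (ip N (z k) (v (t k)) - ip N (z k) (v (- t k))) = 2 * t k"
    proof -
      have "ip N (z k) (v (t k)) - ip N (z k) (v (- t k)) = t k *\<^sub>R ip N (z k) (z k) + t k *\<^sub>R ip N (z k) (z k)"
        by (simp add: ipv)
      also have "\<dots> = (2 * t k) *\<^sub>R ip N (z k) (z k)" by (simp only: mult_2 scaleR_add_left)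
      finally show ?thesis using t(1)[of k] z(2)[of k] N.hnorm_sq[of "z k"] by simp
    qed
    then have "norm (ip N (z k) (v (t k))) \<ge> t k \<or> norm (ip N (z k) (v (- t k))) \<ge> t k"
      using norm_triangle_ineq4[of "ip N (z k) (v (t k))" "ip N (z k) (v (- t k))"] by linarith
    then show ?thesis using v d t(1)[of k] by (metis abs_minus_cancel abs_of_pos order.refl)
  qed
  then obtain st where st: "\<And>x k. x \<in> car N \<Longrightarrow> st x k \<in> car N \<and> hdist N x (st x k) \<le> t k \<and> norm (ip N (z k) (st x k)) \<ge> t k"
    by metis
  define X where "X = rec_nat (hzero N) (\<lambda>k x. st x k)"
  have X0: "X 0 = hzero N" and XS: "X (Suc k) = st (X k) k" for k by (simp_all add: X_def)
  have X: "X k \<in> car N" for k by (induction k) (simp_all add: X0 XS st)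
  have step: "hdist N (X k) (X (Suc k)) \<le> t k" and big: "norm (ip N (z k) (X (Suc k))) \<ge> t k" for k
    using st[OF X] by (auto simp: XS)
  \<comment> \<open>The geometric series 3^(-k) + 3^(-k-1) + ... has sum 3/2 * 3^(-k).\<close>
  have far: "hdist N (X k) (X (k + j)) \<le> (3/2) * (t k - t (k + j))" for k j
  proof (induction j)
    case (Suc j)
    have "hdist N (X k) (X (k + Suc j)) \<le> hdist N (X k) (X (k + j)) + hdist N (X (k + j)) (X (Suc (k + j)))"
      using N.hdist_triangle[OF X[of k] X[of "k + j"] X[of "Suc (k + j)"]] by simp
    then show ?case using Suc step[of "k + j"] t(2)[of "k + j"] by simp
  qed (simp add: X)
  have far': "hdist N (X k) (X n) \<le> (3/2) * t k" if "k \<le> n" for k n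
    using far[of k "n - k"] that t(1)[of n] by simp
  have "t \<longlonglongrightarrow> 0" unfolding t_def by (rule LIMSEQ_realpow_zero) auto
  have "hCauchy N X" unfolding hCauchy_def
  proof (intro conjI allI impI)
    fix e :: real assume e: "e > 0"
    then obtain K where "t K < e / 3"
      using order_tendstoD(2)[OF \<open>t \<longlonglongrightarrow> 0\<close>, of "e / 3"] by (auto simp: eventually_sequentially)
    then have K: "(3/2) * t K < e / 2" by simp
    have "hdist N (X p) (X q) < e" if "p \<ge> K" "q \<ge> K" for p q
      using N.hdist_triangle[OF X[of p] X[of K] X[of q]] far'[OF that(1)] far'[OF that(2)] K N.hdist_commute[OF X X, of p K] by linarith
    then show "\<exists>K. \<forall>p\<ge>K. \<forall>q\<ge>K. hdist N (X p) (X q) < e" by blast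
  qed (rule X)
  then obtain x where x: "x \<in> car N" "(\<lambda>n. hdist N (X n) x) \<longlonglongrightarrow> 0" using N.complete by blast
  \<comment> \<open>All steps after the one adapted to \<open>z k\<close> move the vector by at most
    3/2 * \<open>t (Suc k)\<close>, which is half of \<open>t k\<close>.\<close>
  have half: "t k / 2 \<le> norm (ip N (z k) x)" for k
  proof -
    have "(\<lambda>n. ip N (z k) (X n)) \<longlonglongrightarrow> ip N (z k) x" using x X z by (auto intro!: N.tendsto_ip_right)
    then have lim: "(\<lambda>n. norm (ip N (z k) (X n))) \<longlonglongrightarrow> norm (ip N (z k) x)" by (rule tendsto_norm)
    have "t k / 2 \<le> norm (ip N (z k) (X n))" if "n \<ge> Suc k" for n
    proof -
      have "norm (ip N (z k) (X (Suc k)) - ip N (z k) (X n)) \<le> 1 * ((3/2) * t (Suc k))"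
        using N.ip_diff_right[OF z(1) X X, of k "Suc k" n] far'[OF that] z(2)[of k] by simp
      then show ?thesis using big[of k] t(2)[of k]
        norm_triangle_ineq2[of "ip N (z k) (X (Suc k))" "ip N (z k) (X n)"] by simp
    qed
    then show ?thesis by (intro LIMSEQ_le_const[OF lim]) auto
  qed
  have up: "norm (ip N (z k) x) \<le> (1/4) ^ k * hnorm M (g x)" for k
  proof -
    have "norm (ip N (z k) x) = norm (ip M (y k) (g x))"
      using adjoint_ip[OF ag y(1) x(1)] by (simp add: z_def)
    also have "\<dots> \<le> hnorm M (y k) * hnorm M (g x)" using y m x by (intro M.cauchy_schwarz) auto
    also have "\<dots> \<le> (1/4) ^ k * hnorm M (g x)" using y(3) by (intro mult_right_mono) auto
    finally show ?thesis .
  qed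
  have "(4/3::real) ^ k \<le> 2 * hnorm M (g x)" for k
  proof -
    have "(1/3::real) ^ k / 2 \<le> (1/4) ^ k * hnorm M (g x)" using half[of k] up[of k] by (simp add: t_def)
    then have "4 ^ k * ((1/3::real) ^ k / 2) \<le> 4 ^ k * ((1/4) ^ k * hnorm M (g x))"
      by (intro mult_left_mono) auto
    then show ?thesis by (simp add: power_divide mult.assoc[symmetric])
  qed
  moreover obtain k where "2 * hnorm M (g x) < (4/3::real) ^ k" using real_arch_pow[of "4/3" "2 * hnorm M (g x)"] by auto
  ultimately show False by (meson linorder_not_le)
qed

text \<open>Sharpens a norm bound to an inequality in the algebra. With h the invertible root of <x,
  x> + e and k its inverse, x k has norm at most 1, so <T(x k), T(x k)> <= C^2. By right linearity,
  conjugating with h turns this into <T x, T x> <= C^2 (<x, x> + e).\<close>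

lemma bounded_ip_le:
  assumes "prehilbert M" "prehilbert N"
    and T: "T \<in> car M \<rightarrow> car N" "\<And>x b. x \<in> car M \<Longrightarrow> T (ract M x b) = ract N (T x) b"
    and C: "\<And>x. x \<in> car M \<Longrightarrow> hnorm N (T x) \<le> C * hnorm M x" "C \<ge> 0"
    and x: "x \<in> car M"
  shows "cpositive (C\<^sup>2 *\<^sub>R ip M x x - ip N (T x) (T x))"
proof (rule cpositive_of_eps)
  fix e :: real assume e: "e > 0"
  interpret M: prehilbert M by fact
  interpret N: prehilbert N by fact
  obtain h k where hk: "star h = h" "star k = k" "h * k = 1" "k * h = 1" "h * h = ip M x x + e *\<^sub>R 1"
    using cpositive_plus_eps_invertible_sqrt[OF M.ip_pos[OF x] e] by metis
  define z where "z = ract M x k"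
  have z: "z \<in> car M" using x by (simp add: z_def)
  have Tx: "T x \<in> car N" "T z \<in> car N" using T x z by auto
  have zz: "ip M z z = k * ip M x x * k" using x hk by (simp add: z_def mult.assoc)
  have "norm (ip M z z) \<le> norm (1::'a)"
  proof (rule cpositive_norm_mono[OF M.ip_pos[OF z]])
    have "1 - ip M z z = k * (h * h) * k - k * ip M x x * k" unfolding zz
      by (metis hk(3,4) mult.assoc mult.left_neutral)
    also have "\<dots> = e *\<^sub>R (star k * k)" by (simp add: hk algebra_simps)
    finally have "1 - ip M z z = e *\<^sub>R (star k * k)" .
    moreover have "cpositive (star k * k)" by (auto simp: cpositive_def)
    ultimately show "cpositive (1 - ip M z z)" using cpositive_scaleR[OF _ less_imp_le[OF e]] by metis
  qed
  then have "hnorm M z \<le> 1" using norm_one_le[where 'b='a] by (intro M.hnorm_leI) auto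
  then have "C * hnorm M z \<le> C * 1" using C(2) by (intro mult_left_mono)
  then have "hnorm N (T z) \<le> C" using C(1)[OF z] by linarith
  then have "norm (ip N (T z) (T z)) \<le> C\<^sup>2" using N.hnorm_sq N.hnorm_nonneg power_mono by metis
  then have "cpositive (C\<^sup>2 *\<^sub>R 1 - ip N (T z) (T z))"
    using N.ip_sym[OF Tx(2) Tx(2)] by (intro cpositive_norm_minus)
  then have "cpositive (star h * (C\<^sup>2 *\<^sub>R 1 - ip N (T z) (T z)) * h)" by (rule cpositive_conj)
  also have "T z = ract N (T x) k" unfolding z_def by (rule T(2)[OF x])
  also have "star h * (C\<^sup>2 *\<^sub>R 1 - ip N (ract N (T x) k) (ract N (T x) k)) * h
      = C\<^sup>2 *\<^sub>R (h * h) - (h * k) * ip N (T x) (T x) * (k * h)"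
    using Tx hk(1,2) by (simp add: algebra_simps)
  finally show "cpositive (C\<^sup>2 *\<^sub>R ip M x x - ip N (T x) (T x) + e *\<^sub>R (C\<^sup>2 *\<^sub>R 1))"
    by (simp add: hk algebra_simps)
qed


section \<open>Completions\<close>

context prehilbert
begin

lemma hCauchy_mem: "hCauchy M X \<Longrightarrow> X n \<in> car M"
  by (simp add: hCauchy_def)

lemma hCauchyD: "hCauchy M X \<Longrightarrow> e > 0 \<Longrightarrow> \<exists>N. \<forall>m\<ge>N. \<forall>n\<ge>N. hdist M (X m) (X n) < e"
  by (simp add: hCauchy_def)

lemma hCauchyI:
  assumes "\<And>n. X n \<in> car M" "\<And>e. e > 0 \<Longrightarrow> \<exists>N. \<forall>m\<ge>N. \<forall>n\<ge>N. hdist M (X m) (X n) < e"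
  shows "hCauchy M X"
  using assms by (simp add: hCauchy_def)

lemma hCauchy_const [simp]: "x \<in> car M \<Longrightarrow> hCauchy M (\<lambda>_. x)"
  by (simp add: hCauchy_def)

lemma convergent_imp_hCauchy:
  assumes X: "\<And>n. X n \<in> car M" and x: "x \<in> car M" and lim: "(\<lambda>n. hdist M (X n) x) \<longlonglongrightarrow> 0"
  shows "hCauchy M X"
proof (rule hCauchyI[OF X])
  fix e :: real assume "e > 0"
  then obtain N where N: "\<And>n. n \<ge> N \<Longrightarrow> hdist M (X n) x < e / 2"
    using order_tendstoD(2)[OF lim, of "e / 2"] by (auto simp: eventually_sequentially)
  have "hdist M (X m) (X n) < e" if "m \<ge> N" "n \<ge> N" for m n
    using hdist_triangle[OF X[of m] x X[of n]] N[OF that(1)] N[OF that(2)] hdist_commute[OF x X[of n]] by linarith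
  then show "\<exists>N. \<forall>m\<ge>N. \<forall>n\<ge>N. hdist M (X m) (X n) < e" by blast
qed

lemma hCauchy_lipschitz:
  assumes X: "hCauchy M X" and a: "\<And>x. x \<in> car M \<Longrightarrow> a x \<in> car M"
    and K: "\<And>x y. x \<in> car M \<Longrightarrow> y \<in> car M \<Longrightarrow> hdist M (a x) (a y) \<le> K * hdist M x y" "K \<ge> 0"
  shows "hCauchy M (\<lambda>n. a (X n))"
proof (rule hCauchyI)
  show "a (X n) \<in> car M" for n using a hCauchy_mem[OF X] by blast
  fix e :: real assume "e > 0"
  then obtain N where N: "\<And>m n. m \<ge> N \<Longrightarrow> n \<ge> N \<Longrightarrow> hdist M (X m) (X n) < e / (K + 1)"
    using hCauchyD[OF X, of "e / (K + 1)"] K(2) by auto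
  have "hdist M (a (X m)) (a (X n)) < e" if "m \<ge> N" "n \<ge> N" for m n
  proof -
    have "(K + 1) * hdist M (X m) (X n) < e" using N[OF that] K(2) by (simp add: less_divide_eq mult.commute)
    moreover have "hdist M (a (X m)) (a (X n)) \<le> K * hdist M (X m) (X n)" by (intro K hCauchy_mem[OF X])
    ultimately show ?thesis using hdist_nonneg[of "X m" "X n"] unfolding distrib_right by linarith
  qed
  then show "\<exists>N. \<forall>m\<ge>N. \<forall>n\<ge>N. hdist M (a (X m)) (a (X n)) < e" by blast
qed

lemma hCauchy_ract: "hCauchy M X \<Longrightarrow> hCauchy M (\<lambda>n. ract M (X n) b)"
  by (rule hCauchy_lipschitz[where K = "norm b"]) (auto simp: mult.commute[of "norm b"] hdist_ract)

lemma hCauchy_add: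
  assumes X: "hCauchy M X" and Y: "hCauchy M Y"
  shows "hCauchy M (\<lambda>n. hadd M (X n) (Y n))"
proof (rule hCauchyI)
  note m = hCauchy_mem[OF X] hCauchy_mem[OF Y]
  show "hadd M (X n) (Y n) \<in> car M" for n using m by simp
  fix e :: real assume "e > 0"
  then obtain N1 N2 where N: "\<And>m n. m \<ge> N1 \<Longrightarrow> n \<ge> N1 \<Longrightarrow> hdist M (X m) (X n) < e / 2"
     "\<And>m n. m \<ge> N2 \<Longrightarrow> n \<ge> N2 \<Longrightarrow> hdist M (Y m) (Y n) < e / 2"
    using hCauchyD[OF X, of "e / 2"] hCauchyD[OF Y, of "e / 2"] by (meson half_gt_zero)
  have "hdist M (hadd M (X m) (Y m)) (hadd M (X n) (Y n)) < e" if "m \<ge> max N1 N2" "n \<ge> max N1 N2" for m n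
  proof -
    have "hdist M (X m) (X n) < e / 2" "hdist M (Y m) (Y n) < e / 2" using that N(1)[of m n] N(2)[of m n] by auto
    then show ?thesis using hdist_add[OF m(1)[of m] m(2)[of m] m(1)[of n] m(2)[of n]] by linarith
  qed
  then show "\<exists>N. \<forall>m\<ge>N. \<forall>n\<ge>N. hdist M (hadd M (X m) (Y m)) (hadd M (X n) (Y n)) < e" by blast
qed

lemma hCauchy_bounded:
  assumes X: "hCauchy M X"
  shows "\<exists>B>0. \<forall>n. hnorm M (X n) \<le> B"
proof -
  obtain N where N: "\<And>m n. m \<ge> N \<Longrightarrow> n \<ge> N \<Longrightarrow> hdist M (X m) (X n) < 1"
    using hCauchyD[OF X, of 1] by auto
  define B where "B = Max ((\<lambda>n. hnorm M (X n)) ` {..N}) + 1"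
  have le: "hnorm M (X n) \<le> B - 1" if "n \<le> N" for n
    unfolding B_def using that by (auto intro!: Max_ge)
  have "hnorm M (X n) \<le> B" for n
  proof (cases "n \<le> N")
    case False
    then have "hdist M (X n) (X N) < 1" by (intro N) auto
    then show ?thesis
      using hnorm_diff_le[OF hCauchy_mem[OF X] hCauchy_mem[OF X], of n N] le[of N] by simp
  qed (use le in force)
  moreover have "B > 0" using le[of 0] hnorm_nonneg[of "X 0"] by linarith
  ultimately show ?thesis by blast
qed

lemma hCauchy_ip_convergent:
  assumes X: "hCauchy M X" and Y: "hCauchy M Y"
  shows "convergent (\<lambda>n. ip M (X n) (Y n))"
proof -
  note m = hCauchy_mem[OF X] hCauchy_mem[OF Y]
  obtain B1 B2 where B: "B1 > 0" "\<And>n. hnorm M (X n) \<le> B1" "B2 > 0" "\<And>n. hnorm M (Y n) \<le> B2"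
    using hCauchy_bounded[OF X] hCauchy_bounded[OF Y] by blast
  have "Cauchy (\<lambda>n. ip M (X n) (Y n))"
  proof (rule metric_CauchyI)
    fix e :: real assume "e > 0"
    then have e: "e / (2 * B1) > 0" "e / (2 * B2) > 0" using B by auto
    obtain N1 where N1: "\<And>m n. m \<ge> N1 \<Longrightarrow> n \<ge> N1 \<Longrightarrow> hdist M (X m) (X n) < e / (2 * B2)"
      using hCauchyD[OF X e(2)] by blast
    obtain N2 where N2: "\<And>m n. m \<ge> N2 \<Longrightarrow> n \<ge> N2 \<Longrightarrow> hdist M (Y m) (Y n) < e / (2 * B1)"
      using hCauchyD[OF Y e(1)] by blast
    have "dist (ip M (X p) (Y p)) (ip M (X q) (Y q)) < e" if "p \<ge> max N1 N2" "q \<ge> max N1 N2" for p q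
    proof -
      have 1: "hdist M (X p) (X q) < e / (2 * B2)" and 2: "hdist M (Y p) (Y q) < e / (2 * B1)"
        using that N1[of p q] N2[of p q] by auto
      have "hdist M (X p) (X q) * hnorm M (Y p) \<le> hdist M (X p) (X q) * B2"
        using B by (intro mult_left_mono) auto
      also have "\<dots> < e / (2 * B2) * B2" using 1 B by (intro mult_strict_right_mono) auto
      also have "\<dots> = e / 2" using B by simp
      finally have a: "hdist M (X p) (X q) * hnorm M (Y p) < e / 2" .
      have "hnorm M (X q) * hdist M (Y p) (Y q) \<le> B1 * hdist M (Y p) (Y q)"
        using B by (intro mult_right_mono) auto
      also have "\<dots> < B1 * (e / (2 * B1))" using 2 B by (intro mult_strict_left_mono) auto
      also have "\<dots> = e / 2" using B by simp
      finally have b: "hnorm M (X q) * hdist M (Y p) (Y q) < e / 2" .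
      show ?thesis unfolding dist_norm
        using a b ip_diff[OF m(1)[of p] m(1)[of q] m(2)[of p] m(2)[of q]] by linarith
    qed
    then show "\<exists>N. \<forall>p\<ge>N. \<forall>q\<ge>N. dist (ip M (X p) (Y p)) (ip M (X q) (Y q)) < e" by blast
  qed
  then show ?thesis by (rule Cauchy_convergent)
qed

lemma hdist_lim_sym:
  "hCauchy M X \<Longrightarrow> hCauchy M Y \<Longrightarrow> (\<lambda>n. hdist M (X n) (Y n)) \<longlonglongrightarrow> 0 \<Longrightarrow> (\<lambda>n. hdist M (Y n) (X n)) \<longlonglongrightarrow> 0"
  by (simp add: hdist_commute[OF hCauchy_mem hCauchy_mem])

lemma hdist_lim_trans:
  assumes "hCauchy M X" "hCauchy M Y" "hCauchy M Z"
    and "(\<lambda>n. hdist M (X n) (Y n)) \<longlonglongrightarrow> 0" "(\<lambda>n. hdist M (Y n) (Z n)) \<longlonglongrightarrow> 0"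
  shows "(\<lambda>n. hdist M (X n) (Z n)) \<longlonglongrightarrow> 0"
proof (rule Lim_null_comparison)
  show "(\<lambda>n. hdist M (X n) (Y n) + hdist M (Y n) (Z n)) \<longlonglongrightarrow> 0"
    using tendsto_add[OF assms(4,5)] by simp
  show "\<forall>\<^sub>F n in sequentially. norm (hdist M (X n) (Z n)) \<le> hdist M (X n) (Y n) + hdist M (Y n) (Z n)"
    using hdist_triangle[OF hCauchy_mem[OF assms(1)] hCauchy_mem[OF assms(2)] hCauchy_mem[OF assms(3)]] by simp
qed

lemma cclass_eqI:
  assumes "hCauchy M X" "hCauchy M Y" "(\<lambda>n. hdist M (X n) (Y n)) \<longlonglongrightarrow> 0"
  shows "cclass M X = cclass M Y"
  unfolding cclass_def using assms hdist_lim_sym hdist_lim_trans by blast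

lemma crep_cclass:
  assumes X: "hCauchy M X"
  shows "hCauchy M (crep (cclass M X))" "(\<lambda>n. hdist M (X n) (crep (cclass M X) n)) \<longlonglongrightarrow> 0"
    "cclass M (crep (cclass M X)) = cclass M X"
proof -
  have "X \<in> cclass M X" using X hCauchy_mem[OF X] by (simp add: cclass_def)
  then have "crep (cclass M X) \<in> cclass M X" unfolding crep_def by (rule someI[where P = "\<lambda>Y. Y \<in> cclass M X"])
  then show 1: "hCauchy M (crep (cclass M X))" and 2: "(\<lambda>n. hdist M (X n) (crep (cclass M X) n)) \<longlonglongrightarrow> 0"
    by (auto simp: cclass_def)
  then show "cclass M (crep (cclass M X)) = cclass M X" using X cclass_eqI by metis
qed

lemma completion_cases:
  assumes "P \<in> car (completion M)"
  obtains X where "hCauchy M X" "P = cclass M X"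
  using assms by (auto simp: completion_def)

lemma cclass_mem [simp]: "hCauchy M X \<Longrightarrow> cclass M X \<in> car (completion M)"
  by (simp add: completion_def)

lemma completion_hadd:
  assumes X: "hCauchy M X" and Y: "hCauchy M Y"
  shows "hadd (completion M) (cclass M X) (cclass M Y) = cclass M (\<lambda>n. hadd M (X n) (Y n))"
proof -
  note r = crep_cclass[OF X] crep_cclass[OF Y]
  note m = hCauchy_mem[OF X] hCauchy_mem[OF Y] hCauchy_mem[OF r(1)] hCauchy_mem[OF r(4)]
  have "(\<lambda>n. hdist M (hadd M (X n) (Y n)) (hadd M (crep (cclass M X) n) (crep (cclass M Y) n))) \<longlonglongrightarrow> 0"
  proof (rule Lim_null_comparison[OF always_eventually])
    show "(\<lambda>n. hdist M (X n) (crep (cclass M X) n) + hdist M (Y n) (crep (cclass M Y) n)) \<longlonglongrightarrow> 0"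
      using tendsto_add[OF r(2,5)] by simp
  qed (simp add: hdist_add m)
  then have "cclass M (\<lambda>n. hadd M (X n) (Y n)) = cclass M (\<lambda>n. hadd M (crep (cclass M X) n) (crep (cclass M Y) n))"
    by (intro cclass_eqI hCauchy_add X Y r(1,4))
  then show ?thesis by (simp add: completion_def)
qed

text \<open>\<open>completion\<close> computes with the chosen representatives \<open>crep\<close>.
  Lipschitz maps send sequences at distance tending to 0 to such sequences, so any other
  representative gives the same class.\<close>

lemma cclass_lipschitz:
  assumes X: "hCauchy M X" and a: "\<And>x. x \<in> car M \<Longrightarrow> a x \<in> car M"
    and K: "\<And>x y. x \<in> car M \<Longrightarrow> y \<in> car M \<Longrightarrow> hdist M (a x) (a y) \<le> K * hdist M x y" "K \<ge> 0"
  shows "cclass M (\<lambda>n. a (crep (cclass M X) n)) = cclass M (\<lambda>n. a (X n))"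
proof -
  note r = crep_cclass[OF X]
  note m = hCauchy_mem[OF X] hCauchy_mem[OF r(1)]
  have "(\<lambda>n. hdist M (a (X n)) (a (crep (cclass M X) n))) \<longlonglongrightarrow> 0"
  proof (rule Lim_null_comparison[OF always_eventually])
    show "(\<lambda>n. K * hdist M (X n) (crep (cclass M X) n)) \<longlonglongrightarrow> 0"
      using tendsto_mult_right_zero[OF r(2)] by simp
  qed (simp add: K m)
  then have "cclass M (\<lambda>n. a (X n)) = cclass M (\<lambda>n. a (crep (cclass M X) n))"
    by (intro cclass_eqI hCauchy_lipschitz[OF _ a K] X r(1))
  then show ?thesis by simp
qed

lemma completion_ract:
  assumes X: "hCauchy M X"
  shows "ract (completion M) (cclass M X) b = cclass M (\<lambda>n. ract M (X n) b)"
  using cclass_lipschitz[OF X, of "\<lambda>x. ract M x b" "norm b"]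
  by (simp add: completion_def mult.commute[of "norm b"] hdist_ract)

text \<open>Cauchy sequences are bounded, so replacing both by equivalent representatives changes
  the inner products by a null sequence. Every further property of the completed inner product is
  read off from this limit.\<close>

lemma completion_ip_lim:
  assumes X: "hCauchy M X" and Y: "hCauchy M Y"
  shows "(\<lambda>n. ip M (X n) (Y n)) \<longlonglongrightarrow> ip (completion M) (cclass M X) (cclass M Y)"
proof -
  let ?X = "crep (cclass M X)" and ?Y = "crep (cclass M Y)"
  note r = crep_cclass[OF X] crep_cclass[OF Y]
  note m = hCauchy_mem[OF X] hCauchy_mem[OF Y] hCauchy_mem[OF r(1)] hCauchy_mem[OF r(4)]
  have l: "(\<lambda>n. ip M (?X n) (?Y n)) \<longlonglongrightarrow> ip (completion M) (cclass M X) (cclass M Y)"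
    using hCauchy_ip_convergent[OF r(1,4)] by (simp add: completion_def convergent_LIMSEQ_iff)
  obtain B1 B2 where B: "B1 > 0" "\<And>n. hnorm M (?X n) \<le> B1" "B2 > 0" "\<And>n. hnorm M (Y n) \<le> B2"
    using hCauchy_bounded[OF r(1)] hCauchy_bounded[OF Y] by blast
  have "(\<lambda>n. ip M (X n) (Y n) - ip M (?X n) (?Y n)) \<longlonglongrightarrow> 0"
  proof (rule Lim_null_comparison)
    have "norm (ip M (X n) (Y n) - ip M (?X n) (?Y n)) \<le> hdist M (X n) (?X n) * B2 + B1 * hdist M (Y n) (?Y n)" for n
    proof -
      have "hdist M (X n) (?X n) * hnorm M (Y n) \<le> hdist M (X n) (?X n) * B2"
        using B by (intro mult_left_mono) auto
      moreover have "hnorm M (?X n) * hdist M (Y n) (?Y n) \<le> B1 * hdist M (Y n) (?Y n)"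
        using B by (intro mult_right_mono) auto
      ultimately show ?thesis using ip_diff[OF m(1)[of n] m(3)[of n] m(2)[of n] m(4)[of n]] by linarith
    qed
    then show "\<forall>\<^sub>F n in sequentially. norm (ip M (X n) (Y n) - ip M (?X n) (?Y n)) \<le> hdist M (X n) (?X n) * B2 + B1 * hdist M (Y n) (?Y n)"
      by simp
    show "(\<lambda>n. hdist M (X n) (?X n) * B2 + B1 * hdist M (Y n) (?Y n)) \<longlonglongrightarrow> 0"
      using tendsto_add[OF tendsto_mult_left_zero[OF r(2), of B2] tendsto_mult_right_zero[OF r(5), of B1]] by simp
  qed
  from tendsto_add[OF this l] show ?thesis by simp
qed

lemma prehilbert_completion: "prehilbert (completion M)"
proof
  fix P Q R assume "P \<in> car (completion M)" "Q \<in> car (completion M)" "R \<in> car (completion M)"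
  then obtain X Y Z where XYZ: "hCauchy M X" "P = cclass M X" "hCauchy M Y" "Q = cclass M Y" "hCauchy M Z" "R = cclass M Z"
    by (meson completion_cases)
  note c = XYZ(1,3,5) hCauchy_add[OF XYZ(3,5)]
  note m = hCauchy_mem[OF c(1)] hCauchy_mem[OF c(2)] hCauchy_mem[OF c(3)]
  have "(\<lambda>n. ip M (X n) (Y n) + ip M (X n) (Z n)) \<longlonglongrightarrow> ip (completion M) P Q + ip (completion M) P R"
    unfolding XYZ by (intro tendsto_add completion_ip_lim c)
  moreover have "(\<lambda>n. ip M (X n) (Y n) + ip M (X n) (Z n)) \<longlonglongrightarrow> ip (completion M) P (hadd (completion M) Q R)"
    using completion_ip_lim[OF c(1,4)] m by (simp add: XYZ completion_hadd c)
  ultimately show "ip (completion M) P (hadd (completion M) Q R) = ip (completion M) P Q + ip (completion M) P R"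
    using LIMSEQ_unique by blast
next
  fix P Q b assume "P \<in> car (completion M)" "Q \<in> car (completion M)"
  then obtain X Y where XY: "hCauchy M X" "P = cclass M X" "hCauchy M Y" "Q = cclass M Y"
    by (meson completion_cases)
  note c = XY(1,3) hCauchy_ract[OF XY(3)]
  note m = hCauchy_mem[OF c(1)] hCauchy_mem[OF c(2)]
  show "hadd (completion M) P Q \<in> car (completion M)"
    using XY hCauchy_add by (simp add: completion_hadd)
  have "(\<lambda>n. ip M (X n) (Y n) * b) \<longlonglongrightarrow> ip (completion M) P Q * b"
    unfolding XY by (intro tendsto_mult tendsto_const completion_ip_lim c)
  moreover have "(\<lambda>n. ip M (X n) (Y n) * b) \<longlonglongrightarrow> ip (completion M) P (ract (completion M) Q b)"
    using completion_ip_lim[OF c(1,3)] m by (simp add: XY completion_ract c)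
  ultimately show "ip (completion M) P (ract (completion M) Q b) = ip (completion M) P Q * b"
    using LIMSEQ_unique by blast
  have "(\<lambda>n. star (ip M (X n) (Y n))) \<longlonglongrightarrow> star (ip (completion M) P Q)"
    unfolding XY by (intro tendsto_star completion_ip_lim c)
  then have "(\<lambda>n. ip M (Y n) (X n)) \<longlonglongrightarrow> star (ip (completion M) P Q)"
    using m by (simp add: ip_sym)
  then show "star (ip (completion M) P Q) = ip (completion M) Q P"
    using completion_ip_lim[OF c(2,1)] LIMSEQ_unique unfolding XY by blast
next
  fix P b assume "P \<in> car (completion M)"
  then obtain X where X: "hCauchy M X" "P = cclass M X" by (meson completion_cases)
  show "ract (completion M) P b \<in> car (completion M)"
    using X hCauchy_ract by (simp add: completion_ract)
  show "cpositive (ip (completion M) P P)"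
    unfolding X by (rule cpositive_lim[OF _ completion_ip_lim[OF X(1) X(1)]]) (use ip_pos hCauchy_mem X in blast)
  have "(\<lambda>n. ip M (X n) (hzero M)) \<longlonglongrightarrow> ip (completion M) P (hzero (completion M))"
    using completion_ip_lim[OF X(1) hCauchy_const[OF zero_mem]] by (simp add: X(2) completion_def)
  then show "ip (completion M) P (hzero (completion M)) = 0"
    using hCauchy_mem[OF X(1)] by (simp add: LIMSEQ_const_iff)
qed (simp add: completion_def)

lemma completion_hnorm_lim:
  assumes X: "hCauchy M X"
  shows "(\<lambda>n. hnorm M (X n)) \<longlonglongrightarrow> hnorm (completion M) (cclass M X)"
  unfolding hnorm_def by (intro tendsto_real_sqrt tendsto_norm completion_ip_lim X)

lemma completion_hdist_lim:
  assumes X: "hCauchy M X" and Y: "hCauchy M Y"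
  shows "(\<lambda>n. hdist M (X n) (Y n)) \<longlonglongrightarrow> hdist (completion M) (cclass M X) (cclass M Y)"
  unfolding hdist_def completion_ract[OF Y] completion_hadd[OF X hCauchy_ract[OF Y]]
  by (intro completion_hnorm_lim hCauchy_add hCauchy_ract X Y)

lemma cclass_eq_of_same:
  assumes X: "hCauchy M X" and Y: "hCauchy M Y" and eq: "\<And>n. same (X n) (Y n)"
  shows "cclass M X = cclass M Y"
  by (rule cclass_eqI[OF X Y]) (simp add: same_hdist eq hCauchy_mem[OF X] hCauchy_mem[OF Y])

lemma embed_mem [simp]: "x \<in> car M \<Longrightarrow> embed M x \<in> car (completion M)"
  by (simp add: embed_def)

lemma embed_ip [simp]: "x \<in> car M \<Longrightarrow> y \<in> car M \<Longrightarrow> ip (completion M) (embed M x) (embed M y) = ip M x y"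
  using completion_ip_lim[of "\<lambda>_. x" "\<lambda>_. y"] by (simp add: embed_def LIMSEQ_const_iff)

lemma embed_hdist [simp]: "x \<in> car M \<Longrightarrow> y \<in> car M \<Longrightarrow> hdist (completion M) (embed M x) (embed M y) = hdist M x y"
  using completion_hdist_lim[of "\<lambda>_. x" "\<lambda>_. y"] by (simp add: embed_def LIMSEQ_const_iff)

lemma embed_hadd: "x \<in> car M \<Longrightarrow> y \<in> car M \<Longrightarrow> hadd (completion M) (embed M x) (embed M y) = embed M (hadd M x y)"
  by (simp add: embed_def completion_hadd)

lemma embed_ract: "x \<in> car M \<Longrightarrow> ract (completion M) (embed M x) b = embed M (ract M x b)"
  by (simp add: embed_def completion_ract)

lemma embed_hzero: "embed M (hzero M) = hzero (completion M)"
  by (simp add: embed_def completion_def)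

lemma embed_approx:
  assumes P: "P \<in> car (completion M)" and e: "e > 0"
  shows "\<exists>x\<in>car M. hdist (completion M) P (embed M x) < e"
proof -
  obtain X where X: "hCauchy M X" "P = cclass M X" using P by (meson completion_cases)
  obtain N where N: "\<And>m n. m \<ge> N \<Longrightarrow> n \<ge> N \<Longrightarrow> hdist M (X m) (X n) < e / 2"
    using hCauchyD[OF X(1), of "e / 2"] e by auto
  have "(\<lambda>n. hdist M (X n) (X N)) \<longlonglongrightarrow> hdist (completion M) P (embed M (X N))"
    unfolding X embed_def by (intro completion_hdist_lim X hCauchy_const hCauchy_mem)
  then have "hdist (completion M) P (embed M (X N)) \<le> e / 2"
    by (rule LIMSEQ_le_const2) (use N in \<open>auto intro!: exI[of _ N] less_imp_le\<close>)
  then show ?thesis using e hCauchy_mem[OF X(1)] by (intro bexI[of _ "X N"]) auto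
qed

text \<open>The module laws, valid in \<open>M\<close> up to \<open>same\<close>, become equations
  because classes identify such elements. For completeness, a Cauchy sequence S of classes is
  approximated by elements x_k of \<open>M\<close> within 1/(k+1); the class of the sequence x is
  its limit.\<close>

lemma hilbert_completion: "hilbert_module (completion M)"
proof -
  interpret C: prehilbert "completion M" by (rule prehilbert_completion)
  show ?thesis
  proof
    fix P Q R assume "P \<in> car (completion M)" "Q \<in> car (completion M)" "R \<in> car (completion M)"
    then obtain X Y Z where XYZ: "hCauchy M X" "P = cclass M X" "hCauchy M Y" "Q = cclass M Y" "hCauchy M Z" "R = cclass M Z"
      by (meson completion_cases)
    note c = XYZ(1,3,5)
    note m = hCauchy_mem[OF c(1)] hCauchy_mem[OF c(2)] hCauchy_mem[OF c(3)]
    show "hadd (completion M) (hadd (completion M) P Q) R = hadd (completion M) P (hadd (completion M) Q R)"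
      using m unfolding XYZ by (simp add: completion_hadd hCauchy_add c)
        (intro cclass_eq_of_same hCauchy_add c, simp add: same_def add.assoc)
  next
    fix P Q b c assume "P \<in> car (completion M)" "Q \<in> car (completion M)"
    then obtain X Y where XY: "hCauchy M X" "P = cclass M X" "hCauchy M Y" "Q = cclass M Y"
      by (meson completion_cases)
    note c = XY(1,3)
    note m = hCauchy_mem[OF c(1)] hCauchy_mem[OF c(2)]
    show "hadd (completion M) P Q = hadd (completion M) Q P"
      using m unfolding XY by (simp add: completion_hadd c)
        (intro cclass_eq_of_same hCauchy_add c, simp add: same_def add.commute)
    show "ract (completion M) (hadd (completion M) P Q) b = hadd (completion M) (ract (completion M) P b) (ract (completion M) Q b)"
      using m unfolding XY by (simp add: completion_hadd completion_ract hCauchy_add hCauchy_ract c)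
        (intro cclass_eq_of_same hCauchy_add hCauchy_ract c, simp add: same_def distrib_right)
  next
    fix P b d assume P: "P \<in> car (completion M)"
    then obtain X where X: "hCauchy M X" "P = cclass M X" by (meson completion_cases)
    note m = hCauchy_mem[OF X(1)]
    have z: "hzero (completion M) = cclass M (\<lambda>_. hzero M)" by (simp add: completion_def)
    show "hadd (completion M) P (hzero (completion M)) = P"
      using m unfolding X z by (simp add: completion_hadd X)
        (intro cclass_eq_of_same hCauchy_add X hCauchy_const zero_mem, simp add: same_def)
    show "\<exists>Q\<in>car (completion M). hadd (completion M) P Q = hzero (completion M)"
    proof
      show "hadd (completion M) P (ract (completion M) P (- 1)) = hzero (completion M)"
        using m unfolding X z by (simp add: completion_hadd completion_ract hCauchy_ract X)
          (intro cclass_eq_of_same hCauchy_add hCauchy_ract X hCauchy_const zero_mem, simp add: same_def)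
    qed (use P in simp)
    show "ract (completion M) P (b + d) = hadd (completion M) (ract (completion M) P b) (ract (completion M) P d)"
      using m unfolding X by (simp add: completion_hadd completion_ract hCauchy_ract X)
        (intro cclass_eq_of_same hCauchy_add hCauchy_ract X, simp add: same_def distrib_left)
    show "ract (completion M) P (b * d) = ract (completion M) (ract (completion M) P b) d"
      using m unfolding X by (simp add: completion_ract hCauchy_ract X)
        (intro cclass_eq_of_same hCauchy_ract X, simp add: same_def mult.assoc)
    show "ract (completion M) P 1 = P"
      using m unfolding X by (simp add: completion_ract X)
        (intro cclass_eq_of_same hCauchy_ract X, simp add: same_def)
    assume "ip (completion M) P P = 0"
    then have "hnorm (completion M) P = 0" by (simp add: hnorm_def)
    then have "(\<lambda>n. hdist M (X n) (hzero M)) \<longlonglongrightarrow> 0"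
      using completion_hnorm_lim[OF X(1)] m by (simp add: X(2) hdist_zero_right)
    then show "P = hzero (completion M)"
      unfolding X z by (intro cclass_eqI X hCauchy_const zero_mem)
  next
    fix S assume S: "hCauchy (completion M) S"
    note mS = C.hCauchy_mem[OF S]
    have "\<exists>x\<in>car M. hdist (completion M) (S k) (embed M x) < 1 / real (Suc k)" for k
      using embed_approx[OF mS] by simp
    then obtain x where x: "\<And>k. x k \<in> car M" "\<And>k. hdist (completion M) (S k) (embed M (x k)) < 1 / real (Suc k)"
      by metis
    have small: "\<exists>N. \<forall>k\<ge>N. 1 / real (Suc k) < e" if "e > 0" for e :: real
      using order_tendstoD(2)[OF LIMSEQ_Suc[OF lim_1_over_n] that] by (simp add: eventually_sequentially)
    have xx: "hdist M (x k) (x l) \<le> 1 / real (Suc k) + hdist (completion M) (S k) (S l) + 1 / real (Suc l)" for k l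
    proof -
      have "hdist M (x k) (x l) = hdist (completion M) (embed M (x k)) (embed M (x l))" using x by simp
      also have "\<dots> \<le> hdist (completion M) (embed M (x k)) (S k) + (hdist (completion M) (S k) (S l) + hdist (completion M) (S l) (embed M (x l)))"
        using C.hdist_triangle[of "embed M (x k)" "S k" "embed M (x l)"] C.hdist_triangle[of "S k" "S l" "embed M (x l)"] mS x by simp
      finally show ?thesis using x(2)[of k] x(2)[of l] C.hdist_commute[of "S k" "embed M (x k)"] mS[of k] x(1)[of k] by simp
    qed
    have cx: "hCauchy M x"
    proof (rule hCauchyI[OF x(1)])
      fix e :: real assume e: "e > 0"
      obtain N1 where N1: "\<And>k l. k \<ge> N1 \<Longrightarrow> l \<ge> N1 \<Longrightarrow> hdist (completion M) (S k) (S l) < e / 3"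
        using C.hCauchyD[OF S, of "e / 3"] e by auto
      obtain N2 where N2: "\<And>k. k \<ge> N2 \<Longrightarrow> 1 / real (Suc k) < e / 3" using small[of "e / 3"] e by auto
      have "hdist M (x k) (x l) < e" if "k \<ge> max N1 N2" "l \<ge> max N1 N2" for k l
        using xx[of k l] N1[of k l] N2[of k] N2[of l] that by simp
      then show "\<exists>N. \<forall>m\<ge>N. \<forall>n\<ge>N. hdist M (x m) (x n) < e" by blast
    qed
    have "(\<lambda>k. hdist (completion M) (S k) (cclass M x)) \<longlonglongrightarrow> 0"
    proof (rule LIMSEQ_I)
      fix e :: real assume e: "e > 0"
      obtain N1 where N1: "\<And>k l. k \<ge> N1 \<Longrightarrow> l \<ge> N1 \<Longrightarrow> hdist M (x k) (x l) < e / 3"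
        using hCauchyD[OF cx, of "e / 3"] e by auto
      obtain N2 where N2: "\<And>k. k \<ge> N2 \<Longrightarrow> 1 / real (Suc k) < e / 3" using small[of "e / 3"] e by auto
      have "hdist (completion M) (S k) (cclass M x) < e" if k: "k \<ge> max N1 N2" for k
      proof -
        have "(\<lambda>n. hdist M (x k) (x n)) \<longlonglongrightarrow> hdist (completion M) (embed M (x k)) (cclass M x)"
          unfolding embed_def by (intro completion_hdist_lim hCauchy_const x cx)
        then have "hdist (completion M) (embed M (x k)) (cclass M x) \<le> e / 3"
          by (rule LIMSEQ_le_const2) (use N1 k in \<open>auto intro!: exI[of _ N1] less_imp_le\<close>)
        moreover have "hdist (completion M) (S k) (embed M (x k)) < e / 3"
          using x(2)[of k] N2[of k] k by simp
        ultimately show ?thesis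
          using C.hdist_triangle[of "S k" "embed M (x k)" "cclass M x"] mS x cx e by simp
      qed
      then show "\<exists>N. \<forall>k\<ge>N. norm (hdist (completion M) (S k) (cclass M x) - 0) < e"
        by (intro exI[of _ "max N1 N2"]) simp
    qed
    then show "\<exists>P\<in>car (completion M). (\<lambda>k. hdist (completion M) (S k) P) \<longlonglongrightarrow> 0"
      using cx by (intro bexI[of _ "cclass M x"]) auto
  qed (simp_all add: C.ip_sym C.ip_pos)
qed

end

section \<open>Unitaries from families with equal Gram matrices\<close>

text \<open>\<open>G\<close> is the graph of the desired map: z has the same inner products with the
  v_j as x with the u_j. Totality of the v_j makes z unique. Existence is shown by induction over
  the closed span, where the stronger claim of equal inner products with all other graph pairs makes
  the induction pass through limits and yields isometry. The same induction from the other side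
  gives surjectivity.\<close>

lemma unitary_of_total_families:
  fixes M :: "('b::unital_cstar_algebra, 'e, 'm) hmod_scheme" and N :: "('b, 'f, 'n) hmod_scheme"
  assumes "hilbert_module M" "hilbert_module N"
    and u: "\<And>j. j \<in> J \<Longrightarrow> u j \<in> car M" and v: "\<And>j. j \<in> J \<Longrightarrow> v j \<in> car N"
    and uv: "\<And>i j. i \<in> J \<Longrightarrow> j \<in> J \<Longrightarrow> ip N (v i) (v j) = ip M (u i) (u j)"
    and tu: "closed_span M (u ` J) = car M" and tv: "closed_span N (v ` J) = car N"
  shows "\<exists>f. unitary M N f \<and> (\<forall>j\<in>J. f (u j) = v j)"
proof -
  interpret M: hilbert_module M by fact
  interpret N: hilbert_module N by fact
  define G where "G x z \<longleftrightarrow> x \<in> car M \<and> z \<in> car N \<and> (\<forall>j\<in>J. ip N (v j) z = ip M (u j) x)" for x z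
  have Gc: "x \<in> car M" "z \<in> car N" if "G x z" for x z using that by (auto simp: G_def)
  have ex1: "\<exists>z\<in>car N. G x z \<and> (\<forall>x' z'. G x' z' \<longrightarrow> ip N z z' = ip M x x')" if "x \<in> car M" for x
  proof -
    have "u ` J \<subseteq> car M" "x \<in> closed_span M (u ` J)" using u tu that by auto
    then show ?thesis
    proof (induction rule: M.closed_span_induct)
      case zero
      show ?case by (intro bexI[of _ "hzero N"]) (auto simp: G_def u v)
    next
      case (base x)
      then obtain j where "j \<in> J" "x = u j" by auto
      then show ?case using u v uv by (intro bexI[of _ "v j"]) (auto simp: G_def)
    next
      case (add x y)
      then obtain z w where zw: "z \<in> car N" "w \<in> car N" "G x z" "G y w"
        and eq: "\<And>x' z'. G x' z' \<Longrightarrow> ip N z z' = ip M x x'" "\<And>x' z'. G x' z' \<Longrightarrow> ip N w z' = ip M y x'" by blast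
      have "G (hadd M x y) (hadd N z w)" using zw u v by (simp add: G_def)
      moreover have "ip N (hadd N z w) z' = ip M (hadd M x y) x'" if "G x' z'" for x' z'
        using Gc[OF that] zw(1,2) add.hyps by (simp add: eq[OF that])
      ultimately show ?case using zw(1,2) N.add_mem by blast
    next
      case (scale x c)
      then obtain z where z: "z \<in> car N" "G x z" and eq: "\<And>x' z'. G x' z' \<Longrightarrow> ip N z z' = ip M x x'" by blast
      have "G (ract M x (c *\<^sub>C 1)) (ract N z (c *\<^sub>C 1))" using z u v by (simp add: G_def)
      moreover have "ip N (ract N z (c *\<^sub>C 1)) z' = ip M (ract M x (c *\<^sub>C 1)) x'" if "G x' z'" for x' z'
        using Gc[OF that] z(1) scale.hyps by (simp add: eq[OF that])
      ultimately show ?case using z(1) N.ract_mem by blast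
    next
      case (lim X x)
      then obtain Z where Z: "\<And>n. Z n \<in> car N" "\<And>n. G (X n) (Z n)"
        "\<And>n x' z'. G x' z' \<Longrightarrow> ip N (Z n) z' = ip M (X n) x'" by metis
      have d: "hdist N (Z m) (Z n) = hdist M (X m) (X n)" for m n
      proof -
        have "(hdist N (Z m) (Z n))\<^sup>2 = (hdist M (X m) (X n))\<^sup>2"
          using lim.hyps by (simp add: N.hdist_sq[OF Z(1) Z(1)] M.hdist_sq Z(3)[OF Z(2)])
        then show ?thesis by (simp add: power2_eq_iff_nonneg)
      qed
      have "hCauchy M X" by (rule M.convergent_imp_hCauchy; use lim in simp)
      then have "hCauchy N Z" using Z(1) by (simp add: hCauchy_def d)
      then obtain z where z: "z \<in> car N" "(\<lambda>n. hdist N (Z n) z) \<longlonglongrightarrow> 0" using N.complete by blast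
      have "ip N (v j) z = ip M (u j) x" if j: "j \<in> J" for j
      proof -
        have "(\<lambda>n. ip N (v j) (Z n)) \<longlonglongrightarrow> ip N (v j) z" by (rule N.tendsto_ip_right; use z Z v j in simp)
        moreover have "(\<lambda>n. ip M (u j) (X n)) \<longlonglongrightarrow> ip M (u j) x" by (rule M.tendsto_ip_right; use lim u j in simp)
        moreover have "ip N (v j) (Z n) = ip M (u j) (X n)" for n using Z(2) j by (simp add: G_def)
        ultimately show ?thesis using LIMSEQ_unique by simp
      qed
      then have "G x z" using z lim.hyps by (simp add: G_def)
      moreover have "ip N z z' = ip M x x'" if g: "G x' z'" for x' z'
      proof -
        have "(\<lambda>n. ip N (Z n) z') \<longlonglongrightarrow> ip N z z'" by (rule N.tendsto_ip_left; use z Z(1) Gc[OF g] in simp)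
        moreover have "(\<lambda>n. ip M (X n) x') \<longlonglongrightarrow> ip M x x'" by (rule M.tendsto_ip_left; use lim Gc[OF g] in simp)
        ultimately show ?thesis using LIMSEQ_unique Z(3)[OF g] by simp
      qed
      ultimately show ?case using z by blast
    qed
  qed
  have ex2: "\<exists>x\<in>car M. G x z" if "z \<in> car N" for z
  proof -
    have "v ` J \<subseteq> car N" "z \<in> closed_span N (v ` J)" using v tv that by auto
    then show ?thesis
    proof (induction rule: N.closed_span_induct)
      case zero
      show ?case by (intro bexI[of _ "hzero M"]) (auto simp: G_def u v)
    next
      case (base z)
      then obtain j where "j \<in> J" "z = v j" by auto
      then show ?case using u v uv by (intro bexI[of _ "u j"]) (auto simp: G_def)
    next
      case (add z w)
      then obtain x y where "x \<in> car M" "y \<in> car M" "G x z" "G y w" by blast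
      then show ?case using u v add.hyps by (intro bexI[of _ "hadd M x y"]) (auto simp: G_def)
    next
      case (scale z c)
      then obtain x where "x \<in> car M" "G x z" by blast
      then show ?case using u v scale.hyps by (intro bexI[of _ "ract M x (c *\<^sub>C 1)"]) (auto simp: G_def)
    next
      case (lim Z z)
      then obtain X where X: "\<And>n. X n \<in> car M" "\<And>n. G (X n) (Z n)" by metis
      have uniq: "z = w" if "G x z" "G x w" for x z w
        by (rule N.same_imp_eq[OF N.same_of_total[OF _ tv]]) (use that v in \<open>auto simp: G_def\<close>)
      \<comment> \<open>Preimages of a convergent sequence form a Cauchy sequence, since the graph
        preserves inner products.\<close>
      have iso: "ip N (Z m) (Z n) = ip M (X m) (X n)" for m n
        using ex1[OF X(1)[of m]] X(2) uniq by metis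
      have d: "hdist N (Z m) (Z n) = hdist M (X m) (X n)" for m n
      proof -
        have "(hdist N (Z m) (Z n))\<^sup>2 = (hdist M (X m) (X n))\<^sup>2"
          using X lim.hyps by (simp add: N.hdist_sq M.hdist_sq iso)
        then show ?thesis by (simp add: power2_eq_iff_nonneg)
      qed
      have "hCauchy N Z" by (rule N.convergent_imp_hCauchy; use lim in simp)
      then have "hCauchy M X" using X(1) by (simp add: hCauchy_def d)
      then obtain x where x: "x \<in> car M" "(\<lambda>n. hdist M (X n) x) \<longlonglongrightarrow> 0" using M.complete by blast
      have "ip N (v j) z = ip M (u j) x" if j: "j \<in> J" for j
      proof -
        have "(\<lambda>n. ip N (v j) (Z n)) \<longlonglongrightarrow> ip N (v j) z" by (rule N.tendsto_ip_right; use lim v j in simp)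
        moreover have "(\<lambda>n. ip M (u j) (X n)) \<longlonglongrightarrow> ip M (u j) x" by (rule M.tendsto_ip_right; use x X u j in simp)
        moreover have "ip N (v j) (Z n) = ip M (u j) (X n)" for n using X(2) j by (simp add: G_def)
        ultimately show ?thesis using LIMSEQ_unique by simp
      qed
      then show ?case using x lim.hyps by (auto simp: G_def)
    qed
  qed
  have uniq: "z = w" if "G x z" "G x w" for x z w
    by (rule N.same_imp_eq[OF N.same_of_total[OF _ tv]]) (use that v in \<open>auto simp: G_def\<close>)
  obtain f where f: "\<And>x. x \<in> car M \<Longrightarrow> f x \<in> car N" "\<And>x. x \<in> car M \<Longrightarrow> G x (f x)"
    "\<And>x x' z'. x \<in> car M \<Longrightarrow> G x' z' \<Longrightarrow> ip N (f x) z' = ip M x x'"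
    using ex1 by metis
  have "f (hadd M x y) = hadd N (f x) (f y)" if "x \<in> car M" "y \<in> car M" for x y
    by (rule uniq[OF f(2)]) (use that f(1,2) u v in \<open>auto simp: G_def\<close>)
  moreover have "f (ract M x b) = ract N (f x) b" if "x \<in> car M" for x b
    by (rule uniq[OF f(2)]) (use that f(1,2) u v in \<open>auto simp: G_def\<close>)
  moreover have "ip N (f x) (f y) = ip M x y" if "x \<in> car M" "y \<in> car M" for x y
    using f that by blast
  moreover have "f (u j) = v j" if "j \<in> J" for j
    by (rule uniq[OF f(2)]) (use that u v uv in \<open>auto simp: G_def\<close>)
  moreover have "f ` car M = car N" using f ex2 uniq by (auto simp: image_iff) (metis Gc(1))
  ultimately show ?thesis
    using f(1) by (intro exI[of _ f]) (auto simp: unitary_def isometric_embedding_def)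
qed


section \<open>Correspondences and interior tensor products\<close>

context correspondence
begin

lemma lact_mem [simp, intro]: "x \<in> car M \<Longrightarrow> lact M b x \<in> car M"
  by (rule adjoint_mem(1)[OF lact_adjoint])

lemma ip_lact_left: "x \<in> car M \<Longrightarrow> y \<in> car M \<Longrightarrow> ip M (lact M b x) y = ip M x (lact M (star b) y)"
  by (rule adjoint_ip[OF lact_adjoint])

lemma ip_lact_add: "x \<in> car M \<Longrightarrow> y \<in> car M \<Longrightarrow> ip M x (lact M (b + c) y) = ip M x (lact M b y) + ip M x (lact M c y)"
  by (simp add: lact_plus)

lemma ip_lact_zero [simp]: "x \<in> car M \<Longrightarrow> y \<in> car M \<Longrightarrow> ip M x (lact M 0 y) = 0"
  using ip_lact_add[of x y 0 0] by simp

lemma ip_lact_minus: "x \<in> car M \<Longrightarrow> y \<in> car M \<Longrightarrow> ip M x (lact M (- b) y) = - ip M x (lact M b y)"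
  using ip_lact_add[of x y b "- b"] by (simp add: eq_neg_iff_add_eq_0 add.commute)

lemma ip_lact_diff: "x \<in> car M \<Longrightarrow> y \<in> car M \<Longrightarrow> ip M x (lact M (b - c) y) = ip M x (lact M b y) - ip M x (lact M c y)"
  using ip_lact_add[of x y b "- c"] by (simp add: ip_lact_minus)

lemma ip_lact_scaleR: "x \<in> car M \<Longrightarrow> y \<in> car M \<Longrightarrow> ip M x (lact M (r *\<^sub>R b) y) = r *\<^sub>R ip M x (lact M b y)"
  by (simp add: scaleR_scaleC lact_scaleC) (simp flip: scaleR_scaleC)

lemma lact_hadd: "x \<in> car M \<Longrightarrow> y \<in> car M \<Longrightarrow> lact M b (hadd M x y) = hadd M (lact M b x) (lact M b y)"
  by (rule adjoint_add[OF prehilbert_axioms hilbert_module_axioms lact_adjoint])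

lemma lact_ract: "x \<in> car M \<Longrightarrow> lact M b (ract M x c) = ract M (lact M b x) c"
  by (rule adjoint_ract[OF prehilbert_axioms hilbert_module_axioms lact_adjoint])

text \<open>\<open>1\<close> fixes every b x, and these are total by nondegeneracy.\<close>

lemma lact_one: assumes x: "x \<in> car M" shows "lact M 1 x = x"
proof (rule same_imp_eq[OF same_of_total[OF _ nondegenerate]])
  fix z assume "z \<in> {lact M b x |b x. x \<in> car M}"
  then obtain b y where z: "z = lact M b y" "y \<in> car M" by blast
  have "ip M z (lact M 1 x) = ip M (lact M 1 z) x" using x z by (simp add: ip_lact_left)
  also have "lact M 1 z = z" using z by (simp flip: lact_mult)
  finally show "ip M z (lact M 1 x) = ip M z x" .
qed (use x in auto)

lemma cpositive_ip_lact: "cpositive a \<Longrightarrow> x \<in> car M \<Longrightarrow> cpositive (ip M x (lact M a x))"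
proof -
  assume "cpositive a" and x: "x \<in> car M"
  then obtain c where c: "a = star c * c" by (auto simp: cpositive_def)
  have "ip M x (lact M a x) = ip M (lact M c x) (lact M c x)"
    using x by (simp add: c lact_mult ip_lact_left)
  then show ?thesis using ip_pos x by simp
qed

text \<open>A *-homomorphism respects positivity, and |b|^2 - b* b is positive.\<close>

lemma hnorm_lact: assumes x: "x \<in> car M" shows "hnorm M (lact M b x) \<le> norm b * hnorm M x"
proof (rule hnorm_leI)
  have "cpositive ((norm b)\<^sup>2 *\<^sub>R 1 - star b * b)"
    by (rule cpositive_norm_minus) (simp_all add: star_mult star_star cstar_identity)
  from cpositive_ip_lact[OF this x]
  have "cpositive ((norm b)\<^sup>2 *\<^sub>R ip M x x - ip M (lact M b x) (lact M b x))"
    using x by (simp add: ip_lact_diff ip_lact_scaleR lact_one lact_mult ip_lact_left)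
  then have "norm (ip M (lact M b x) (lact M b x)) \<le> norm ((norm b)\<^sup>2 *\<^sub>R ip M x x)"
    by (rule cpositive_norm_mono[OF ip_pos[OF lact_mem[OF x]]])
  then show "norm (ip M (lact M b x) (lact M b x)) \<le> (norm b * hnorm M x)\<^sup>2"
    by (simp add: power_mult_distrib hnorm_sq)
qed simp

lemma norm_ip_lact: assumes x: "x \<in> car M" shows "norm (ip M x (lact M b x)) \<le> norm b * (hnorm M x)\<^sup>2"
proof -
  have "norm (ip M x (lact M b x)) \<le> hnorm M x * (norm b * hnorm M x)"
    using cauchy_schwarz[OF x lact_mem[OF x]] hnorm_lact[OF x]
    by (meson hnorm_nonneg mult_left_mono order_trans)
  then show ?thesis by (simp add: power2_eq_square mult_ac)
qed

lemma hdist_lact: "x \<in> car M \<Longrightarrow> y \<in> car M \<Longrightarrow> hdist M (lact M b x) (lact M b y) \<le> norm b * hdist M x y"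
  using hnorm_lact[of "hadd M x (ract M y (- 1))" b] by (simp add: hdist_def lact_hadd lact_ract)

end

section \<open>Positive kernels with values in the algebra\<close>

lemma sum_list_swap:
  "(\<Sum>x\<leftarrow>xs. \<Sum>y\<leftarrow>ys. f x y) = (\<Sum>y\<leftarrow>ys. \<Sum>x\<leftarrow>xs. (f x y :: 'b::comm_monoid_add))"
  by (induction xs) (simp_all add: sum_list_addf)

lemma star_sum_list_map: "star (\<Sum>x\<leftarrow>xs. f x) = (\<Sum>x\<leftarrow>xs. star (f x :: 'b::unital_cstar_algebra))"
  by (induction xs) (auto simp: star_add)

text \<open>Stands in for a finite sum of vectors; only its inner products are ever used.\<close>

lemma (in prehilbert) ex_list_sum:
  assumes "\<And>p. p \<in> set ps \<Longrightarrow> f p \<in> car M"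
  shows "\<exists>z\<in>car M. (\<forall>w\<in>car M. ip M w z = (\<Sum>p\<leftarrow>ps. ip M w (f p)))"
  using assms
proof (induction ps)
  case (Cons p ps)
  then obtain z where "z \<in> car M" "\<forall>w\<in>car M. ip M w z = (\<Sum>p\<leftarrow>ps. ip M w (f p))" by auto
  then show ?case using Cons.prems by (intro bexI[of _ "hadd M (f p) z"]) auto
qed (auto intro!: bexI[of _ "hzero M"])

text \<open>A Hermitian positive definite kernel: every matrix (k(x_i, x_j)) is positive as a matrix
  over the algebra. Stating this by quadratic forms keeps matrix algebras out of the
  development.\<close>

definition pos_kernel :: "'e set \<Rightarrow> ('e \<Rightarrow> 'e \<Rightarrow> 'b::unital_cstar_algebra) \<Rightarrow> bool" where
  "pos_kernel X k \<longleftrightarrow> (\<forall>x\<in>X. \<forall>y\<in>X. star (k x y) = k y x) \<and>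
     (\<forall>ps. set ps \<subseteq> X \<times> UNIV \<longrightarrow>
        cpositive (\<Sum>p\<leftarrow>ps. \<Sum>q\<leftarrow>ps. star (snd p) * k (fst p) (fst q) * snd q))"

text \<open>Induction on the list, replacing the kernel by the Schur complement of its (perturbed, hence
  invertible) entry at the first point.\<close>

lemma (in correspondence) pos_kernel_imp_cpositive:
  assumes "pos_kernel X k" "set ps \<subseteq> X \<times> car M"
  shows "cpositive (\<Sum>p\<leftarrow>ps. \<Sum>q\<leftarrow>ps. ip M (snd p) (lact M (k (fst p) (fst q)) (snd q)))"
  using assms
proof (induction ps arbitrary: k)
  case (Cons p0 ps)
  obtain x0 y0 where p0: "p0 = (x0, y0)" by (cases p0)
  have x0: "x0 \<in> X" and y0: "y0 \<in> car M" and ps: "set ps \<subseteq> X \<times> car M"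
    using Cons.prems by (auto simp: p0)
  have psX: "fst p \<in> X" "snd p \<in> car M" if "p \<in> set ps" for p using ps that by auto
  have herm: "star (k x y) = k y x" if "x \<in> X" "y \<in> X" for x y
    using Cons.prems(1) that by (simp add: pos_kernel_def)
  have pos: "cpositive (\<Sum>p\<leftarrow>qs. \<Sum>q\<leftarrow>qs. star (snd p) * k (fst p) (fst q) * snd q)" if "set qs \<subseteq> X \<times> UNIV" for qs
    using Cons.prems(1) that by (simp add: pos_kernel_def)
  have k00: "cpositive (k x0 x0)" using pos[of "[(x0, 1)]"] x0 by simp
  show ?case
  proof (rule cpositive_of_eps)
    fix e :: real assume e: "e > 0"
    obtain h c0 where hc: "star h = h" "star c0 = c0" "h * c0 = 1" "c0 * h = 1" "h * h = k x0 x0 + e *\<^sub>R 1"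
      using cpositive_plus_eps_invertible_sqrt[OF k00 e] by metis
    define a where "a = k x0 x0 + e *\<^sub>R 1"
    define c where "c = c0 * c0"
    have ac: "a * c = 1" "c * a = 1" and sc: "star c = c" and sa: "star a = a"
    proof -
      have "h * h * (c0 * c0) = h * (h * c0) * c0" "c0 * c0 * (h * h) = c0 * (c0 * h) * h"
        by (simp_all only: mult.assoc)
      then show "a * c = 1" "c * a = 1" by (simp_all add: a_def c_def hc flip: hc(5))
      show "star c = c" by (simp add: c_def star_mult hc)
      show "star a = a" by (simp add: a_def star_add herm[OF x0 x0])
    qed
    define k' where "k' x y = k x y - k x x0 * c * k x0 y" for x y
    have "pos_kernel X k'"
      unfolding pos_kernel_def
    proof (intro conjI ballI allI impI)
      show "star (k' x y) = k' y x" if "x \<in> X" "y \<in> X" for x y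
        using that x0 by (simp add: k'_def herm star_mult sc mult.assoc)
      fix qs :: "('a \<times> 'b) list" assume qs: "set qs \<subseteq> X \<times> UNIV"
      define s where "s = (\<Sum>q\<leftarrow>qs. k x0 (fst q) * snd q)"
      \<comment> \<open>This coefficient at \<open>x0\<close> minimises the quadratic form built
        with \<open>a\<close>; its minimum is the form of the Schur complement
        \<open>k'\<close>.\<close>
      define b0 where "b0 = - (c * s)"
      have ss: "star s = (\<Sum>q\<leftarrow>qs. star (snd q) * k (fst q) x0)"
        unfolding s_def star_sum_list_map
        by (rule arg_cong[of _ _ sum_list], rule map_cong[OF refl]) (use qs x0 herm in \<open>auto simp: star_mult\<close>)
      define Q where "Q = (\<Sum>p\<leftarrow>qs. \<Sum>q\<leftarrow>qs. star (snd p) * k (fst p) (fst q) * snd q)"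
      have Q': "(\<Sum>p\<leftarrow>qs. \<Sum>q\<leftarrow>qs. star (snd p) * k' (fst p) (fst q) * snd q) = Q - star s * c * s"
      proof -
        have "star s * c * s = (\<Sum>p\<leftarrow>qs. \<Sum>q\<leftarrow>qs. star (snd p) * k (fst p) x0 * c * (k x0 (fst q) * snd q))"
          unfolding ss unfolding s_def sum_list_mult_const[symmetric] sum_list_const_mult[symmetric]
          by (rule sum_list_swap)
        then show ?thesis
          by (simp add: Q_def k'_def left_diff_distrib right_diff_distrib sum_list_subtractf mult.assoc)
      qed
      have "cpositive (\<Sum>p\<leftarrow>(x0, b0) # qs. \<Sum>q\<leftarrow>(x0, b0) # qs. star (snd p) * k (fst p) (fst q) * snd q)"
        using qs x0 by (intro pos) auto
      also have "(\<Sum>p\<leftarrow>(x0, b0) # qs. \<Sum>q\<leftarrow>(x0, b0) # qs. star (snd p) * k (fst p) (fst q) * snd q)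
          = star b0 * k x0 x0 * b0 + star b0 * s + (star s * b0 + Q)"
        by (simp add: sum_list_addf ss Q_def sum_list_mult_const, simp add: s_def sum_list_const_mult mult.assoc)
      finally have 1: "cpositive (star b0 * k x0 x0 * b0 + star b0 * s + (star s * b0 + Q))" .
      have "cpositive (e *\<^sub>R (star b0 * b0))"
        using e by (intro cpositive_scaleR) (auto simp: cpositive_def)
      from cpositive_add[OF 1 this]
      have "cpositive (star b0 * a * b0 + star b0 * s + (star s * b0 + Q))"
        by (simp add: a_def algebra_simps)
      moreover have "star b0 * a * b0 = star s * c * s"
      proof -
        have "star b0 * a * b0 = star s * (c * a) * c * s" by (simp add: b0_def star_mult sc mult.assoc)
        then show ?thesis by (simp add: ac)
      qed
      moreover have "star b0 * s = - (star s * c * s)" "star s * b0 = - (star s * c * s)"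
        by (simp_all add: b0_def star_mult sc mult.assoc)
      ultimately have "cpositive (Q - star s * c * s)" by simp
      then show "cpositive (\<Sum>p\<leftarrow>qs. \<Sum>q\<leftarrow>qs. star (snd p) * k' (fst p) (fst q) * snd q)"
        unfolding Q' .
    qed
    then have IH: "cpositive (\<Sum>p\<leftarrow>ps. \<Sum>q\<leftarrow>ps. ip M (snd p) (lact M (k' (fst p) (fst q)) (snd q)))"
      using Cons.IH ps by blast
    obtain s where s: "s \<in> car M" and ips: "\<And>w. w \<in> car M \<Longrightarrow> ip M w s = (\<Sum>p\<leftarrow>ps. ip M w (lact M (k x0 (fst p)) (snd p)))"
      using ex_list_sum[of ps "\<lambda>p. lact M (k x0 (fst p)) (snd p)"] psX by auto
    have ips': "ip M s w = (\<Sum>p\<leftarrow>ps. ip M (snd p) (lact M (k (fst p) x0) w))" if w: "w \<in> car M" for w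
    proof -
      have "ip M s w = star (ip M w s)" using ip_sym[OF w s] by simp
      also have "\<dots> = (\<Sum>p\<leftarrow>ps. ip M (snd p) (lact M (k (fst p) x0) w))"
        unfolding ips[OF w] star_sum_list_map
        by (rule arg_cong[of _ _ sum_list], rule map_cong[OF refl])
          (use psX w x0 in \<open>simp add: ip_sym ip_lact_left herm\<close>)
      finally show ?thesis .
    qed
    \<comment> \<open>Completing the square: <w, a w> contains all terms involving
      \<open>y0\<close>, and what is missing from the full sum is the sum for
      \<open>k'\<close>.\<close>
    define w where "w = hadd M y0 (lact M c s)"
    have w: "w \<in> car M" using y0 s by (simp add: w_def)
    define Q where "Q = (\<Sum>p\<leftarrow>ps. \<Sum>q\<leftarrow>ps. ip M (snd p) (lact M (k (fst p) (fst q)) (snd q)))"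
    have "cpositive a" unfolding a_def hc(5)[symmetric] using hc(1) by (auto simp: cpositive_def intro!: exI[of _ h])
    then have "cpositive (ip M w (lact M a w))" using w by (rule cpositive_ip_lact)
    also have "ip M w (lact M a w) = ip M y0 (lact M a y0) + ip M y0 s + (ip M s y0 + ip M s (lact M c s))"
      using y0 s by (simp add: w_def lact_hadd ip_lact_left sc ac lact_one flip: lact_mult)
    finally have 2: "cpositive (ip M y0 (lact M a y0) + ip M y0 s + (ip M s y0 + ip M s (lact M c s)))" .
    have "ip M s (lact M c s) = (\<Sum>p\<leftarrow>ps. \<Sum>q\<leftarrow>ps. ip M (snd p) (lact M (k (fst p) x0 * c * k x0 (fst q)) (snd q)))"
    proof -
      have "ip M (snd p) (lact M (k (fst p) x0) (lact M c s))
          = (\<Sum>q\<leftarrow>ps. ip M (snd p) (lact M (k (fst p) x0 * c * k x0 (fst q)) (snd q)))" if p: "p \<in> set ps" for p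
      proof -
        have m: "lact M (c * k x0 (fst p)) (snd p) \<in> car M" using psX[OF p] by simp
        have "ip M (snd p) (lact M (k (fst p) x0) (lact M c s)) = ip M (lact M (c * k x0 (fst p)) (snd p)) s"
          using psX[OF p] s x0 by (simp add: ip_lact_left star_mult sc herm lact_mult)
        also have "\<dots> = (\<Sum>q\<leftarrow>ps. ip M (snd p) (lact M (k (fst p) x0 * c * k x0 (fst q)) (snd q)))"
          unfolding ips[OF m]
          by (rule arg_cong[of _ _ sum_list], rule map_cong[OF refl])
            (use psX psX[OF p] x0 in \<open>simp add: ip_lact_left star_mult sc herm lact_mult mult.assoc\<close>)
        finally show ?thesis .
      qed
      then show ?thesis using ips'[of "lact M c s"] s by (simp cong: map_cong)
    qed
    moreover have "(\<Sum>p\<leftarrow>ps. \<Sum>q\<leftarrow>ps. ip M (snd p) (lact M (k' (fst p) (fst q)) (snd q)))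
        = Q - (\<Sum>p\<leftarrow>ps. \<Sum>q\<leftarrow>ps. ip M (snd p) (lact M (k (fst p) x0 * c * k x0 (fst q)) (snd q)))"
      unfolding Q_def sum_list_subtractf[symmetric]
      by (intro arg_cong[of _ _ sum_list] map_cong refl) (use psX in \<open>simp add: k'_def ip_lact_diff\<close>)
    ultimately have "cpositive (ip M y0 (lact M a y0) + ip M y0 s + (ip M s y0 + Q))"
      using cpositive_add[OF 2 IH] by (simp add: add.assoc)
    moreover have "ip M y0 (lact M a y0) = ip M y0 (lact M (k x0 x0) y0) + e *\<^sub>R ip M y0 y0"
      using y0 by (simp add: a_def ip_lact_add ip_lact_scaleR lact_one)
    ultimately show "cpositive ((\<Sum>p\<leftarrow>p0 # ps. \<Sum>q\<leftarrow>p0 # ps. ip M (snd p) (lact M (k (fst p) (fst q)) (snd q))) + e *\<^sub>R ip M y0 y0)"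
      by (simp add: p0 sum_list_addf ips[OF y0] ips'[OF y0] Q_def algebra_simps)
  qed
qed simp

text \<open>The quadratic form at (x_i, b_i) is <z, z> for z the sum of the x_i b_i.\<close>

lemma (in prehilbert) pos_kernel_ip: "pos_kernel (car M) (ip M)"
  unfolding pos_kernel_def
proof (intro conjI ballI allI impI)
  fix ps :: "('e \<times> 'b) list" assume ps: "set ps \<subseteq> car M \<times> UNIV"
  then have psX: "fst p \<in> car M" if "p \<in> set ps" for p using that by auto
  obtain z where z: "z \<in> car M" "\<And>w. w \<in> car M \<Longrightarrow> ip M w z = (\<Sum>p\<leftarrow>ps. ip M w (ract M (fst p) (snd p)))"
    using ex_list_sum[of ps "\<lambda>p. ract M (fst p) (snd p)"] psX by auto
  have "ip M z z = (\<Sum>p\<leftarrow>ps. star (ip M (ract M (fst p) (snd p)) z))"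
    unfolding z(2)[OF z(1)] 
    by (intro arg_cong[of _ _ sum_list] map_cong refl) (use psX z(1) in \<open>simp add: ip_sym star_mult star_star\<close>)
  also have "\<dots> = (\<Sum>p\<leftarrow>ps. \<Sum>q\<leftarrow>ps. star (ip M (ract M (fst p) (snd p)) (ract M (fst q) (snd q))))"
    by (intro arg_cong[of _ _ sum_list] map_cong refl) (use psX in \<open>simp add: z(2) star_sum_list_map\<close>)
  also have "\<dots> = (\<Sum>q\<leftarrow>ps. \<Sum>p\<leftarrow>ps. star (snd q) * ip M (fst q) (fst p) * snd p)"
    by (subst sum_list_swap, intro arg_cong[of _ _ sum_list] map_cong refl) (use psX in \<open>simp add: ip_sym star_mult star_star mult.assoc\<close>)
  finally show "cpositive (\<Sum>p\<leftarrow>ps. \<Sum>q\<leftarrow>ps. star (snd p) * ip M (fst p) (fst q) * snd q)"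
    using ip_pos[OF z(1)] by simp
qed (simp add: ip_sym)


text \<open>With z the sum of the x_i b_i, the quadratic form is C^2 <z, z> - <a z, a z>, which is
  positive by \<open>bounded_ip_le\<close>. This kernel is what bounds a \<odot> id by the same
  constant C.\<close>

lemma (in hilbert_module) pos_kernel_adjointable:
  assumes ag: "is_adjoint M M a g" and C: "\<And>x. x \<in> car M \<Longrightarrow> hnorm M (a x) \<le> C * hnorm M x" "C \<ge> 0"
  shows "pos_kernel (car M) (\<lambda>x y. C\<^sup>2 *\<^sub>R ip M x y - ip M (a x) (a y))"
  unfolding pos_kernel_def
proof (intro conjI ballI allI impI)
  note m = adjoint_mem[OF ag]
  show "star (C\<^sup>2 *\<^sub>R ip M x y - ip M (a x) (a y)) = C\<^sup>2 *\<^sub>R ip M y x - ip M (a y) (a x)"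
    if "x \<in> car M" "y \<in> car M" for x y using that m by (simp add: ip_sym)
  fix ps :: "('e \<times> 'b) list" assume ps: "set ps \<subseteq> car M \<times> UNIV"
  then have psX: "fst p \<in> car M" if "p \<in> set ps" for p using that by auto
  obtain z where z: "z \<in> car M" "\<And>w. w \<in> car M \<Longrightarrow> ip M w z = (\<Sum>p\<leftarrow>ps. ip M w (ract M (fst p) (snd p)))"
    using ex_list_sum[of ps "\<lambda>p. ract M (fst p) (snd p)"] psX by auto
  have z': "ip M z w = (\<Sum>p\<leftarrow>ps. star (snd p) * ip M (fst p) w)" if w: "w \<in> car M" for w
  proof -
    have "ip M z w = star (ip M w z)" using z(1) w by (simp add: ip_sym)
    also have "\<dots> = (\<Sum>p\<leftarrow>ps. star (snd p) * ip M (fst p) w)"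
      unfolding z(2)[OF w] star_sum_list_map
      by (intro arg_cong[of _ _ sum_list] map_cong refl) (use psX w in \<open>simp add: ip_sym star_mult\<close>)
    finally show ?thesis .
  qed
  have zz: "ip M z z = (\<Sum>p\<leftarrow>ps. \<Sum>q\<leftarrow>ps. star (snd p) * ip M (fst p) (fst q) * snd q)"
    unfolding z'[OF z(1)]
    by (intro arg_cong[of _ _ sum_list] map_cong refl)
      (use psX in \<open>simp add: z(2) sum_list_const_mult[symmetric] mult.assoc cong: map_cong\<close>)
  have az: "ip M (a z) (a z) = (\<Sum>p\<leftarrow>ps. \<Sum>q\<leftarrow>ps. star (snd p) * ip M (a (fst p)) (a (fst q)) * snd q)"
  proof -
    have "ip M (a z) (a z) = ip M z (g (a z))" using z(1) m by (simp add: adjoint_ip[OF ag])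
    also have "\<dots> = (\<Sum>p\<leftarrow>ps. star (snd p) * ip M (a (fst p)) (a z))"
      using z(1) m by (subst z') (auto simp: adjoint_ip[OF ag] psX cong: map_cong)
    also have "\<dots> = (\<Sum>p\<leftarrow>ps. \<Sum>q\<leftarrow>ps. star (snd p) * ip M (a (fst p)) (a (fst q)) * snd q)"
    proof (intro arg_cong[of _ _ sum_list] map_cong refl)
      fix p assume p: "p \<in> set ps"
      have "ip M (a (fst p)) (a z) = ip M (g (a (fst p))) z"
        using adjoint_ip'[OF prehilbert_axioms prehilbert_axioms ag] psX[OF p] z(1) m by simp
      also have "\<dots> = (\<Sum>q\<leftarrow>ps. ip M (a (fst p)) (a (fst q)) * snd q)"
        using psX[OF p] m
        by (subst z(2)) (auto simp: adjoint_ip'[OF prehilbert_axioms prehilbert_axioms ag] psX cong: map_cong)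
      finally show "star (snd p) * ip M (a (fst p)) (a z) = (\<Sum>q\<leftarrow>ps. star (snd p) * ip M (a (fst p)) (a (fst q)) * snd q)"
        by (simp add: sum_list_const_mult[symmetric] mult.assoc)
    qed
    finally show ?thesis .
  qed
  have "cpositive (C\<^sup>2 *\<^sub>R ip M z z - ip M (a z) (a z))"
    using adjoint_ract[OF prehilbert_axioms hilbert_module_axioms ag] m C z(1)
    by (intro bounded_ip_le prehilbert_axioms) auto
  also have "C\<^sup>2 *\<^sub>R ip M z z - ip M (a z) (a z)
      = (\<Sum>p\<leftarrow>ps. \<Sum>q\<leftarrow>ps. star (snd p) * (C\<^sup>2 *\<^sub>R ip M (fst p) (fst q) - ip M (a (fst p)) (a (fst q))) * snd q)"
  proof -
    have sc: "r *\<^sub>R (\<Sum>p\<leftarrow>ps. f p) = (\<Sum>p\<leftarrow>ps. r *\<^sub>R (f p :: 'b))" for r f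
      by (induction ps) (auto simp: scaleR_add_right)
    show ?thesis unfolding zz az sc sum_list_subtractf[symmetric]
      by (simp add: right_diff_distrib left_diff_distrib)
  qed
  finally show "cpositive (\<Sum>p\<leftarrow>ps. \<Sum>q\<leftarrow>ps. star (snd p) * (C\<^sup>2 *\<^sub>R ip M (fst p) (fst q) - ip M (a (fst p)) (a (fst q))) * snd q)" .
qed

section \<open>The interior tensor product\<close>

locale tensor_factors = E: prehilbert E + F: correspondence F
  for E :: "('b::unital_cstar_algebra, 'e, 'm) hmod_scheme" and F :: "('b, 'f, 'n) corr_scheme"
begin

lemma alg_tensor_car: "xs \<in> car (alg_tensor E F) \<longleftrightarrow> set xs \<subseteq> car E \<times> car F"
  by (auto simp: alg_tensor_def)

lemma alg_tensor_ip:
  "ip (alg_tensor E F) xs ys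
    = (\<Sum>p\<leftarrow>xs. \<Sum>q\<leftarrow>ys. ip F (snd p) (lact F (ip E (fst p) (fst q)) (snd q)))"
  by (simp add: alg_tensor_def case_prod_unfold)

lemma alg_tensor_ip_sym:
  assumes "set xs \<subseteq> car E \<times> car F" "set ys \<subseteq> car E \<times> car F"
  shows "star (ip (alg_tensor E F) xs ys) = ip (alg_tensor E F) ys xs"
proof -
  have "star (ip F (snd p) (lact F (ip E (fst p) (fst q)) (snd q))) = ip F (snd q) (lact F (ip E (fst q) (fst p)) (snd p))"
    if "p \<in> set xs" "q \<in> set ys" for p q
  proof -
    have "fst p \<in> car E" "snd p \<in> car F" "fst q \<in> car E" "snd q \<in> car F" using that assms by auto
    then show ?thesis by (simp add: F.ip_sym F.ip_lact_left E.ip_sym)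
  qed
  then show ?thesis
    unfolding alg_tensor_ip star_sum_list_map sum_list_swap[of _ ys xs]
    by (intro arg_cong[of _ _ sum_list] map_cong refl) auto
qed

text \<open>The substance is positivity of the inner product of a list with itself; it holds because
  the left action of \<open>F\<close> carries the positive kernel \<open>ip E\<close> to positive
  sums.\<close>

lemma prehilbert_alg_tensor: "prehilbert (alg_tensor E F)"
proof
  fix xs ys zs b
  assume xs: "xs \<in> car (alg_tensor E F)"
  then have X: "fst p \<in> car E" "snd p \<in> car F" if "p \<in> set xs" for p using that by (auto simp: alg_tensor_car)
  show "ract (alg_tensor E F) xs b \<in> car (alg_tensor E F)"
    using X by (simp add: alg_tensor_car subset_iff) (fastforce simp: alg_tensor_def)
  show "ip (alg_tensor E F) xs (hzero (alg_tensor E F)) = 0"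
    unfolding alg_tensor_ip by (simp add: alg_tensor_def)
  show "cpositive (ip (alg_tensor E F) xs xs)"
    unfolding alg_tensor_ip
    using xs by (intro F.pos_kernel_imp_cpositive[OF E.pos_kernel_ip]) (auto simp: alg_tensor_car)
  assume ys: "ys \<in> car (alg_tensor E F)"
  then have Y: "fst p \<in> car E" "snd p \<in> car F" if "p \<in> set ys" for p using that by (auto simp: alg_tensor_car)
  show "hadd (alg_tensor E F) xs ys \<in> car (alg_tensor E F)" using xs ys by (auto simp: alg_tensor_def)
  show "star (ip (alg_tensor E F) xs ys) = ip (alg_tensor E F) ys xs"
    using alg_tensor_ip_sym xs ys by (simp add: alg_tensor_car)
  show "ip (alg_tensor E F) xs (ract (alg_tensor E F) ys b) = ip (alg_tensor E F) xs ys * b"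
  proof -
    have r: "ract (alg_tensor E F) ys b = map (\<lambda>p. (fst p, ract F (snd p) b)) ys"
      by (simp add: alg_tensor_def case_prod_unfold)
    show ?thesis unfolding alg_tensor_ip r sum_list_mult_const[symmetric] map_map comp_def
      by (intro arg_cong[of _ _ sum_list] map_cong refl) (simp add: X Y F.lact_ract)
  qed
  show "ip (alg_tensor E F) xs (hadd (alg_tensor E F) ys zs) = ip (alg_tensor E F) xs ys + ip (alg_tensor E F) xs zs"
    if "zs \<in> car (alg_tensor E F)"
    unfolding alg_tensor_ip by (simp add: alg_tensor_def sum_list_addf)
qed (simp add: alg_tensor_def)

sublocale A: prehilbert "alg_tensor E F" by (rule prehilbert_alg_tensor)

lemma hilbert_interior_tensor: "hilbert_module (interior_tensor E F)"
  unfolding interior_tensor_def by (rule A.hilbert_completion)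

sublocale T: hilbert_module "interior_tensor E F" by (rule hilbert_interior_tensor)

lemma tensor_mem [simp]: "x \<in> car E \<Longrightarrow> y \<in> car F \<Longrightarrow> tensor E F x y \<in> car (interior_tensor E F)"
  unfolding tensor_def interior_tensor_def by (rule A.embed_mem) (simp add: alg_tensor_car)

lemma tensor_ip:
  "\<lbrakk>x \<in> car E; y \<in> car F; x' \<in> car E; y' \<in> car F\<rbrakk> \<Longrightarrow>
    ip (interior_tensor E F) (tensor E F x y) (tensor E F x' y') = ip F y (lact F (ip E x x') y')"
  unfolding tensor_def interior_tensor_def
  by (subst A.embed_ip) (simp_all add: alg_tensor_car alg_tensor_ip)

text \<open>Embedded lists are dense in the completion and are finite sums of elementary
  tensors.\<close>

lemma tensor_total: "closed_span (interior_tensor E F) {tensor E F x y | x y. x \<in> car E \<and> y \<in> car F} = car (interior_tensor E F)"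
proof (rule T.closed_spanI_dense)
  fix P and e :: real assume "P \<in> car (interior_tensor E F)" "e > 0"
  then obtain xs where xs: "xs \<in> car (alg_tensor E F)" "hdist (interior_tensor E F) P (embed (alg_tensor E F) xs) < e"
    using A.embed_approx unfolding interior_tensor_def by blast
  have "embed (alg_tensor E F) xs \<in> clin_span (interior_tensor E F) {tensor E F x y | x y. x \<in> car E \<and> y \<in> car F}"
    using xs(1)
  proof (induction xs)
    case Nil
    have "embed (alg_tensor E F) [] = hzero (interior_tensor E F)"
      using A.embed_hzero by (simp add: interior_tensor_def alg_tensor_def)
    then show ?case by (simp add: clin_span.zero)
  next
    case (Cons p xs)
    then have p: "fst p \<in> car E" "snd p \<in> car F" and xs: "xs \<in> car (alg_tensor E F)" by (auto simp: alg_tensor_car)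
    have "embed (alg_tensor E F) (p # xs) = hadd (interior_tensor E F) (tensor E F (fst p) (snd p)) (embed (alg_tensor E F) xs)"
    proof -
      have "hadd (alg_tensor E F) [(fst p, snd p)] xs = p # xs" by (simp add: alg_tensor_def)
      then show ?thesis unfolding interior_tensor_def tensor_def
        using p xs A.embed_hadd[of "[(fst p, snd p)]" xs] by (simp add: alg_tensor_car mem_Times_iff)
    qed
    then show ?case using clin_span.add[OF clin_span.base Cons.IH[OF xs], of "tensor E F (fst p) (snd p)"] p by auto
  qed
  with xs show "\<exists>y\<in>clin_span (interior_tensor E F) {tensor E F x y | x y. x \<in> car E \<and> y \<in> car F}.
      hdist (interior_tensor E F) P y < e" by blast
qed

end

section \<open>The operators a \<odot> id\<close>

locale tensor_operator = E: hilbert_module E + tensor_factors E F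
  for E :: "('b::unital_cstar_algebra, 'e, 'm) hmod_scheme" and F :: "('b, 'f, 'n) corr_scheme" +
  fixes a g :: "'e \<Rightarrow> 'e" and C :: real
  assumes ag: "is_adjoint E E a g" and C: "\<And>x. x \<in> car E \<Longrightarrow> hnorm E (a x) \<le> C * hnorm E x" "C \<ge> 0"
begin

lemma map_mem: "xs \<in> car (alg_tensor E F) \<Longrightarrow> map (\<lambda>(x, y). (a x, y)) xs \<in> car (alg_tensor E F)"
  using adjoint_mem(1)[OF ag] by (auto simp: alg_tensor_car)

text \<open>C^2 <xs, xs> minus the inner product of the image list with itself is the sum for the
  kernel of \<open>pos_kernel_adjointable\<close>, hence positive.\<close>

lemma map_hnorm:
  assumes xs: "xs \<in> car (alg_tensor E F)"
  shows "hnorm (alg_tensor E F) (map (\<lambda>(x, y). (a x, y)) xs) \<le> C * hnorm (alg_tensor E F) xs"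
proof (rule A.hnorm_leI)
  let ?ax = "map (\<lambda>(x, y). (a x, y)) xs"
  have X: "fst p \<in> car E" "snd p \<in> car F" if "p \<in> set xs" for p using that xs by (auto simp: alg_tensor_car)
  have sc: "r *\<^sub>R (\<Sum>p\<leftarrow>ps. f p) = (\<Sum>p\<leftarrow>ps. r *\<^sub>R (f p :: 'b))" for r f and ps :: "('e \<times> 'f) list"
    by (induction ps) (auto simp: scaleR_add_right)
  have "cpositive (\<Sum>p\<leftarrow>xs. \<Sum>q\<leftarrow>xs. ip F (snd p) (lact F (C\<^sup>2 *\<^sub>R ip E (fst p) (fst q) - ip E (a (fst p)) (a (fst q))) (snd q)))"
    by (rule F.pos_kernel_imp_cpositive[OF E.pos_kernel_adjointable[OF ag C]])
      (use xs in \<open>auto simp: alg_tensor_car\<close>)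
  also have "(\<Sum>p\<leftarrow>xs. \<Sum>q\<leftarrow>xs. ip F (snd p) (lact F (C\<^sup>2 *\<^sub>R ip E (fst p) (fst q) - ip E (a (fst p)) (a (fst q))) (snd q)))
      = C\<^sup>2 *\<^sub>R ip (alg_tensor E F) xs xs - ip (alg_tensor E F) ?ax ?ax"
    unfolding alg_tensor_ip sc sum_list_subtractf[symmetric] map_map comp_def case_prod_unfold fst_conv snd_conv
    by (intro arg_cong[of _ _ sum_list] map_cong refl) (simp add: X F.ip_lact_diff F.ip_lact_scaleR)
  finally have "norm (ip (alg_tensor E F) ?ax ?ax) \<le> norm (C\<^sup>2 *\<^sub>R ip (alg_tensor E F) xs xs)"
    by (rule cpositive_norm_mono[OF A.ip_pos[OF map_mem[OF xs]]])
  then show "norm (ip (alg_tensor E F) ?ax ?ax) \<le> (C * hnorm (alg_tensor E F) xs)\<^sup>2"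
    by (simp add: power_mult_distrib A.hnorm_sq)
qed (simp add: C)

lemma map_hdist:
  assumes "xs \<in> car (alg_tensor E F)" "ys \<in> car (alg_tensor E F)"
  shows "hdist (alg_tensor E F) (map (\<lambda>(x, y). (a x, y)) xs) (map (\<lambda>(x, y). (a x, y)) ys)
    \<le> C * hdist (alg_tensor E F) xs ys"
proof -
  have "hadd (alg_tensor E F) (map (\<lambda>(x, y). (a x, y)) xs) (ract (alg_tensor E F) (map (\<lambda>(x, y). (a x, y)) ys) (- 1))
      = map (\<lambda>(x, y). (a x, y)) (hadd (alg_tensor E F) xs (ract (alg_tensor E F) ys (- 1)))"
    by (simp add: alg_tensor_def case_prod_unfold)
  then show ?thesis using map_hnorm[of "hadd (alg_tensor E F) xs (ract (alg_tensor E F) ys (- 1))"] assms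
    by (simp add: hdist_def)
qed

lemma map_hCauchy: "hCauchy (alg_tensor E F) X \<Longrightarrow> hCauchy (alg_tensor E F) (\<lambda>n. map (\<lambda>(x, y). (a x, y)) (X n))"
  by (rule A.hCauchy_lipschitz[OF _ map_mem map_hdist C(2)])

lemma tensor_id_cclass:
  "hCauchy (alg_tensor E F) X \<Longrightarrow>
    tensor_id E F a (cclass (alg_tensor E F) X) = cclass (alg_tensor E F) (\<lambda>n. map (\<lambda>(x, y). (a x, y)) (X n))"
  unfolding tensor_id_def by (rule A.cclass_lipschitz[OF _ map_mem map_hdist C(2)])

lemma tensor_id_tensor:
  "x \<in> car E \<Longrightarrow> y \<in> car F \<Longrightarrow> tensor_id E F a (tensor E F x y) = tensor E F (a x) y"
  unfolding tensor_def embed_def by (subst tensor_id_cclass) (simp_all add: alg_tensor_car)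

lemma tensor_id_mem: "P \<in> car (interior_tensor E F) \<Longrightarrow> tensor_id E F a P \<in> car (interior_tensor E F)"
  unfolding interior_tensor_def
  by (erule A.completion_cases) (simp add: tensor_id_cclass map_hCauchy)

lemma tensor_id_hnorm:
  assumes "P \<in> car (interior_tensor E F)"
  shows "hnorm (interior_tensor E F) (tensor_id E F a P) \<le> C * hnorm (interior_tensor E F) P"
proof -
  obtain X where X: "hCauchy (alg_tensor E F) X" "P = cclass (alg_tensor E F) X"
    using assms unfolding interior_tensor_def by (rule A.completion_cases)
  have "(\<lambda>n. C * hnorm (alg_tensor E F) (X n)) \<longlonglongrightarrow> C * hnorm (interior_tensor E F) P"
    unfolding X(2) interior_tensor_def by (intro tendsto_intros A.completion_hnorm_lim X(1))
  moreover have "(\<lambda>n. hnorm (alg_tensor E F) (map (\<lambda>(x, y). (a x, y)) (X n))) \<longlonglongrightarrow> hnorm (interior_tensor E F) (tensor_id E F a P)"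
    unfolding X(2) interior_tensor_def tensor_id_cclass[OF X(1)] by (intro A.completion_hnorm_lim map_hCauchy X(1))
  ultimately show ?thesis
    using map_hnorm[OF A.hCauchy_mem[OF X(1)]] by (intro LIMSEQ_le[where X = "\<lambda>n. hnorm (alg_tensor E F) (map (\<lambda>(x, y). (a x, y)) (X n))"]) auto
qed

text \<open>On lists the identity is term by term. It extends to classes because \<open>g\<close> is
  adjointable too, hence bounded, so that g \<odot> id is also defined by Lipschitz maps.\<close>

lemma tensor_id_adjoint:
  "is_adjoint (interior_tensor E F) (interior_tensor E F) (tensor_id E F a) (tensor_id E F g)"
proof -
  have ga: "is_adjoint E E g a" by (rule adjoint_swap[OF E.prehilbert_axioms E.prehilbert_axioms ag])
  obtain D where "D \<ge> 0" "\<forall>x\<in>car E. hnorm E (g x) \<le> D * hnorm E x"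
    using adjoint_bounded[OF E.prehilbert_axioms E.hilbert_module_axioms ga] by blast
  then interpret G: tensor_operator E F g a D
    by (unfold_locales) (use ga in auto)
  have "ip (interior_tensor E F) (tensor_id E F a P) Q = ip (interior_tensor E F) P (tensor_id E F g Q)"
    if PQ: "P \<in> car (interior_tensor E F)" "Q \<in> car (interior_tensor E F)" for P Q
  proof -
    obtain X where X: "hCauchy (alg_tensor E F) X" "P = cclass (alg_tensor E F) X"
      using PQ(1) unfolding interior_tensor_def by (rule A.completion_cases)
    obtain Y where Y: "hCauchy (alg_tensor E F) Y" "Q = cclass (alg_tensor E F) Y"
      using PQ(2) unfolding interior_tensor_def by (rule A.completion_cases)
    have "ip (alg_tensor E F) (map (\<lambda>(x, y). (a x, y)) (X n)) (Y n) = ip (alg_tensor E F) (X n) (map (\<lambda>(x, y). (g x, y)) (Y n))" for n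
    proof -
      have Xn: "fst p \<in> car E" if "p \<in> set (X n)" for p using that A.hCauchy_mem[OF X(1), of n] by (auto simp: alg_tensor_car)
      have Yn: "fst p \<in> car E" if "p \<in> set (Y n)" for p using that A.hCauchy_mem[OF Y(1), of n] by (auto simp: alg_tensor_car)
      show ?thesis
        unfolding alg_tensor_ip map_map comp_def case_prod_unfold fst_conv snd_conv
        by (intro arg_cong[of _ _ sum_list] map_cong refl) (simp add: Xn Yn adjoint_ip[OF ag])
    qed
    moreover have "(\<lambda>n. ip (alg_tensor E F) (map (\<lambda>(x, y). (a x, y)) (X n)) (Y n)) \<longlonglongrightarrow> ip (interior_tensor E F) (tensor_id E F a P) Q"
      unfolding X(2) Y(2) interior_tensor_def tensor_id_cclass[OF X(1)] by (intro A.completion_ip_lim map_hCauchy X(1) Y(1))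
    moreover have "(\<lambda>n. ip (alg_tensor E F) (X n) (map (\<lambda>(x, y). (g x, y)) (Y n))) \<longlonglongrightarrow> ip (interior_tensor E F) P (tensor_id E F g Q)"
      unfolding X(2) Y(2) interior_tensor_def G.tensor_id_cclass[OF Y(1)] by (intro A.completion_ip_lim G.map_hCauchy X(1) Y(1))
    ultimately show ?thesis using LIMSEQ_unique by simp
  qed
  then show ?thesis using tensor_id_mem G.tensor_id_mem by (auto simp: is_adjoint_def)
qed

end

text \<open>Any map with the inner products of elementary tensors is additive in both variables,
  balanced over the algebra, right linear and bounded. This serves the product of the system, the
  action of fibres on the inductive limit, and \<open>tensor\<close> itself.\<close>

locale tensor_map = E: prehilbert E + F: correspondence F + G: hilbert_module G
  for E :: "('b::unital_cstar_algebra, 'e, 'm) hmod_scheme" and F :: "('b, 'f, 'n) corr_scheme"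
    and G :: "('b, 'g, 'k) hmod_scheme" +
  fixes m :: "'e \<Rightarrow> 'f \<Rightarrow> 'g"
  assumes m_mem [simp, intro]: "x \<in> car E \<Longrightarrow> y \<in> car F \<Longrightarrow> m x y \<in> car G"
    and m_ip: "\<lbrakk>x \<in> car E; y \<in> car F; x' \<in> car E; y' \<in> car F\<rbrakk>
        \<Longrightarrow> ip G (m x y) (m x' y') = ip F y (lact F (ip E x x') y')"
begin

lemma m_hnorm:
  assumes "x \<in> car E" "y \<in> car F"
  shows "hnorm G (m x y) \<le> hnorm E x * hnorm F y"
  using F.norm_ip_lact[OF assms(2), of "ip E x x"] assms
  by (intro G.hnorm_leI) (simp_all add: m_ip power_mult_distrib E.hnorm_sq)

text \<open>Additivity of \<open>m\<close> is derived only afterwards, so m x y - m x' y and m (x -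
  x') y are compared through their inner products.\<close>

lemma m_hdist_left:
  assumes "x \<in> car E" "x' \<in> car E" "y \<in> car F"
  shows "hdist G (m x y) (m x' y) \<le> hdist E x x' * hnorm F y"
proof -
  define d where "d = hadd E x (ract E x' (- 1))"
  have d: "d \<in> car E" using assms by (simp add: d_def)
  have "(hdist G (m x y) (m x' y))\<^sup>2 = (hnorm G (m d y))\<^sup>2"
    unfolding G.hdist_sq[OF m_mem[OF assms(1,3)] m_mem[OF assms(2,3)]] G.hnorm_sq
    using assms d by (simp add: m_ip)
      (simp add: d_def F.ip_lact_add F.ip_lact_diff F.ip_lact_minus algebra_simps)
  then have "hdist G (m x y) (m x' y) = hnorm G (m d y)" by (simp add: power2_eq_iff_nonneg)
  then show ?thesis using m_hnorm[OF d assms(3)] by (simp add: hdist_def d_def)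
qed

lemma m_hdist_right:
  assumes "x \<in> car E" "y \<in> car F" "y' \<in> car F"
  shows "hdist G (m x y) (m x y') \<le> hnorm E x * hdist F y y'"
proof -
  define d where "d = hadd F y (ract F y' (- 1))"
  have d: "d \<in> car F" using assms by (simp add: d_def)
  have "(hdist G (m x y) (m x y'))\<^sup>2 = (hnorm G (m x d))\<^sup>2"
    unfolding G.hdist_sq[OF m_mem[OF assms(1,2)] m_mem[OF assms(1,3)]] G.hnorm_sq
    using assms d by (simp add: m_ip)
      (simp add: d_def F.lact_hadd F.lact_ract algebra_simps)
  then have "hdist G (m x y) (m x y') = hnorm G (m x d)" by (simp add: power2_eq_iff_nonneg)
  then show ?thesis using m_hnorm[OF assms(1) d] by (simp add: hdist_def d_def)
qed

lemma m_add_left: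
  assumes "x \<in> car E" "x' \<in> car E" "y \<in> car F"
  shows "m (hadd E x x') y = hadd G (m x y) (m x' y)"
proof (rule G.hdist_0_imp_eq)
  have "(hdist G (m (hadd E x x') y) (hadd G (m x y) (m x' y)))\<^sup>2 = 0"
    using assms by (subst G.hdist_sq) (simp_all add: m_ip F.ip_lact_add)
  then show "hdist G (m (hadd E x x') y) (hadd G (m x y) (m x' y)) = 0" by simp
qed (use assms in auto)

lemma m_add_right:
  assumes "x \<in> car E" "y \<in> car F" "y' \<in> car F"
  shows "m x (hadd F y y') = hadd G (m x y) (m x y')"
proof (rule G.hdist_0_imp_eq)
  have "(hdist G (m x (hadd F y y')) (hadd G (m x y) (m x y')))\<^sup>2 = 0"
    using assms by (subst G.hdist_sq) (simp_all add: m_ip F.lact_hadd)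
  then show "hdist G (m x (hadd F y y')) (hadd G (m x y) (m x y')) = 0" by simp
qed (use assms in auto)

lemma m_ract_right:
  assumes "x \<in> car E" "y \<in> car F"
  shows "m x (ract F y b) = ract G (m x y) b"
proof (rule G.hdist_0_imp_eq)
  have "(hdist G (m x (ract F y b)) (ract G (m x y) b))\<^sup>2 = 0"
    using assms by (subst G.hdist_sq) (simp_all add: m_ip F.lact_ract algebra_simps)
  then show "hdist G (m x (ract F y b)) (ract G (m x y) b) = 0" by simp
qed (use assms in auto)

lemma m_ract_left:
  assumes "x \<in> car E" "y \<in> car F"
  shows "m (ract E x b) y = m x (lact F b y)"
proof (rule G.hdist_0_imp_eq)
  have "(hdist G (m (ract E x b) y) (m x (lact F b y)))\<^sup>2 = 0"
    using assms by (subst G.hdist_sq) (simp_all add: m_ip F.ip_lact_left F.lact_mult star_star)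
  then show "hdist G (m (ract E x b) y) (m x (lact F b y)) = 0" by simp
qed (use assms in auto)

end


section \<open>Isometric embeddings\<close>

lemma hilbert_imp_prehilbert: "hilbert_module M \<Longrightarrow> prehilbert M"
proof -
  assume "hilbert_module M"
  then interpret hilbert_module M .
  show ?thesis by (rule prehilbert_axioms)
qed

lemma isometric_embeddingD:
  assumes "isometric_embedding M N f"
  shows "x \<in> car M \<Longrightarrow> f x \<in> car N"
    and "x \<in> car M \<Longrightarrow> y \<in> car M \<Longrightarrow> f (hadd M x y) = hadd N (f x) (f y)"
    and "x \<in> car M \<Longrightarrow> f (ract M x b) = ract N (f x) b"
    and "x \<in> car M \<Longrightarrow> y \<in> car M \<Longrightarrow> ip N (f x) (f y) = ip M x y"
  using assms by (auto simp: isometric_embedding_def)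

lemma isometric_embedding_hnorm:
  "isometric_embedding M N f \<Longrightarrow> x \<in> car M \<Longrightarrow> hnorm N (f x) = hnorm M x"
  by (simp add: hnorm_def isometric_embeddingD)

lemma isometric_embedding_hdist:
  assumes "prehilbert M" "isometric_embedding M N f" "x \<in> car M" "y \<in> car M"
  shows "hdist N (f x) (f y) = hdist M x y"
proof -
  interpret M: prehilbert M by fact
  show ?thesis unfolding hdist_def using assms(3,4)
    by (simp add: isometric_embedding_hnorm[OF assms(2), symmetric] isometric_embeddingD[OF assms(2)])
qed

lemma isometric_embedding_hzero:
  assumes "prehilbert M" "hilbert_module N" "isometric_embedding M N f"
  shows "f (hzero M) = hzero N"
proof -
  interpret M: prehilbert M by fact
  interpret N: hilbert_module N by fact
  show ?thesis
    by (rule N.ip_definite) (simp_all add: isometric_embeddingD[OF assms(3)])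
qed

lemma isometric_embedding_clin_span:
  assumes "prehilbert M" "hilbert_module N" "isometric_embedding M N f" "A \<subseteq> car M" "x \<in> clin_span M A"
  shows "f x \<in> clin_span N (f ` A)"
  using assms(5)
proof induction
  case zero
  then show ?case using isometric_embedding_hzero[OF assms(1-3)] by (simp add: clin_span.zero)
next
  case (base x)
  then show ?case by (simp add: clin_span.base)
next
  case (add x y)
  then have "x \<in> car M" "y \<in> car M" using prehilbert.clin_span_subset[OF assms(1,4)] by auto
  then show ?case using add by (simp add: isometric_embeddingD(2)[OF assms(3)] clin_span.add)
next
  case (scale x c)
  then have "x \<in> car M" using prehilbert.clin_span_subset[OF assms(1,4)] by auto
  then show ?case using scale by (simp add: isometric_embeddingD(3)[OF assms(3)] clin_span.scale)
qed

lemma isometric_embedding_approx_clin_span: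
  assumes "prehilbert M" "hilbert_module N" "isometric_embedding M N f" "A \<subseteq> car M" "closed_span M A = car M"
    and "x \<in> car M" "e > 0"
  shows "\<exists>y\<in>clin_span N (f ` A). hdist N (f x) y < e"
proof -
  have "x \<in> closed_span M A" using assms by simp
  then obtain z where z: "z \<in> clin_span M A" "hdist M x z < e" using assms(7) by (auto simp: closed_span_def)
  have "z \<in> car M" using z(1) prehilbert.clin_span_subset[OF assms(1,4)] by auto
  then have "hdist N (f x) (f z) < e" using z(2) assms by (simp add: isometric_embedding_hdist)
  then show ?thesis using isometric_embedding_clin_span[OF assms(1-4) z(1)] by blast
qed

lemma unitary_total:
  assumes "prehilbert M" "hilbert_module N" "unitary M N f" "A \<subseteq> car M" "closed_span M A = car M"
  shows "closed_span N (f ` A) = car N"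
proof (rule prehilbert.closed_spanI_dense)
  show "prehilbert N" using assms(2) by (rule hilbert_imp_prehilbert)
  fix x and e :: real assume "x \<in> car N" "e > 0"
  moreover have f: "isometric_embedding M N f" "f ` car M = car N" using assms(3) by (auto simp: unitary_def)
  ultimately obtain z where "z \<in> car M" "x = f z" by auto
  then show "\<exists>y\<in>clin_span N (f ` A). hdist N x y < e"
    using isometric_embedding_approx_clin_span[OF assms(1,2) f(1) assms(4,5) _ \<open>e > 0\<close>] by simp
qed

lemma unitary_adjoint_ex:
  assumes "prehilbert M" "unitary M N f"
  shows "\<exists>g. is_adjoint M N f g"
proof -
  have f: "isometric_embedding M N f" "f ` car M = car N" using assms(2) by (auto simp: unitary_def)
  define g where "g = inv_into (car M) f"
  have g: "g y \<in> car M \<and> f (g y) = y" if "y \<in> car N" for y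
    using that f(2) inv_into_into[of y f "car M"] f_inv_into_f[of y f "car M"] by (simp add: g_def)
  have "ip N (f x) y = ip M x (g y)" if "x \<in> car M" "y \<in> car N" for x y
    using isometric_embeddingD(4)[OF f(1) that(1), of "g y"] g[OF that(2)] by simp
  then show ?thesis using g isometric_embeddingD(1)[OF f(1)] by (intro exI[of _ g]) (auto simp: is_adjoint_def)
qed

text \<open>The chosen adjoint is arbitrary off the carrier; on it, isometry of \<open>f\<close>
  forces it to invert \<open>f\<close>.\<close>

lemma hadjoint_unitary:
  assumes "hilbert_module M" "unitary M N f" "x \<in> car M"
  shows "hadjoint M N f (f x) = x"
proof -
  interpret M: hilbert_module M by fact
  have f: "isometric_embedding M N f" using assms(2) by (auto simp: unitary_def)
  have ad: "is_adjoint M N f (hadjoint M N f)"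
    unfolding hadjoint_def by (rule someI_ex[OF unitary_adjoint_ex[OF M.prehilbert_axioms assms(2)]])
  have fx: "f x \<in> car N" using isometric_embeddingD(1)[OF f assms(3)] .
  show ?thesis
  proof (rule M.eqI)
    fix z assume z: "z \<in> car M"
    show "ip M z (hadjoint M N f (f x)) = ip M z x"
      using adjoint_ip[OF ad z fx] isometric_embeddingD(4)[OF f z assms(3)] by simp
  qed (use adjoint_mem(2)[OF ad fx] assms(3) in auto)
qed

section \<open>Product systems\<close>

context product_system
begin

lemma fib_hilbert: "t \<ge> 0 \<Longrightarrow> hilbert_module (fib E t)"
  using fib_corr correspondence.axioms(1) by blast

lemma fib_prehilbert: "t \<ge> 0 \<Longrightarrow> prehilbert (fib E t)"
  using fib_hilbert hilbert_imp_prehilbert by blast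

lemma corr_tensor_simps [simp]:
  "car (corr_tensor A B) = car (interior_tensor A B)" "ip (corr_tensor A B) = ip (interior_tensor A B)"
  "hadd (corr_tensor A B) = hadd (interior_tensor A B)" "ract (corr_tensor A B) = ract (interior_tensor A B)"
  by (simp_all add: corr_tensor_def hmod.defs corr.defs)

lemma umul_interior: 
  assumes "s \<ge> 0" "t \<ge> 0"
  shows "unitary (interior_tensor (fib E s) (fib E t)) (fib E (s + t)) (umul E s t)"
  using umul_unitary[OF assms] by (simp add: bilinear_unitary_def unitary_def isometric_embedding_def)

lemma tensor_factors_fib: "s \<ge> 0 \<Longrightarrow> t \<ge> 0 \<Longrightarrow> tensor_factors (fib E s) (fib E t)"
  by (simp add: tensor_factors_def fib_prehilbert fib_corr)

lemma tensor_map_pmul: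
  assumes "s \<ge> 0" "t \<ge> 0"
  shows "tensor_map (fib E s) (fib E t) (fib E (s + t)) (pmul E s t)"
proof -
  interpret T: tensor_factors "fib E s" "fib E t" using tensor_factors_fib assms .
  note u = umul_interior[OF assms, unfolded unitary_def, THEN conjunct1]
  show ?thesis
    by (intro tensor_map.intro tensor_map_axioms.intro fib_prehilbert fib_corr fib_hilbert)
      (simp_all add: assms pmul_def isometric_embeddingD[OF u] T.tensor_ip)
qed

lemmas pmul_mem = tensor_map.m_mem[OF tensor_map_pmul]
lemmas pmul_ip = tensor_map.m_ip[OF tensor_map_pmul]

lemma pmul_mem' [simp]: "\<lbrakk>s \<ge> 0; t \<ge> 0; x \<in> car (fib E s); y \<in> car (fib E t); r = s + t\<rbrakk> \<Longrightarrow> pmul E s t x y \<in> car (fib E r)"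
  using pmul_mem by simp

lemma pmul_total:
  assumes "s \<ge> 0" "t \<ge> 0"
  shows "closed_span (fib E (s + t)) {pmul E s t x y | x y. x \<in> car (fib E s) \<and> y \<in> car (fib E t)} = car (fib E (s + t))"
proof -
  interpret T: tensor_factors "fib E s" "fib E t" using tensor_factors_fib assms .
  have "closed_span (fib E (s + t)) (umul E s t ` {tensor (fib E s) (fib E t) x y | x y. x \<in> car (fib E s) \<and> y \<in> car (fib E t)}) = car (fib E (s + t))"
    by (rule unitary_total[OF T.T.prehilbert_axioms fib_hilbert umul_interior _ T.tensor_total]) (use assms in auto)
  also have "umul E s t ` {tensor (fib E s) (fib E t) x y | x y. x \<in> car (fib E s) \<and> y \<in> car (fib E t)}
      = {pmul E s t x y | x y. x \<in> car (fib E s) \<and> y \<in> car (fib E t)}"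
    by (auto simp: pmul_def)
  finally show ?thesis .
qed

lemma iota_mem [simp]: "iota E b \<in> car (fib E 0)"
  using iota_unitary by (auto simp: bilinear_unitary_def unitary_def isometric_embedding_def trivial_corr_def)

lemma iota_surj: "x \<in> car (fib E 0) \<Longrightarrow> \<exists>b. x = iota E b"
  using iota_unitary by (auto simp: bilinear_unitary_def unitary_def trivial_corr_def)

lemma iota_ip: "ip (fib E 0) (iota E b) (iota E c) = star b * c"
  using iota_unitary by (simp add: bilinear_unitary_def unitary_def isometric_embedding_def trivial_corr_def)

lemma iota_lact: "iota E (b * c) = lact (fib E 0) b (iota E c)"
  using iota_unitary by (simp add: bilinear_unitary_def trivial_corr_def)

lemma lact_mem [simp]: "t \<ge> 0 \<Longrightarrow> x \<in> car (fib E t) \<Longrightarrow> lact (fib E t) b x \<in> car (fib E t)"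
  by (rule correspondence.lact_mem[OF fib_corr])

lemma lact_one [simp]: "t \<ge> 0 \<Longrightarrow> x \<in> car (fib E t) \<Longrightarrow> lact (fib E t) 1 x = x"
  by (rule correspondence.lact_one[OF fib_corr])

lemma ract_mem [simp]: "t \<ge> 0 \<Longrightarrow> x \<in> car (fib E t) \<Longrightarrow> ract (fib E t) x b \<in> car (fib E t)"
  by (rule hilbert_module.ract_closed[OF fib_hilbert])

text \<open>Acting by b is multiplying by \<open>iota E b\<close> from the left, so this is
  associativity at index 0.\<close>

lemma pmul_lact:
  assumes "s \<ge> 0" "t \<ge> 0" "x \<in> car (fib E s)" "y \<in> car (fib E t)"
  shows "lact (fib E (s + t)) b (pmul E s t x y) = pmul E s t (lact (fib E s) b x) y"
  using pmul_assoc[of 0 s t "iota E b" x y] assms by (simp add: pmul_left)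

end

section \<open>The inductive limit over a unital unit\<close>

locale unital_unit = product_system E for E :: "('b::unital_cstar_algebra, 'e) psys" +
  fixes \<xi> :: "real \<Rightarrow> 'e"
  assumes \<xi>_unital: "unital_ps_unit E \<xi>"
begin

abbreviation "L \<equiv> alg_indlim E \<xi>"
abbreviation "H \<equiv> indlim E \<xi>"
abbreviation "j \<equiv> ilim_embed E \<xi>"

lemma \<xi>_mem [simp]: "t \<ge> 0 \<Longrightarrow> \<xi> t \<in> car (fib E t)"
  and \<xi>_mult: "s \<ge> 0 \<Longrightarrow> t \<ge> 0 \<Longrightarrow> pmul E s t (\<xi> s) (\<xi> t) = \<xi> (s + t)"
  and \<xi>_0: "\<xi> 0 = iota E 1"
  and \<xi>_ip [simp]: "t \<ge> 0 \<Longrightarrow> ip (fib E t) (\<xi> t) (\<xi> t) = 1"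
  using \<xi>_unital by (auto simp: unital_ps_unit_def ps_unit_def)

lemma \<xi>_hnorm: "t \<ge> 0 \<Longrightarrow> hnorm (fib E t) (\<xi> t) \<le> 1"
  using norm_one_le[where 'b='b] by (simp add: hnorm_def)

lemma transport_eq: "transport E \<xi> r p = pmul E (r - fst p) (fst p) (\<xi> (r - fst p)) (snd p)"
  by (simp add: transport_def case_prod_unfold)

lemma L_car: "p \<in> car L \<longleftrightarrow> fst p \<ge> 0 \<and> snd p \<in> car (fib E (fst p))"
  by (auto simp: alg_indlim_def)

lemma transport_mem [simp]: "p \<in> car L \<Longrightarrow> fst p \<le> r \<Longrightarrow> transport E \<xi> r p \<in> car (fib E r)"
  by (simp add: transport_eq L_car)

lemma transport_ip:
  assumes "0 \<le> t" "t \<le> r" "x \<in> car (fib E t)" "y \<in> car (fib E t)"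
  shows "ip (fib E r) (transport E \<xi> r (t, x)) (transport E \<xi> r (t, y)) = ip (fib E t) x y"
  using pmul_ip[of "r - t" t "\<xi> (r - t)" x "\<xi> (r - t)" y] assms by (simp add: transport_eq)

text \<open>Associativity together with \<xi>_(q-r) \<xi>_(r-t) = \<xi>_(q-t).\<close>

lemma transport_transport:
  assumes "p \<in> car L" "fst p \<le> r" "r \<le> q"
  shows "transport E \<xi> q (r, transport E \<xi> r p) = transport E \<xi> q p"
  using pmul_assoc[of "q - r" "r - fst p" "fst p" "\<xi> (q - r)" "\<xi> (r - fst p)" "snd p"] \<xi>_mult[of "q - r" "r - fst p"] assms
  by (simp add: transport_eq L_car)

lemma transport_self: "p \<in> car L \<Longrightarrow> transport E \<xi> (fst p) p = snd p"
  by (simp add: transport_eq L_car \<xi>_0 pmul_left)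

text \<open>Transport is isometric because \<xi> is unital, so every common index gives the same
  value as the maximum used in \<open>alg_indlim\<close>. This makes it possible to compare three or
  more pairs at one index.\<close>

lemma L_ip:
  assumes "p \<in> car L" "q \<in> car L" "fst p \<le> r" "fst q \<le> r"
  shows "ip L p q = ip (fib E r) (transport E \<xi> r p) (transport E \<xi> r q)"
proof -
  let ?m = "max (fst p) (fst q)"
  have "ip L p q = ip (fib E ?m) (transport E \<xi> ?m p) (transport E \<xi> ?m q)"
    by (simp add: alg_indlim_def Let_def)
  also have "\<dots> = ip (fib E r) (transport E \<xi> r (?m, transport E \<xi> ?m p)) (transport E \<xi> r (?m, transport E \<xi> ?m q))"
    using assms by (subst transport_ip) (auto simp: L_car)
  also have "\<dots> = ip (fib E r) (transport E \<xi> r p) (transport E \<xi> r q)"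
    using assms by (simp add: transport_transport)
  finally show ?thesis .
qed

lemma transport_hadd:
  assumes "0 \<le> t" "t \<le> r" "x \<in> car (fib E t)" "y \<in> car (fib E t)"
  shows "transport E \<xi> r (t, hadd (fib E t) x y) = hadd (fib E r) (transport E \<xi> r (t, x)) (transport E \<xi> r (t, y))"
  using tensor_map.m_add_right[OF tensor_map_pmul[of "r - t" t], of "\<xi> (r - t)" x y] assms
  by (simp add: transport_eq)

lemma transport_ract:
  assumes "0 \<le> t" "t \<le> r" "x \<in> car (fib E t)"
  shows "transport E \<xi> r (t, ract (fib E t) x b) = ract (fib E r) (transport E \<xi> r (t, x)) b"
  using tensor_map.m_ract_right[OF tensor_map_pmul[of "r - t" t], of "\<xi> (r - t)" x b] assms
  by (simp add: transport_eq)

lemma transport_L_hadd: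
  assumes "p \<in> car L" "q \<in> car L" "fst p \<le> r" "fst q \<le> r"
  shows "transport E \<xi> r (hadd L p q) = hadd (fib E r) (transport E \<xi> r p) (transport E \<xi> r q)"
proof -
  let ?m = "max (fst p) (fst q)"
  have "hadd L p q = (?m, hadd (fib E ?m) (transport E \<xi> ?m p) (transport E \<xi> ?m q))"
    by (simp add: alg_indlim_def Let_def)
  moreover have "0 \<le> ?m" "?m \<le> r" using assms by (auto simp: L_car)
  ultimately show ?thesis using assms by (simp add: transport_hadd transport_transport)
qed

lemma prehilbert_L: "prehilbert L"
proof
  interpret F0: hilbert_module "fib E 0" by (rule fib_hilbert) simp
  show z: "hzero L \<in> car L" by (simp add: alg_indlim_def)
  fix p q u b
  assume p: "p \<in> car L"
  define r0 where "r0 = fst p"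
  have r0: "r0 \<ge> 0" using p by (simp add: r0_def L_car)
  interpret F: hilbert_module "fib E r0" by (rule fib_hilbert[OF r0])
  show "cpositive (ip L p p)" using L_ip[OF p p, of r0] p by (simp add: r0_def F.ip_pos[unfolded r0_def])
  show "ip L p (hzero L) = 0"
  proof -
    have "transport E \<xi> r0 (hzero L) = hzero (fib E r0)"
    proof -
      have "transport E \<xi> r0 (0, ract (fib E 0) (hzero (fib E 0)) 0) = ract (fib E r0) (transport E \<xi> r0 (0, hzero (fib E 0))) 0"
        using r0 by (intro transport_ract) auto
      moreover have "ract (fib E 0) (hzero (fib E 0)) 0 = hzero (fib E 0)" by (rule F0.ip_definite) auto
      moreover have "ract (fib E r0) (transport E \<xi> r0 (0, hzero (fib E 0))) 0 = hzero (fib E r0)"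
        using r0 by (intro F.ip_definite) (auto simp: L_car)
      ultimately show ?thesis by (simp add: alg_indlim_def)
    qed
    then show ?thesis using L_ip[OF p z, of r0] r0 p by (simp add: r0_def) (simp add: alg_indlim_def F.ip_zero_right[unfolded r0_def])
  qed
  show "ract L p b \<in> car L" using p by (auto simp: alg_indlim_def)
  assume q: "q \<in> car L"
  show "hadd L p q \<in> car L"
  proof -
    let ?m = "max (fst p) (fst q)"
    have m: "?m \<ge> 0" using p by (auto simp: L_car)
    interpret Fm: hilbert_module "fib E ?m" by (rule fib_hilbert[OF m])
    have "hadd L p q = (?m, hadd (fib E ?m) (transport E \<xi> ?m p) (transport E \<xi> ?m q))"
      by (simp add: alg_indlim_def Let_def)
    then show ?thesis using m p q by (simp add: L_car)
  qed
  define r where "r = max (fst p) (fst q)"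
  have r: "r \<ge> 0" "fst p \<le> r" "fst q \<le> r" using p by (auto simp: r_def L_car)
  interpret R: hilbert_module "fib E r" by (rule fib_hilbert[OF r(1)])
  show "star (ip L p q) = ip L q p" using p q r by (simp add: L_ip[of _ _ r] R.ip_sym)
  show "ip L p (ract L q b) = ip L p q * b"
  proof -
    have rq: "ract L q b = (fst q, ract (fib E (fst q)) (snd q) b)" by (simp add: alg_indlim_def case_prod_unfold)
    have rm: "ract L q b \<in> car L" unfolding rq using q by (simp add: L_car)
    have "transport E \<xi> r (ract L q b) = ract (fib E r) (transport E \<xi> r q) b"
      unfolding rq using transport_ract[of "fst q" r "snd q" b] q r by (simp add: L_car)
    then show ?thesis using L_ip[OF p rm, of r] L_ip[OF p q, of r] p q r by (simp add: rq)
  qed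
  assume u: "u \<in> car L"
  define w where "w = max r (fst u)"
  have w: "w \<ge> 0" "fst p \<le> w" "fst q \<le> w" "fst u \<le> w" using r by (auto simp: w_def)
  interpret W: hilbert_module "fib E w" by (rule fib_hilbert[OF w(1)])
  have fsth: "fst (hadd L q u) = max (fst q) (fst u)" by (simp add: alg_indlim_def Let_def)
  have qu: "hadd L q u \<in> car L"
  proof -
    let ?m = "max (fst q) (fst u)"
    have m: "?m \<ge> 0" using q by (auto simp: L_car)
    interpret Fm: hilbert_module "fib E ?m" by (rule fib_hilbert[OF m])
    have "hadd L q u = (?m, hadd (fib E ?m) (transport E \<xi> ?m q) (transport E \<xi> ?m u))"
      by (simp add: alg_indlim_def Let_def)
    then show ?thesis using m q u by (simp add: L_car)
  qed
  show "ip L p (hadd L q u) = ip L p q + ip L p u"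
    using p q u w qu by (simp add: L_ip[of _ _ w] fsth transport_L_hadd)
qed

sublocale L: prehilbert L by (rule prehilbert_L)

lemma hilbert_H: "hilbert_module H"
  unfolding indlim_def by (rule L.hilbert_completion)

sublocale H: hilbert_module H by (rule hilbert_H)

lemma j_mem [simp]: "t \<ge> 0 \<Longrightarrow> x \<in> car (fib E t) \<Longrightarrow> j t x \<in> car H"
  unfolding ilim_embed_def indlim_def by (rule L.embed_mem) (simp add: L_car)

lemma j_ip: "t \<ge> 0 \<Longrightarrow> x \<in> car (fib E t) \<Longrightarrow> y \<in> car (fib E t) \<Longrightarrow> ip H (j t x) (j t y) = ip (fib E t) x y"
  unfolding ilim_embed_def indlim_def
  using L_ip[of "(t, x)" "(t, y)" t] transport_self[of "(t, x)"] transport_self[of "(t, y)"]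
  by (subst L.embed_ip) (simp_all add: L_car)

text \<open>A pair and its transport have equal inner products with all pairs, hence the same class
  in the completion.\<close>

lemma j_transport:
  assumes "p \<in> car L" "fst p \<le> r"
  shows "j r (transport E \<xi> r p) = j (fst p) (snd p)"
  unfolding ilim_embed_def embed_def prod.collapse
proof (rule L.cclass_eq_of_same[OF L.hCauchy_const L.hCauchy_const])
  have r: "r \<ge> 0" using assms by (auto simp: L_car)
  show m: "(r, transport E \<xi> r p) \<in> car L" using assms r by (simp add: L_car)
  show "L.same (r, transport E \<xi> r p) p"
    unfolding L.same_def
  proof
    fix z assume z: "z \<in> car L"
    define w where "w = max r (fst z)"
    show "ip L z (r, transport E \<xi> r p) = ip L z p"
      using L_ip[OF z m, of w] L_ip[OF z assms(1), of w] assms transport_transport[OF assms, of w] by (simp add: w_def)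
  qed
qed (use assms in auto)

lemma j_shift:
  assumes "s \<ge> 0" "t \<ge> 0" "x \<in> car (fib E t)"
  shows "j (s + t) (pmul E s t (\<xi> s) x) = j t x"
  using j_transport[of "(t, x)" "s + t"] assms by (simp add: L_car transport_eq)

lemma j_isometric: "t \<ge> 0 \<Longrightarrow> isometric_embedding (fib E t) H (j t)"
proof -
  assume t: "t \<ge> 0"
  interpret F: hilbert_module "fib E t" by (rule fib_hilbert[OF t])
  have "j t (hadd (fib E t) x y) = hadd H (j t x) (j t y)" if "x \<in> car (fib E t)" "y \<in> car (fib E t)" for x y
  proof -
    have "hadd L (t, x) (t, y) = (t, hadd (fib E t) x y)"
      using that t transport_self[of "(t, x)"] transport_self[of "(t, y)"] by (simp add: alg_indlim_def Let_def)
    then show ?thesis using L.embed_hadd[of "(t, x)" "(t, y)"] that t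
      by (simp add: ilim_embed_def indlim_def L_car)
  qed
  moreover have "j t (ract (fib E t) x b) = ract H (j t x) b" if "x \<in> car (fib E t)" for x b
  proof -
    have "ract L (t, x) b = (t, ract (fib E t) x b)" by (simp add: alg_indlim_def)
    then show ?thesis using L.embed_ract[of "(t, x)" b] that t
      by (simp add: ilim_embed_def indlim_def L_car)
  qed
  ultimately show ?thesis using t by (auto simp: isometric_embedding_def j_ip)
qed

text \<open>Transport allows the index of the approximating element to be as large as
  desired.\<close>

lemma j_dense:
  assumes "h \<in> car H" "e > 0" "T \<ge> 0"
  shows "\<exists>r\<ge>T. \<exists>x\<in>car (fib E r). hdist H h (j r x) < e"
proof -
  obtain p where p: "p \<in> car L" "hdist H h (j (fst p) (snd p)) < e"
    using L.embed_approx[of h e] assms by (auto simp: indlim_def ilim_embed_def)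
  define r where "r = max T (fst p)"
  have "hdist H h (j r (transport E \<xi> r p)) < e" using p j_transport[OF p(1), of r] by (simp add: r_def)
  then show ?thesis using p by (intro exI[of _ r] conjI bexI[of _ "transport E \<xi> r p"]) (auto simp: r_def)
qed

lemma j_pmul_shift:
  assumes "0 \<le> s" "s \<le> r" "t \<ge> 0" "x \<in> car (fib E s)" "y \<in> car (fib E t)"
  shows "j (r + t) (pmul E r t (transport E \<xi> r (s, x)) y) = j (s + t) (pmul E s t x y)"
  using pmul_assoc[of "r - s" s t "\<xi> (r - s)" x y] j_shift[of "r - s" "s + t" "pmul E s t x y"] assms
  by (simp add: transport_eq add.assoc[symmetric])

end


section \<open>The action of the product system on the inductive limit\<close>

lemma clin_span_mono: "A \<subseteq> B \<Longrightarrow> clin_span M A \<subseteq> clin_span M B"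
proof
  fix x assume "A \<subseteq> B" "x \<in> clin_span M A"
  from this(2,1) show "x \<in> clin_span M B" by induction (auto intro: clin_span.intros)
qed

context unital_unit
begin

lemma tensor_factors_H: "t \<ge> 0 \<Longrightarrow> tensor_factors H (fib E t)"
  by (simp add: tensor_factors_def H.prehilbert_axioms fib_corr)

text \<open>The families j_s(x) \<odot> y and j_(s+t)(x y) have equal Gram matrices, as seen after
  transporting the left factors to a common index. The second is total: vectors j_r(z) with r \<ge>
  t are dense, and z is approximated by combinations of products from E_(r-t) and E_t.\<close>

lemma ilim_unitary_ex:
  assumes t: "t \<ge> 0"
  shows "\<exists>v. unitary (interior_tensor H (fib E t)) H v \<and>
    (\<forall>s\<ge>0. \<forall>x\<in>car (fib E s). \<forall>y\<in>car (fib E t).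
       v (tensor H (fib E t) (j s x) y) = j (s + t) (pmul E s t x y))"
proof -
  interpret F: correspondence "fib E t" by (rule fib_corr[OF t])
  interpret T: tensor_factors H "fib E t" by (rule tensor_factors_H[OF t])
  define J where "J = {(s, x, y). s \<ge> 0 \<and> x \<in> car (fib E s) \<and> y \<in> car (fib E t)}"
  define u where "u = (\<lambda>(s, x, y). tensor H (fib E t) (j s x) y)"
  define v where "v = (\<lambda>(s, x, y). j (s + t) (pmul E s t x y))"
  have um: "u i \<in> car (interior_tensor H (fib E t))" and vm: "v i \<in> car H" if "i \<in> J" for i
    using that t by (auto simp: J_def u_def v_def)
  have "ip H (v p) (v q) = ip (interior_tensor H (fib E t)) (u p) (u q)" if pq: "p \<in> J" "q \<in> J" for p q
  proof -
    obtain s x y where p: "p = (s, x, y)" "s \<ge> 0" "x \<in> car (fib E s)" "y \<in> car (fib E t)" using pq(1) by (auto simp: J_def)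
    obtain s' x' y' where q: "q = (s', x', y')" "s' \<ge> 0" "x' \<in> car (fib E s')" "y' \<in> car (fib E t)" using pq(2) by (auto simp: J_def)
    define r where "r = max s s'"
    have r: "r \<ge> 0" "s \<le> r" "s' \<le> r" using p by (auto simp: r_def)
    define X where "X = transport E \<xi> r (s, x)"
    define X' where "X' = transport E \<xi> r (s', x')"
    have X: "X \<in> car (fib E r)" "X' \<in> car (fib E r)" using p q r by (auto simp: X_def X'_def L_car)
    have jX: "j s x = j r X" "j s' x' = j r X'"
      using j_transport[of "(s, x)" r] j_transport[of "(s', x')" r] p q r by (auto simp: X_def X'_def L_car)
    have "v p = j (r + t) (pmul E r t X y)" "v q = j (r + t) (pmul E r t X' y')"
      using j_pmul_shift[OF p(2) r(2) t p(3,4)] j_pmul_shift[OF q(2) r(3) t q(3,4)]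
      by (simp_all add: p(1) q(1) v_def X_def X'_def)
    then have "ip H (v p) (v q) = ip (fib E t) y (lact (fib E t) (ip (fib E r) X X') y')"
      using X p q r t by (simp add: j_ip pmul_ip)
    also have "\<dots> = ip (interior_tensor H (fib E t)) (u p) (u q)"
      using X p q r t by (simp add: u_def jX T.tensor_ip j_ip)
    finally show ?thesis .
  qed
  moreover have "closed_span (interior_tensor H (fib E t)) (u ` J) = car (interior_tensor H (fib E t))"
  proof (rule T.T.total_of_approx[OF _ T.tensor_total])
    fix P and e :: real assume "P \<in> {tensor H (fib E t) x y |x y. x \<in> car H \<and> y \<in> car (fib E t)}" and e: "e > 0"
    then obtain h y where P: "P = tensor H (fib E t) h y" "h \<in> car H" "y \<in> car (fib E t)" by blast
    \<comment> \<open>Elementary tensors trivially have their own inner products; this supplies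
      their Lipschitz continuity in the left factor.\<close>
    interpret M: tensor_map H "fib E t" "interior_tensor H (fib E t)" "tensor H (fib E t)"
      by unfold_locales (simp_all add: T.tensor_ip)
    define n where "n = hnorm (fib E t) y + 1"
    have n: "n > 0" using F.hnorm_nonneg[of y] by (simp add: n_def del: F.hnorm_nonneg)
    then obtain r x where rx: "r \<ge> 0" "x \<in> car (fib E r)" "hdist H h (j r x) < e / n"
      using j_dense[OF P(2), of "e / n" 0] e by auto
    have "hdist (interior_tensor H (fib E t)) P (tensor H (fib E t) (j r x) y) \<le> hdist H h (j r x) * hnorm (fib E t) y"
      unfolding P(1) using P rx by (intro M.m_hdist_left) auto
    also have "\<dots> \<le> hdist H h (j r x) * n" by (intro mult_left_mono) (auto simp: n_def)
    also have "\<dots> < e" using rx(3) n by (simp add: less_divide_eq)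
    finally have "hdist (interior_tensor H (fib E t)) P (tensor H (fib E t) (j r x) y) < e" .
    moreover have "tensor H (fib E t) (j r x) y \<in> u ` J"
      using rx P(3) by (auto simp: J_def u_def image_iff intro!: bexI[of _ "(r, x, y)"])
    ultimately show "\<exists>Q\<in>clin_span (interior_tensor H (fib E t)) (u ` J). hdist (interior_tensor H (fib E t)) P Q < e"
      by (intro bexI[of _ "tensor H (fib E t) (j r x) y"] clin_span.base)
  qed (use um in auto)
  moreover have "closed_span H (v ` J) = car H"
  proof (rule H.total_of_approx[where A = "{j r z | r z. r \<ge> t \<and> z \<in> car (fib E r)}"])
    show "closed_span H {j r z | r z. r \<ge> t \<and> z \<in> car (fib E r)} = car H"
    proof (rule H.closed_spanI_dense)
      fix h and e :: real assume "h \<in> car H" "e > 0"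
      then obtain r x where "r \<ge> t" "x \<in> car (fib E r)" "hdist H h (j r x) < e" using j_dense[of h e t] t by blast
      then show "\<exists>y\<in>clin_span H {j r z | r z. r \<ge> t \<and> z \<in> car (fib E r)}. hdist H h y < e"
        by (intro bexI[of _ "j r x"] clin_span.base) auto
    qed
    fix h and e :: real assume "h \<in> {j r z | r z. r \<ge> t \<and> z \<in> car (fib E r)}" and e: "e > 0"
    then obtain r z where h: "h = j r z" "r \<ge> t" "z \<in> car (fib E r)" by blast
    define s where "s = r - t"
    have s: "s \<ge> 0" "s + t = r" using h by (auto simp: s_def)
    let ?A = "{pmul E s t x y | x y. x \<in> car (fib E s) \<and> y \<in> car (fib E t)}"
    have "\<exists>y\<in>clin_span H (j r ` ?A). hdist H (j r z) y < e"
    proof (rule isometric_embedding_approx_clin_span[OF fib_prehilbert H.hilbert_module_axioms j_isometric])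
      show "closed_span (fib E r) ?A = car (fib E r)" using pmul_total[OF s(1) t] s(2) by simp
    qed (use s t h e in auto)
    moreover have "j r ` ?A \<subseteq> v ` J"
      using s by (force simp: J_def v_def image_iff)
    then have "clin_span H (j r ` ?A) \<subseteq> clin_span H (v ` J)" by (rule clin_span_mono)
    ultimately show "\<exists>y\<in>clin_span H (v ` J). hdist H h y < e" unfolding h(1) by blast
  qed (use vm t in auto)
  ultimately obtain f where f: "unitary (interior_tensor H (fib E t)) H f" "\<forall>i\<in>J. f (u i) = v i"
    using unitary_of_total_families[OF T.T.hilbert_module_axioms H.hilbert_module_axioms, of J u v] um vm by blast
  have "f (tensor H (fib E t) (j s x) y) = j (s + t) (pmul E s t x y)"
    if "s \<ge> 0" "x \<in> car (fib E s)" "y \<in> car (fib E t)" for s x y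
    using f(2)[rule_format, of "(s, x, y)"] that by (simp add: J_def u_def v_def)
  with f(1) show ?thesis by blast
qed

lemma ilim_unitary_unitary: "t \<ge> 0 \<Longrightarrow> unitary (interior_tensor H (fib E t)) H (ilim_unitary E \<xi> t)"
  using someI_ex[OF ilim_unitary_ex] unfolding ilim_unitary_def by blast

text \<open>The product h y of a vector of the inductive limit with an element of the fibre at
  t.\<close>

definition act :: "real \<Rightarrow> 'e ilim \<Rightarrow> 'e \<Rightarrow> 'e ilim" where
  "act t h y = ilim_unitary E \<xi> t (tensor H (fib E t) h y)"

lemma act_j:
  "\<lbrakk>s \<ge> 0; t \<ge> 0; x \<in> car (fib E s); y \<in> car (fib E t)\<rbrakk> \<Longrightarrow> act t (j s x) y = j (s + t) (pmul E s t x y)"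
  using someI_ex[OF ilim_unitary_ex] unfolding act_def ilim_unitary_def by blast

lemma tensor_map_act:
  assumes "t \<ge> 0"
  shows "tensor_map H (fib E t) H (act t)"
proof -
  interpret T: tensor_factors H "fib E t" by (rule tensor_factors_H[OF assms])
  note u = ilim_unitary_unitary[OF assms, unfolded unitary_def, THEN conjunct1]
  show ?thesis
    by (intro tensor_map.intro tensor_map_axioms.intro H.prehilbert_axioms fib_corr H.hilbert_module_axioms)
      (simp_all add: assms act_def isometric_embeddingD[OF u] T.tensor_ip)
qed

lemmas act_mem [simp] = tensor_map.m_mem[OF tensor_map_act]
lemmas act_hdist_left = tensor_map.m_hdist_left[OF tensor_map_act]
lemmas act_hdist_right = tensor_map.m_hdist_right[OF tensor_map_act]
lemmas act_add_right = tensor_map.m_add_right[OF tensor_map_act]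
lemmas act_ract_right = tensor_map.m_ract_right[OF tensor_map_act]
lemmas act_ract_left = tensor_map.m_ract_left[OF tensor_map_act]

lemma act_total:
  assumes "t \<ge> 0"
  shows "closed_span H {act t h y | h y. h \<in> car H \<and> y \<in> car (fib E t)} = car H"
proof -
  interpret T: tensor_factors H "fib E t" by (rule tensor_factors_H[OF assms])
  have "closed_span H (ilim_unitary E \<xi> t ` {tensor H (fib E t) x y | x y. x \<in> car H \<and> y \<in> car (fib E t)}) = car H"
    by (rule unitary_total[OF T.T.prehilbert_axioms H.hilbert_module_axioms ilim_unitary_unitary _ T.tensor_total]) (use assms in auto)
  also have "ilim_unitary E \<xi> t ` {tensor H (fib E t) x y | x y. x \<in> car H \<and> y \<in> car (fib E t)}
      = {act t h y | h y. h \<in> car H \<and> y \<in> car (fib E t)}"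
    by (auto simp: act_def)
  finally show ?thesis .
qed

lemma j_seq:
  assumes "h \<in> car H"
  obtains r x where "\<And>n::nat. r n \<ge> 0" "\<And>n. x n \<in> car (fib E (r n))" "(\<lambda>n. hdist H (j (r n) (x n)) h) \<longlonglongrightarrow> 0"
proof -
  have "\<exists>r x. r \<ge> 0 \<and> x \<in> car (fib E r) \<and> hdist H h (j r x) < 1 / real (Suc n)" for n
    using j_dense[OF assms, of "1 / real (Suc n)" 0] by auto
  then obtain r x where rx: "\<And>n. r n \<ge> 0" "\<And>n. x n \<in> car (fib E (r n))" "\<And>n. hdist H h (j (r n) (x n)) < 1 / real (Suc n)"
    by metis
  have "(\<lambda>n. hdist H (j (r n) (x n)) h) \<longlonglongrightarrow> 0"
  proof (rule Lim_null_comparison[OF always_eventually LIMSEQ_Suc[OF lim_1_over_n]], rule allI)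
    fix n show "norm (hdist H (j (r n) (x n)) h) \<le> 1 / real (Suc n)"
      using rx(3)[of n] H.hdist_commute[OF assms j_mem[OF rx(1,2), of n]] by simp
  qed
  with rx that show thesis by blast
qed

text \<open>For h in the image of a fibre this is associativity of the product system; both sides
  are Lipschitz in h, and such h are dense.\<close>

lemma act_assoc:
  assumes "s \<ge> 0" "t \<ge> 0" "h \<in> car H" "y \<in> car (fib E s)" "z \<in> car (fib E t)"
  shows "act t (act s h y) z = act (s + t) h (pmul E s t y z)"
proof -
  obtain r x where rx: "\<And>n::nat. r n \<ge> 0" "\<And>n. x n \<in> car (fib E (r n))" "(\<lambda>n. hdist H (j (r n) (x n)) h) \<longlonglongrightarrow> 0"
    using j_seq[OF assms(3)] by blast
  have jm: "j (r n) (x n) \<in> car H" for n using rx by simp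
  have eq: "act t (act s (j (r n) (x n)) y) z = act (s + t) (j (r n) (x n)) (pmul E s t y z)" for n
    using rx(1,2)[of n] assms pmul_assoc[of "r n" s t "x n" y z] by (simp add: act_j add.assoc)
  show ?thesis
  proof (rule H.lim_unique[where X = "\<lambda>n. act t (act s (j (r n) (x n)) y) z"])
    show "(\<lambda>n. hdist H (act t (act s (j (r n) (x n)) y) z) (act t (act s h y) z)) \<longlonglongrightarrow> 0"
    proof (rule Lim_null_comparison[OF always_eventually], rule allI)
      fix n
      have "hdist H (act t (act s (j (r n) (x n)) y) z) (act t (act s h y) z)
          \<le> hdist H (act s (j (r n) (x n)) y) (act s h y) * hnorm (fib E t) z"
        using assms jm by (intro act_hdist_left) auto
      also have "\<dots> \<le> (hdist H (j (r n) (x n)) h * hnorm (fib E s) y) * hnorm (fib E t) z"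
        using assms jm by (intro mult_right_mono act_hdist_left) (auto simp: hnorm_def)
      finally show "norm (hdist H (act t (act s (j (r n) (x n)) y) z) (act t (act s h y) z))
          \<le> hdist H (j (r n) (x n)) h * (hnorm (fib E s) y * hnorm (fib E t) z)" by (simp add: mult.assoc)
      show "(\<lambda>n. hdist H (j (r n) (x n)) h * (hnorm (fib E s) y * hnorm (fib E t) z)) \<longlonglongrightarrow> 0"
        by (rule tendsto_mult_left_zero[OF rx(3)])
    qed
    show "(\<lambda>n. hdist H (act t (act s (j (r n) (x n)) y) z) (act (s + t) h (pmul E s t y z))) \<longlonglongrightarrow> 0"
      unfolding eq
    proof (rule Lim_null_comparison[OF always_eventually], rule allI)
      fix n
      show "norm (hdist H (act (s + t) (j (r n) (x n)) (pmul E s t y z)) (act (s + t) h (pmul E s t y z)))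
          \<le> hdist H (j (r n) (x n)) h * hnorm (fib E (s + t)) (pmul E s t y z)"
        using assms jm act_hdist_left[of "s + t" "j (r n) (x n)" h "pmul E s t y z"] by simp
      show "(\<lambda>n. hdist H (j (r n) (x n)) h * hnorm (fib E (s + t)) (pmul E s t y z)) \<longlonglongrightarrow> 0"
        by (rule tendsto_mult_left_zero[OF rx(3)])
    qed
  qed (use assms jm in auto)
qed

text \<open>The unit vector onto which all \<xi>_t are mapped; index 0 is a convenient
  choice.\<close>

definition \<xi>v :: "'e ilim" where "\<xi>v = j 0 (\<xi> 0)"

lemma \<xi>v_mem [simp]: "\<xi>v \<in> car H" by (simp add: \<xi>v_def)

lemma \<xi>v_ip [simp]: "ip H \<xi>v \<xi>v = 1" by (simp add: \<xi>v_def j_ip)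

lemma act_\<xi>v: "t \<ge> 0 \<Longrightarrow> y \<in> car (fib E t) \<Longrightarrow> act t \<xi>v y = j t y"
  by (simp add: \<xi>v_def act_j) (simp add: \<xi>_0 pmul_left)

section \<open>The semigroup\<close>

abbreviation "\<theta> \<equiv> vartheta E \<xi>"

lemma theta_unitary:
  assumes "t \<ge> 0" "P \<in> car (interior_tensor H (fib E t))"
  shows "\<theta> t a (ilim_unitary E \<xi> t P) = ilim_unitary E \<xi> t (tensor_id H (fib E t) a P)"
proof -
  interpret T: tensor_factors H "fib E t" by (rule tensor_factors_H[OF assms(1)])
  show ?thesis
    using hadjoint_unitary[OF T.T.hilbert_module_axioms ilim_unitary_unitary[OF assms(1)] assms(2)]
    by (simp add: vartheta_def)
qed

text \<open>Collects what later arguments need about \<theta>. Its bound does not depend on t,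
  because a \<odot> id has the bound of a on every tensor product and v_t is unitary.\<close>

lemma theta_props:
  assumes a: "adjointable H a"
  shows "\<exists>C\<ge>0. (\<forall>h\<in>car H. \<forall>k\<in>car H. hdist H (a h) (a k) \<le> C * hdist H h k) \<and>
    (\<forall>t\<ge>0. \<forall>h\<in>car H. \<forall>k\<in>car H. hdist H (\<theta> t a h) (\<theta> t a k) \<le> C * hdist H h k)"
    and "t \<ge> 0 \<Longrightarrow> h \<in> car H \<Longrightarrow> y \<in> car (fib E t) \<Longrightarrow> \<theta> t a (act t h y) = act t (a h) y"
    and "t \<ge> 0 \<Longrightarrow> h \<in> car H \<Longrightarrow> \<theta> t a h \<in> car H"
    and "t \<ge> 0 \<Longrightarrow> h \<in> car H \<Longrightarrow> k \<in> car H \<Longrightarrow> \<theta> t a (hadd H h k) = hadd H (\<theta> t a h) (\<theta> t a k)"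
    and "t \<ge> 0 \<Longrightarrow> h \<in> car H \<Longrightarrow> \<theta> t a (ract H h b) = ract H (\<theta> t a h) b"
    and "h \<in> car H \<Longrightarrow> a h \<in> car H"
proof -
  obtain g where ag: "is_adjoint H H a g" using a by (auto simp: adjointable_def)
  obtain C where C: "C \<ge> 0" "\<And>x. x \<in> car H \<Longrightarrow> hnorm H (a x) \<le> C * hnorm H x"
    using adjoint_bounded[OF H.prehilbert_axioms H.hilbert_module_axioms ag] by blast
  have op: "tensor_operator H (fib E t) a g C" if "t \<ge> 0" for t
    by (simp add: tensor_operator_def tensor_operator_axioms_def H.hilbert_module_axioms tensor_factors_H[OF that] ag C)
  show am: "a h \<in> car H" if "h \<in> car H" for h using adjoint_mem(1)[OF ag that] .
  \<comment> \<open>Adjointable operators are additive, so a norm bound is a Lipschitz bound with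
    the same constant. It is stated for any module, as it is applied to the tensor products and to
    the inductive limit.\<close>
  have lip: "hdist N (T h) (T k) \<le> C * hdist N h k"
    if T: "hilbert_module N" "is_adjoint N N T T'" "\<And>x. x \<in> car N \<Longrightarrow> hnorm N (T x) \<le> C * hnorm N x" "h \<in> car N" "k \<in> car N"
    for N :: "('b, 'z) hmod" and T T' h k
  proof -
    interpret N: hilbert_module N by fact
    have "hadd N (T h) (ract N (T k) (- 1)) = T (hadd N h (ract N k (- 1)))"
      using that(4,5) by (simp add: adjoint_add[OF N.prehilbert_axioms N.hilbert_module_axioms T(2)]
        adjoint_ract[OF N.prehilbert_axioms N.hilbert_module_axioms T(2)])
    then show ?thesis using T(3)[of "hadd N h (ract N k (- 1))"] that(4,5) by (simp add: hdist_def)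
  qed
  have pre: "\<exists>P\<in>car (interior_tensor H (fib E t)). h = ilim_unitary E \<xi> t P" if "t \<ge> 0" "h \<in> car H" for t h
    using ilim_unitary_unitary[OF that(1)] that(2) by (auto simp: unitary_def)
  have iso: "isometric_embedding (interior_tensor H (fib E t)) H (ilim_unitary E \<xi> t)" if "t \<ge> 0" for t
    using ilim_unitary_unitary[OF that] by (simp add: unitary_def)
  show mem: "\<theta> t a h \<in> car H" if "t \<ge> 0" "h \<in> car H" for t h
  proof -
    interpret O: tensor_operator H "fib E t" a g C by (rule op[OF that(1)])
    show ?thesis using pre[OF that] by (auto simp: theta_unitary[OF that(1)] O.tensor_id_mem isometric_embeddingD(1)[OF iso[OF that(1)]])
  qed
  show "\<theta> t a (act t h y) = act t (a h) y" if "t \<ge> 0" "h \<in> car H" "y \<in> car (fib E t)"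
  proof -
    interpret O: tensor_operator H "fib E t" a g C by (rule op[OF that(1)])
    show ?thesis using that by (simp add: act_def theta_unitary O.tensor_id_tensor)
  qed
  show "\<theta> t a (hadd H h k) = hadd H (\<theta> t a h) (\<theta> t a k)" if tt: "t \<ge> 0" "h \<in> car H" "k \<in> car H" for h k
  proof -
    interpret O: tensor_operator H "fib E t" a g C by (rule op[OF that(1)])
    obtain P Q where P: "P \<in> car (interior_tensor H (fib E t))" "h = ilim_unitary E \<xi> t P"
      and Q: "Q \<in> car (interior_tensor H (fib E t))" "k = ilim_unitary E \<xi> t Q" using pre[OF tt(1,2)] pre[OF tt(1,3)] by blast
    have "\<theta> t a (hadd H h k) = ilim_unitary E \<xi> t (tensor_id H (fib E t) a (hadd (interior_tensor H (fib E t)) P Q))"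
      using P Q tt by (simp add: isometric_embeddingD(2)[OF iso[OF tt(1)], symmetric] theta_unitary)
    then show ?thesis
      using P Q tt by (simp add: adjoint_add[OF O.T.prehilbert_axioms O.T.hilbert_module_axioms O.tensor_id_adjoint]
        isometric_embeddingD(2)[OF iso[OF tt(1)]] O.tensor_id_mem theta_unitary)
  qed
  show "\<theta> t a (ract H h b) = ract H (\<theta> t a h) b" if tt: "t \<ge> 0" "h \<in> car H" for h
  proof -
    interpret O: tensor_operator H "fib E t" a g C by (rule op[OF that(1)])
    obtain P where P: "P \<in> car (interior_tensor H (fib E t))" "h = ilim_unitary E \<xi> t P" using pre[OF tt] by blast
    have "\<theta> t a (ract H h b) = ilim_unitary E \<xi> t (tensor_id H (fib E t) a (ract (interior_tensor H (fib E t)) P b))"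
      using P tt by (simp add: isometric_embeddingD(3)[OF iso[OF tt(1)], symmetric] theta_unitary)
    then show ?thesis
      using P tt by (simp add: adjoint_ract[OF O.T.prehilbert_axioms O.T.hilbert_module_axioms O.tensor_id_adjoint]
        isometric_embeddingD(3)[OF iso[OF tt(1)]] O.tensor_id_mem theta_unitary)
  qed
  have "hdist H (\<theta> t a h) (\<theta> t a k) \<le> C * hdist H h k" if tt: "t \<ge> 0" "h \<in> car H" "k \<in> car H" for t h k
  proof -
    interpret O: tensor_operator H "fib E t" a g C by (rule op[OF that(1)])
    obtain P Q where P: "P \<in> car (interior_tensor H (fib E t))" "h = ilim_unitary E \<xi> t P"
      and Q: "Q \<in> car (interior_tensor H (fib E t))" "k = ilim_unitary E \<xi> t Q" using pre[OF tt(1,2)] pre[OF tt(1,3)] by blast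
    show ?thesis
      using lip[OF O.T.hilbert_module_axioms O.tensor_id_adjoint O.tensor_id_hnorm P(1) Q(1)] P Q tt
      by (simp add: theta_unitary O.tensor_id_mem isometric_embedding_hdist[OF O.T.prehilbert_axioms iso[OF tt(1)]])
  qed
  moreover have "hdist H (a h) (a k) \<le> C * hdist H h k" if "h \<in> car H" "k \<in> car H" for h k
    by (rule lip[OF H.hilbert_module_axioms ag C(2) that])
  ultimately show "\<exists>C\<ge>0. (\<forall>h\<in>car H. \<forall>k\<in>car H. hdist H (a h) (a k) \<le> C * hdist H h k) \<and>
    (\<forall>t\<ge>0. \<forall>h\<in>car H. \<forall>k\<in>car H. hdist H (\<theta> t a h) (\<theta> t a k) \<le> C * hdist H h k)"
    using C(1) by blast
qed

end


section \<open>Strong continuity\<close>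

lemma hdist_ge_0 [simp]: "hdist M x y \<ge> 0" and hnorm_ge_0 [simp]: "hnorm M x \<ge> 0"
  by (simp_all add: hdist_def hnorm_def)

lemma tendsto_null_approx:
  fixes f :: "'a \<Rightarrow> real"
  assumes "\<And>e. e > 0 \<Longrightarrow> \<exists>g. (g \<longlongrightarrow> 0) F \<and> (\<forall>\<^sub>F r in F. \<bar>f r\<bar> \<le> g r + e)"
  shows "(f \<longlongrightarrow> 0) F"
proof (rule tendstoI)
  fix e :: real assume e: "e > 0"
  obtain g where g: "(g \<longlongrightarrow> 0) F" "\<forall>\<^sub>F r in F. \<bar>f r\<bar> \<le> g r + e / 2" using assms[of "e / 2"] e by auto
  have "\<forall>\<^sub>F r in F. g r < e / 2" using order_tendstoD(2)[OF g(1), of "e / 2"] e by simp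
  with g(2) show "\<forall>\<^sub>F r in F. dist (f r) 0 < e" by eventually_elim simp
qed

lemma tendsto_null_power2:
  fixes f :: "'a \<Rightarrow> real"
  assumes "((\<lambda>r. (f r)\<^sup>2) \<longlongrightarrow> 0) F"
  shows "(f \<longlongrightarrow> 0) F"
  using tendsto_real_sqrt[OF assms] by (simp add: tendsto_rabs_zero_iff)

lemma (in hilbert_module) ract_0: "x \<in> car M \<Longrightarrow> ract M x 0 = hzero M"
  by (rule ip_definite) auto

lemma (in prehilbert) hdist_le_hnorms: "x \<in> car M \<Longrightarrow> y \<in> car M \<Longrightarrow> hdist M x y \<le> hnorm M x + hnorm M y"
  using hdist_triangle[of x "hzero M" y] hdist_commute[of "hzero M" y] by (simp add: hdist_zero_right)

locale generating_units = unital_unit E \<xi> for E :: "('b::unital_cstar_algebra, 'e) psys" and \<xi> +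
  fixes S :: "(real \<Rightarrow> 'e) set"
  assumes S_units: "\<zeta> \<in> S \<Longrightarrow> ps_unit E \<zeta>"
    and S_gen: "generates E S"
    and \<xi>_S: "\<xi> \<in> S"
    and S_cont: "\<zeta> \<in> S \<Longrightarrow> \<zeta>' \<in> S \<Longrightarrow>
      continuous_on {0..} (\<lambda>t. ip (fib E t) (\<zeta> t) (lact (fib E t) b (\<zeta>' t)))"
begin

section \<open>Units near time 0\<close>

lemma S_mem [simp]: "\<zeta> \<in> S \<Longrightarrow> t \<ge> 0 \<Longrightarrow> \<zeta> t \<in> car (fib E t)"
  and S_mult: "\<zeta> \<in> S \<Longrightarrow> s \<ge> 0 \<Longrightarrow> t \<ge> 0 \<Longrightarrow> pmul E s t (\<zeta> s) (\<zeta> t) = \<zeta> (s + t)"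
  and S_0: "\<zeta> \<in> S \<Longrightarrow> \<zeta> 0 = iota E 1"
  using S_units by (auto simp: ps_unit_def)

lemma ev_pos: "\<forall>\<^sub>F r in at_right (0::real). r > 0"
  by (rule eventually_at_right_less)

text \<open>Continuity at 0, where both units equal \<open>iota E 1\<close> and the inner product is
  b.\<close>

lemma lim_ip_lact:
  assumes "\<zeta> \<in> S" "\<zeta>' \<in> S"
  shows "((\<lambda>r. ip (fib E r) (\<zeta> r) (lact (fib E r) b (\<zeta>' r))) \<longlongrightarrow> b) (at_right 0)"
proof -
  let ?f = "\<lambda>r. ip (fib E r) (\<zeta> r) (lact (fib E r) b (\<zeta>' r))"
  have "(?f \<longlongrightarrow> ?f 0) (at 0 within {0..})"
    using S_cont[OF assms] by (auto simp: continuous_on_def)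
  then have "(?f \<longlongrightarrow> ?f 0) (at_right 0)" by (rule tendsto_within_subset) auto
  moreover have "?f 0 = b" by (simp add: S_0[OF assms(1)] S_0[OF assms(2)] iota_lact[symmetric] iota_ip)
  ultimately show ?thesis by simp
qed

lemma lim_ip:
  assumes "\<zeta> \<in> S" "\<zeta>' \<in> S"
  shows "((\<lambda>r. ip (fib E r) (\<zeta> r) (\<zeta>' r)) \<longlongrightarrow> 1) (at_right 0)"
  by (rule Lim_transform_eventually[OF lim_ip_lact[OF assms, of 1]])
    (use ev_pos in eventually_elim, use assms in simp)

text \<open>In the expansion of |\<zeta>_r - \<xi>_r|^2 all four inner products tend to 1 and their
  signs cancel.\<close>

lemma unit_near:
  assumes "\<zeta> \<in> S"
  shows "((\<lambda>r. hdist (fib E r) (\<zeta> r) (\<xi> r)) \<longlongrightarrow> 0) (at_right 0)"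
proof (rule tendsto_null_power2)
  have "((\<lambda>r. norm (ip (fib E r) (\<zeta> r) (\<zeta> r) - ip (fib E r) (\<zeta> r) (\<xi> r) - ip (fib E r) (\<xi> r) (\<zeta> r) + ip (fib E r) (\<xi> r) (\<xi> r)))
      \<longlongrightarrow> norm (1 - 1 - 1 + 1 :: 'b)) (at_right 0)"
    by (intro tendsto_intros lim_ip assms \<xi>_S)
  then have l: "((\<lambda>r. norm (ip (fib E r) (\<zeta> r) (\<zeta> r) - ip (fib E r) (\<zeta> r) (\<xi> r) - ip (fib E r) (\<xi> r) (\<zeta> r) + ip (fib E r) (\<xi> r) (\<xi> r)))
      \<longlongrightarrow> 0) (at_right 0)" by (simp del: \<xi>_ip)
  show "((\<lambda>r. (hdist (fib E r) (\<zeta> r) (\<xi> r))\<^sup>2) \<longlongrightarrow> 0) (at_right 0)"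
    by (rule Lim_transform_eventually[OF l])
      (use ev_pos in eventually_elim, use assms in \<open>simp del: \<xi>_ip add: prehilbert.hdist_sq[OF fib_prehilbert]\<close>)
qed

text \<open>In the expansion of |b \<zeta>_r - \<zeta>_r b|^2 all four terms tend to b* b, by
  \<open>lim_ip_lact\<close> for b* b, b*, b and 1.\<close>

lemma unit_commutes:
  assumes "\<zeta> \<in> S"
  shows "((\<lambda>r. hdist (fib E r) (lact (fib E r) b (\<zeta> r)) (ract (fib E r) (\<zeta> r) b)) \<longlongrightarrow> 0) (at_right 0)"
proof (rule tendsto_null_power2)
  let ?i = "\<lambda>c r. ip (fib E r) (\<zeta> r) (lact (fib E r) c (\<zeta> r))"
  have "((\<lambda>r. norm (?i (star b * b) r - ?i (star b) r * b - star b * ?i b r + star b * (?i 1 r * b)))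
      \<longlongrightarrow> norm (star b * b - star b * b - star b * b + star b * (1 * b))) (at_right 0)"
    by (intro tendsto_intros lim_ip_lact assms)
  then have l: "((\<lambda>r. norm (?i (star b * b) r - ?i (star b) r * b - star b * ?i b r + star b * (?i 1 r * b))) \<longlongrightarrow> 0) (at_right 0)"
    by simp
  show "((\<lambda>r. (hdist (fib E r) (lact (fib E r) b (\<zeta> r)) (ract (fib E r) (\<zeta> r) b))\<^sup>2) \<longlongrightarrow> 0) (at_right 0)"
  proof (rule Lim_transform_eventually[OF l], use ev_pos in eventually_elim)
    fix r :: real assume r: "r > 0"
    interpret F: correspondence "fib E r" by (rule fib_corr) (use r in simp)
    show "norm (?i (star b * b) r - ?i (star b) r * b - star b * ?i b r + star b * (?i 1 r * b))
        = (hdist (fib E r) (lact (fib E r) b (\<zeta> r)) (ract (fib E r) (\<zeta> r) b))\<^sup>2"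
      using r assms by (subst F.hdist_sq) (simp_all add: F.ip_lact_left F.lact_mult F.lact_one mult.assoc)
  qed
qed

lemma unit_commutes':
  assumes "\<zeta> \<in> S"
  shows "((\<lambda>r. hdist (fib E r) (lact (fib E r) b (\<zeta> r)) (ract (fib E r) (\<xi> r) b)) \<longlongrightarrow> 0) (at_right 0)"
proof (rule Lim_null_comparison)
  show "((\<lambda>r. norm b * hdist (fib E r) (\<zeta> r) (\<xi> r) + hdist (fib E r) (lact (fib E r) b (\<xi> r)) (ract (fib E r) (\<xi> r) b)) \<longlongrightarrow> 0) (at_right 0)"
    using tendsto_add[OF tendsto_mult_right_zero[OF unit_near[OF assms], of "norm b"] unit_commutes[OF \<xi>_S, of b]] by simp
  show "\<forall>\<^sub>F r in at_right 0. norm (hdist (fib E r) (lact (fib E r) b (\<zeta> r)) (ract (fib E r) (\<xi> r) b))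
      \<le> norm b * hdist (fib E r) (\<zeta> r) (\<xi> r) + hdist (fib E r) (lact (fib E r) b (\<xi> r)) (ract (fib E r) (\<xi> r) b)" (is "\<forall>\<^sub>F r in _. ?P r")
    using ev_pos
  proof eventually_elim
    fix r :: real assume r: "r > 0"
    interpret F: correspondence "fib E r" by (rule fib_corr) (use r in simp)
    show "?P r"
      using F.hdist_triangle[of "lact (fib E r) b (\<zeta> r)" "lact (fib E r) b (\<xi> r)" "ract (fib E r) (\<xi> r) b"]
        F.hdist_lact[of "\<zeta> r" "\<xi> r" b] r assms by simp
  qed
qed

text \<open><\<zeta>_t, \<zeta>_t> is continuous, hence bounded on the compact interval.\<close>

lemma unit_bounded:
  assumes "\<zeta> \<in> S"
  shows "\<exists>B\<ge>0. \<forall>v\<in>{0..u}. hnorm (fib E v) (\<zeta> v) \<le> B"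
proof -
  have "continuous_on {0..u} (\<lambda>t. ip (fib E t) (\<zeta> t) (lact (fib E t) 1 (\<zeta> t)))"
    by (rule continuous_on_subset[OF S_cont[OF assms assms]]) auto
  then have "bounded ((\<lambda>t. ip (fib E t) (\<zeta> t) (lact (fib E t) 1 (\<zeta> t))) ` {0..u})"
    by (intro compact_imp_bounded compact_continuous_image) auto
  then obtain B where B: "\<forall>v\<in>{0..u}. norm (ip (fib E v) (\<zeta> v) (lact (fib E v) 1 (\<zeta> v))) \<le> B"
    by (auto simp: bounded_iff)
  have "hnorm (fib E v) (\<zeta> v) \<le> sqrt \<bar>B\<bar>" if "v \<in> {0..u}" for v
    using B[rule_format, OF that] assms that by (auto simp: hnorm_def)
  then show ?thesis by (intro exI[of _ "sqrt \<bar>B\<bar>"]) auto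
qed

section \<open>Elements that asymptotically commute with \<xi>\<close>

lemmas pmul_hdist_left = tensor_map.m_hdist_left[OF tensor_map_pmul]
lemmas pmul_hdist_right = tensor_map.m_hdist_right[OF tensor_map_pmul]
lemmas pmul_hnorm = tensor_map.m_hnorm[OF tensor_map_pmul]
lemmas pmul_add_left = tensor_map.m_add_left[OF tensor_map_pmul]
lemmas pmul_add_right = tensor_map.m_add_right[OF tensor_map_pmul]
lemmas pmul_ract_left = tensor_map.m_ract_left[OF tensor_map_pmul]
lemmas pmul_ract_right = tensor_map.m_ract_right[OF tensor_map_pmul]

text \<open>The elements that asymptotically commute with \<xi> are stable under products and closed linear
  combinations, so only b \<zeta>_s has to be treated; there \<zeta>_r and \<xi>_r become interchangeable, as do
  b \<xi>_r and \<xi>_r b, while \<zeta>_s \<zeta>_r = \<zeta>_r \<zeta>_s.\<close>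

definition asym :: "real \<Rightarrow> 'e \<Rightarrow> bool" where
  "asym t x \<longleftrightarrow> ((\<lambda>r. hdist (fib E (t + r)) (pmul E t r x (\<xi> r)) (pmul E r t (\<xi> r) x)) \<longlongrightarrow> 0) (at_right 0)"

lemma pmul_\<xi>_mem:
  assumes "t \<ge> 0" "r \<ge> 0" "x \<in> car (fib E t)"
  shows "pmul E t r x (\<xi> r) \<in> car (fib E (t + r))" "pmul E r t (\<xi> r) x \<in> car (fib E (t + r))"
  using assms by simp_all

lemma pmul_\<xi>_hdist:
  assumes "t \<ge> 0" "r \<ge> 0" "x \<in> car (fib E t)" "y \<in> car (fib E t)"
  shows "hdist (fib E (t + r)) (pmul E t r x (\<xi> r)) (pmul E t r y (\<xi> r)) \<le> hdist (fib E t) x y"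
    and "hdist (fib E (t + r)) (pmul E r t (\<xi> r) x) (pmul E r t (\<xi> r) y) \<le> hdist (fib E t) x y"
proof -
  have "hdist (fib E (t + r)) (pmul E t r x (\<xi> r)) (pmul E t r y (\<xi> r)) \<le> hdist (fib E t) x y * hnorm (fib E r) (\<xi> r)"
    using assms by (intro pmul_hdist_left) auto
  also have "\<dots> \<le> hdist (fib E t) x y * 1" using assms by (intro mult_left_mono \<xi>_hnorm) auto
  finally show "hdist (fib E (t + r)) (pmul E t r x (\<xi> r)) (pmul E t r y (\<xi> r)) \<le> hdist (fib E t) x y" by simp
  have "hdist (fib E (r + t)) (pmul E r t (\<xi> r) x) (pmul E r t (\<xi> r) y) \<le> hnorm (fib E r) (\<xi> r) * hdist (fib E t) x y"
    using assms by (intro pmul_hdist_right) auto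
  also have "\<dots> \<le> 1 * hdist (fib E t) x y" using assms by (intro mult_right_mono \<xi>_hnorm) auto
  finally show "hdist (fib E (t + r)) (pmul E r t (\<xi> r) x) (pmul E r t (\<xi> r) y) \<le> hdist (fib E t) x y"
    by (simp add: add.commute)
qed

text \<open>Multiplication by \<xi>_r from either side is contractive in x, uniformly in r, which
  makes the property closed.\<close>

lemma asym_approx:
  assumes t: "t \<ge> 0" and x: "x \<in> car (fib E t)"
    and appr: "\<And>e. e > 0 \<Longrightarrow> \<exists>y\<in>car (fib E t). asym t y \<and> hdist (fib E t) x y < e"
  shows "asym t x"
  unfolding asym_def
proof (rule tendsto_null_approx)
  fix e :: real assume "e > 0"
  then obtain y where y: "y \<in> car (fib E t)" "asym t y" "hdist (fib E t) x y < e / 2"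
    using appr[of "e / 2"] by auto
  have "\<forall>\<^sub>F r in at_right 0. \<bar>hdist (fib E (t + r)) (pmul E t r x (\<xi> r)) (pmul E r t (\<xi> r) x)\<bar>
      \<le> hdist (fib E (t + r)) (pmul E t r y (\<xi> r)) (pmul E r t (\<xi> r) y) + e"
    using ev_pos
  proof eventually_elim
    fix r :: real assume r: "r > 0"
    interpret W: hilbert_module "fib E (t + r)" by (rule fib_hilbert) (use t r in simp)
    note m = pmul_\<xi>_mem[OF t less_imp_le[OF r]]
    note d = pmul_\<xi>_hdist[OF t less_imp_le[OF r] x y(1)]
    show "\<bar>hdist (fib E (t + r)) (pmul E t r x (\<xi> r)) (pmul E r t (\<xi> r) x)\<bar>
      \<le> hdist (fib E (t + r)) (pmul E t r y (\<xi> r)) (pmul E r t (\<xi> r) y) + e"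
      using W.hdist_triangle[OF m(1)[OF x] m(1)[OF y(1)] m(2)[OF x]] W.hdist_triangle[OF m(1)[OF y(1)] m(2)[OF y(1)] m(2)[OF x]]
        W.hdist_commute[OF m(2)[OF x] m(2)[OF y(1)]] d y(3) by simp
  qed
  with y(2) show "\<exists>g. (g \<longlongrightarrow> 0) (at_right 0) \<and>
      (\<forall>\<^sub>F r in at_right 0. \<bar>hdist (fib E (t + r)) (pmul E t r x (\<xi> r)) (pmul E r t (\<xi> r) x)\<bar> \<le> g r + e)"
    unfolding asym_def by blast
qed

lemma asym_zero:
  assumes t: "t \<ge> 0"
  shows "asym t (hzero (fib E t))"
  unfolding asym_def
proof (rule Lim_null_comparison[OF _ tendsto_const])
  interpret T: hilbert_module "fib E t" by (rule fib_hilbert[OF t])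
  show "\<forall>\<^sub>F r in at_right 0. norm (hdist (fib E (t + r)) (pmul E t r (hzero (fib E t)) (\<xi> r)) (pmul E r t (\<xi> r) (hzero (fib E t)))) \<le> 0" (is "\<forall>\<^sub>F r in _. ?P r")
    using ev_pos
  proof eventually_elim
    fix r :: real assume r: "r > 0"
    interpret W: hilbert_module "fib E (t + r)" by (rule fib_hilbert) (use t r in simp)
    note m = pmul_\<xi>_mem[OF t less_imp_le[OF r] T.zero_mem]
    have "hnorm (fib E (t + r)) (pmul E t r (hzero (fib E t)) (\<xi> r)) \<le> 0"
      using pmul_hnorm[of t r "hzero (fib E t)" "\<xi> r"] t r by simp
    moreover have "hnorm (fib E (t + r)) (pmul E r t (\<xi> r) (hzero (fib E t))) \<le> 0"
      using pmul_hnorm[of r t "\<xi> r" "hzero (fib E t)"] t r by (simp add: add.commute)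
    ultimately show "?P r"
      using W.hdist_le_hnorms[OF m] by simp
  qed
qed

lemma asym_add:
  assumes t: "t \<ge> 0" and x: "x \<in> car (fib E t)" "y \<in> car (fib E t)" and a: "asym t x" "asym t y"
  shows "asym t (hadd (fib E t) x y)"
  unfolding asym_def
proof (rule Lim_null_comparison)
  show "((\<lambda>r. hdist (fib E (t + r)) (pmul E t r x (\<xi> r)) (pmul E r t (\<xi> r) x)
      + hdist (fib E (t + r)) (pmul E t r y (\<xi> r)) (pmul E r t (\<xi> r) y)) \<longlongrightarrow> 0) (at_right 0)"
    using tendsto_add[OF a[unfolded asym_def]] by simp
  show "\<forall>\<^sub>F r in at_right 0. norm (hdist (fib E (t + r)) (pmul E t r (hadd (fib E t) x y) (\<xi> r)) (pmul E r t (\<xi> r) (hadd (fib E t) x y)))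
      \<le> hdist (fib E (t + r)) (pmul E t r x (\<xi> r)) (pmul E r t (\<xi> r) x)
      + hdist (fib E (t + r)) (pmul E t r y (\<xi> r)) (pmul E r t (\<xi> r) y)" (is "\<forall>\<^sub>F r in _. ?P r")
    using ev_pos
  proof eventually_elim
    fix r :: real assume r: "r > 0"
    interpret W: hilbert_module "fib E (t + r)" by (rule fib_hilbert) (use t r in simp)
    note m = pmul_\<xi>_mem[OF t less_imp_le[OF r]]
    have "pmul E t r (hadd (fib E t) x y) (\<xi> r) = hadd (fib E (t + r)) (pmul E t r x (\<xi> r)) (pmul E t r y (\<xi> r))"
      using t r x by (intro pmul_add_left) auto
    moreover have "pmul E r t (\<xi> r) (hadd (fib E t) x y) = hadd (fib E (t + r)) (pmul E r t (\<xi> r) x) (pmul E r t (\<xi> r) y)"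
      using pmul_add_right[of r t "\<xi> r" x y] t r x by (simp add: add.commute)
    ultimately show "?P r"
      using W.hdist_add[OF m(1)[OF x(1)] m(1)[OF x(2)] m(2)[OF x(1)] m(2)[OF x(2)]] by simp
  qed
qed

lemma asym_scale:
  assumes t: "t \<ge> 0" and x: "x \<in> car (fib E t)" and a: "asym t x"
  shows "asym t (ract (fib E t) x (c *\<^sub>C 1))"
  unfolding asym_def
proof (rule Lim_null_comparison)
  show "((\<lambda>r. hdist (fib E (t + r)) (pmul E t r x (\<xi> r)) (pmul E r t (\<xi> r) x) * norm (c *\<^sub>C (1::'b))) \<longlongrightarrow> 0) (at_right 0)"
    using tendsto_mult_left_zero[OF a[unfolded asym_def]] by simp
  show "\<forall>\<^sub>F r in at_right 0. norm (hdist (fib E (t + r)) (pmul E t r (ract (fib E t) x (c *\<^sub>C 1)) (\<xi> r)) (pmul E r t (\<xi> r) (ract (fib E t) x (c *\<^sub>C 1))))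
      \<le> hdist (fib E (t + r)) (pmul E t r x (\<xi> r)) (pmul E r t (\<xi> r) x) * norm (c *\<^sub>C (1::'b))" (is "\<forall>\<^sub>F r in _. ?P r")
    using ev_pos
  proof eventually_elim
    fix r :: real assume r: "r > 0"
    interpret R: correspondence "fib E r" by (rule fib_corr) (use r in simp)
    interpret W: hilbert_module "fib E (t + r)" by (rule fib_hilbert) (use t r in simp)
    note m = pmul_\<xi>_mem[OF t less_imp_le[OF r]]
    have "pmul E t r (ract (fib E t) x (c *\<^sub>C 1)) (\<xi> r) = ract (fib E (t + r)) (pmul E t r x (\<xi> r)) (c *\<^sub>C 1)"
      using t r x by (simp add: pmul_ract_left pmul_ract_right R.lact_scaleC)
    moreover have "pmul E r t (\<xi> r) (ract (fib E t) x (c *\<^sub>C 1)) = ract (fib E (t + r)) (pmul E r t (\<xi> r) x) (c *\<^sub>C 1)"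
      using pmul_ract_right[of r t "\<xi> r" x "c *\<^sub>C 1"] t r x by (simp add: add.commute)
    ultimately show "?P r"
      using W.hdist_ract[OF m(1)[OF x] m(2)[OF x], of "c *\<^sub>C 1"] by simp
  qed
qed

text \<open>\<xi>_r moves past one factor at a time: u y \<xi>_r is close to u \<xi>_r y, which is
  close to \<xi>_r u y.\<close>

lemma asym_mult:
  assumes st: "s \<ge> 0" "t \<ge> 0" and u: "u \<in> car (fib E s)" and y: "y \<in> car (fib E t)"
    and a: "asym s u" "asym t y"
  shows "asym (s + t) (pmul E s t u y)"
  unfolding asym_def
proof (rule Lim_null_comparison)
  show "((\<lambda>r. hnorm (fib E s) u * hdist (fib E (t + r)) (pmul E t r y (\<xi> r)) (pmul E r t (\<xi> r) y)
      + hdist (fib E (s + r)) (pmul E s r u (\<xi> r)) (pmul E r s (\<xi> r) u) * hnorm (fib E t) y) \<longlongrightarrow> 0) (at_right 0)"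
    using tendsto_add[OF tendsto_mult_right_zero[OF a(2)[unfolded asym_def]] tendsto_mult_left_zero[OF a(1)[unfolded asym_def]]] by simp
  show "\<forall>\<^sub>F r in at_right 0. norm (hdist (fib E (s + t + r)) (pmul E (s + t) r (pmul E s t u y) (\<xi> r)) (pmul E r (s + t) (\<xi> r) (pmul E s t u y)))
      \<le> hnorm (fib E s) u * hdist (fib E (t + r)) (pmul E t r y (\<xi> r)) (pmul E r t (\<xi> r) y)
      + hdist (fib E (s + r)) (pmul E s r u (\<xi> r)) (pmul E r s (\<xi> r) u) * hnorm (fib E t) y" (is "\<forall>\<^sub>F r in _. ?P r")
    using ev_pos
  proof eventually_elim
    fix r :: real assume r0: "r > 0"
    then have r: "r \<ge> 0" by simp
    interpret W: hilbert_module "fib E (s + t + r)" by (rule fib_hilbert) (use st r in simp)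
    define A where "A = pmul E (s + t) r (pmul E s t u y) (\<xi> r)"
    define B where "B = pmul E s (t + r) u (pmul E r t (\<xi> r) y)"
    define C where "C = pmul E r (s + t) (\<xi> r) (pmul E s t u y)"
    have A: "A = pmul E s (t + r) u (pmul E t r y (\<xi> r))"
      unfolding A_def using st r u y by (intro pmul_assoc) auto
    have B: "B = pmul E (s + r) t (pmul E s r u (\<xi> r)) y"
      unfolding B_def using pmul_assoc[of s r t u "\<xi> r" y] st r u y by (simp add: add.commute)
    have C: "C = pmul E (s + r) t (pmul E r s (\<xi> r) u) y"
      unfolding C_def using pmul_assoc[of r s t "\<xi> r" u y] st r u y by (simp add: add.commute)
    have m: "A \<in> car (fib E (s + t + r))" "B \<in> car (fib E (s + t + r))" "C \<in> car (fib E (s + t + r))"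
      unfolding A_def B_def C_def using st r u y by (simp_all add: add_ac)
    have "hdist (fib E (s + (t + r))) A B \<le> hnorm (fib E s) u * hdist (fib E (t + r)) (pmul E t r y (\<xi> r)) (pmul E r t (\<xi> r) y)"
      unfolding A B_def using st r u y by (intro pmul_hdist_right) auto
    moreover have "hdist (fib E (s + r + t)) B C \<le> hdist (fib E (s + r)) (pmul E s r u (\<xi> r)) (pmul E r s (\<xi> r) u) * hnorm (fib E t) y"
      unfolding B C using st r u y by (intro pmul_hdist_left) auto
    ultimately show "?P r"
      unfolding A_def[symmetric] C_def[symmetric] using W.hdist_triangle[OF m(1) m(2) m(3)] by (simp add: add_ac)
  qed
qed

text \<open>The chain is b \<zeta>_s \<xi>_r ~ b \<zeta>_s \<zeta>_r = b \<zeta>_r \<zeta>_s ~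
  \<xi>_r b \<zeta>_s.\<close>

lemma asym_unit:
  assumes z: "\<zeta> \<in> S" and s: "s \<ge> 0"
  shows "asym s (lact (fib E s) b (\<zeta> s))"
  unfolding asym_def
proof (rule Lim_null_comparison)
  show "((\<lambda>r. hnorm (fib E s) (lact (fib E s) b (\<zeta> s)) * hdist (fib E r) (\<zeta> r) (\<xi> r)
      + hdist (fib E r) (lact (fib E r) b (\<zeta> r)) (ract (fib E r) (\<xi> r) b) * hnorm (fib E s) (\<zeta> s)) \<longlongrightarrow> 0) (at_right 0)"
    using tendsto_add[OF tendsto_mult_right_zero[OF unit_near[OF z]] tendsto_mult_left_zero[OF unit_commutes'[OF z]]] by simp
  show "\<forall>\<^sub>F r in at_right 0. norm (hdist (fib E (s + r)) (pmul E s r (lact (fib E s) b (\<zeta> s)) (\<xi> r)) (pmul E r s (\<xi> r) (lact (fib E s) b (\<zeta> s))))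
      \<le> hnorm (fib E s) (lact (fib E s) b (\<zeta> s)) * hdist (fib E r) (\<zeta> r) (\<xi> r)
      + hdist (fib E r) (lact (fib E r) b (\<zeta> r)) (ract (fib E r) (\<xi> r) b) * hnorm (fib E s) (\<zeta> s)" (is "\<forall>\<^sub>F r in _. ?P r")
    using ev_pos
  proof eventually_elim
    fix r :: real assume r0: "r > 0"
    then have r: "r \<ge> 0" by simp
    interpret R: hilbert_module "fib E r" by (rule fib_hilbert[OF r])
    interpret W: hilbert_module "fib E (s + r)" by (rule fib_hilbert) (use s r in simp)
    define A where "A = pmul E s r (lact (fib E s) b (\<zeta> s)) (\<xi> r)"
    define B where "B = pmul E s r (lact (fib E s) b (\<zeta> s)) (\<zeta> r)"
    define C where "C = pmul E r s (\<xi> r) (lact (fib E s) b (\<zeta> s))"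
    have B: "B = pmul E r s (lact (fib E r) b (\<zeta> r)) (\<zeta> s)"
      unfolding B_def using pmul_lact[of s r "\<zeta> s" "\<zeta> r" b] pmul_lact[of r s "\<zeta> r" "\<zeta> s" b]
        S_mult[OF z s r] S_mult[OF z r s] s r z by (simp add: add.commute)
    have C: "C = pmul E r s (ract (fib E r) (\<xi> r) b) (\<zeta> s)"
      unfolding C_def using s r z by (simp add: pmul_ract_left)
    have m: "A \<in> car (fib E (s + r))" "B \<in> car (fib E (s + r))" "C \<in> car (fib E (s + r))"
      unfolding A_def B_def C_def using s r z by simp_all
    have "hdist (fib E (s + r)) A B \<le> hnorm (fib E s) (lact (fib E s) b (\<zeta> s)) * hdist (fib E r) (\<xi> r) (\<zeta> r)"
      unfolding A_def B_def using s r z by (intro pmul_hdist_right) auto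
    moreover have "hdist (fib E (r + s)) B C \<le> hdist (fib E r) (lact (fib E r) b (\<zeta> r)) (ract (fib E r) (\<xi> r) b) * hnorm (fib E s) (\<zeta> s)"
      unfolding B C using s r z by (intro pmul_hdist_left) auto
    ultimately show "?P r"
      unfolding A_def[symmetric] C_def[symmetric]
      using W.hdist_triangle[OF m(1) m(2) m(3)] R.hdist_commute[of "\<xi> r" "\<zeta> r"] z r by (simp add: add.commute)
  qed
qed

lemma unit_word_mem: "unit_word E S t x \<Longrightarrow> t \<ge> 0 \<and> x \<in> car (fib E t)"
  by (induction rule: unit_word.induct) auto

lemma unit_word_asym: "unit_word E S t x \<Longrightarrow> asym t x"
proof (induction rule: unit_word.induct)
  case (Nil b)
  have "iota E b = lact (fib E 0) b (\<xi> 0)" using iota_lact[of b 1] by (simp add: \<xi>_0)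
  then show ?case using asym_unit[OF \<xi>_S, of 0 b] by simp
next
  case (Cons t x \<zeta> s b)
  note m = unit_word_mem[OF Cons.hyps(1)]
  have "lact (fib E (s + t)) b (pmul E s t (\<zeta> s) x) = pmul E s t (lact (fib E s) b (\<zeta> s)) x"
    using Cons.hyps m by (intro pmul_lact) auto
  then show ?case using Cons m by (simp add: asym_mult asym_unit)
qed

text \<open>\<open>generates\<close> speaks of positive times; at time 0 every element is itself an
  empty word \<open>iota E b\<close>.\<close>

lemma words_total:
  assumes "t \<ge> 0"
  shows "closed_span (fib E t) {x. unit_word E S t x} = car (fib E t)"
proof (cases "t = 0")
  case True
  interpret F: hilbert_module "fib E 0" by (rule fib_hilbert) simp
  have "x \<in> clin_span (fib E 0) {x. unit_word E S 0 x}" if "x \<in> car (fib E 0)" for x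
    using iota_surj[OF that] unit_word.Nil by (auto intro: clin_span.base)
  then have "closed_span (fib E 0) {x. unit_word E S 0 x} = car (fib E 0)"
    by (intro F.closed_spanI_dense) (metis F.hdist_self)
  then show ?thesis using True by simp
next
  case False
  then show ?thesis using S_gen assms by (simp add: generates_def)
qed

lemma asym_all:
  assumes t: "t \<ge> 0" and x: "x \<in> car (fib E t)"
  shows "asym t x"
proof -
  interpret T: hilbert_module "fib E t" by (rule fib_hilbert[OF t])
  have "{x. unit_word E S t x} \<subseteq> car (fib E t)" "x \<in> closed_span (fib E t) {x. unit_word E S t x}"
    using unit_word_mem words_total[OF t] x by auto
  then show ?thesis
  proof (induction rule: T.closed_span_induct)
    case (lim X x)
    show ?case
    proof (rule asym_approx[OF t lim.hyps(2)])
      fix e :: real assume "e > 0"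
      then obtain n where "hdist (fib E t) (X n) x < e"
        using order_tendstoD(2)[OF lim.hyps(3)] by (auto simp: eventually_sequentially)
      then show "\<exists>y\<in>car (fib E t). asym t y \<and> hdist (fib E t) x y < e"
        using lim.hyps(1,2) lim.IH T.hdist_commute[of x "X n"] by (intro bexI[of _ "X n"]) auto
    qed
  qed (use t unit_word_asym asym_zero asym_add asym_scale in auto)
qed

end


section \<open>Right multiplication by short units, and strong continuity\<close>

context generating_units
begin

text \<open>For h = \<xi> x one has h \<xi>_r = \<xi> x \<xi>_r and h = \<xi> \<xi>_r x, so the
  distance is the one in \<open>asym\<close>. Right multiplication by \<xi>_r is contractive, so the
  dense set of such h suffices.\<close>

lemma right_shift:
  assumes h: "h \<in> car H"
  shows "((\<lambda>r. hdist H (act r h (\<xi> r)) h) \<longlongrightarrow> 0) (at_right 0)"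
proof (rule tendsto_null_approx)
  fix e :: real assume "e > 0"
  then obtain t x where tx: "t \<ge> 0" "x \<in> car (fib E t)" "hdist H h (j t x) < e / 2"
    using j_dense[OF h, of "e / 2" 0] by auto
  have "\<forall>\<^sub>F r in at_right 0. \<bar>hdist H (act r h (\<xi> r)) h\<bar>
      \<le> hdist (fib E (t + r)) (pmul E t r x (\<xi> r)) (pmul E r t (\<xi> r) x) + e"
    using ev_pos
  proof eventually_elim
    fix r :: real assume r0: "r > 0"
    then have r: "r \<ge> 0" by simp
    have jm: "j t x \<in> car H" using tx by simp
    have "hdist H (act r h (\<xi> r)) (act r (j t x) (\<xi> r)) \<le> hdist H h (j t x) * hnorm (fib E r) (\<xi> r)"
      using h tx r by (intro act_hdist_left) auto
    also have "\<dots> \<le> hdist H h (j t x) * 1" using r by (intro mult_left_mono \<xi>_hnorm) auto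
    finally have 1: "hdist H (act r h (\<xi> r)) (act r (j t x) (\<xi> r)) < e / 2" using tx(3) by simp
    have "act r (j t x) (\<xi> r) = j (t + r) (pmul E t r x (\<xi> r))" using tx r by (simp add: act_j)
    moreover have "j t x = j (t + r) (pmul E r t (\<xi> r) x)" using j_shift[OF r tx(1,2)] by (simp add: add.commute)
    ultimately have 2: "hdist H (act r (j t x) (\<xi> r)) (j t x)
        = hdist (fib E (t + r)) (pmul E t r x (\<xi> r)) (pmul E r t (\<xi> r) x)"
      using isometric_embedding_hdist[OF fib_prehilbert[of "t + r"] j_isometric[of "t + r"]] pmul_\<xi>_mem[OF tx(1) r tx(2)] tx(1) r by simp
    have m: "act r h (\<xi> r) \<in> car H" "act r (j t x) (\<xi> r) \<in> car H" using h r tx by auto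
    show "\<bar>hdist H (act r h (\<xi> r)) h\<bar> \<le> hdist (fib E (t + r)) (pmul E t r x (\<xi> r)) (pmul E r t (\<xi> r) x) + e"
      using H.hdist_triangle[OF m(1,2) h] H.hdist_triangle[OF m(2) jm h] H.hdist_commute[OF h jm] 1 2 tx(3) by simp
  qed
  with asym_all[OF tx(1,2)] show "\<exists>g. (g \<longlongrightarrow> 0) (at_right 0) \<and> (\<forall>\<^sub>F r in at_right 0. \<bar>hdist H (act r h (\<xi> r)) h\<bar> \<le> g r + e)"
    unfolding asym_def by blast
qed

text \<open>h \<zeta>_r and h \<xi>_r differ by at most |h| times the null function of
  \<open>unit_near\<close>.\<close>

lemma right_shift_unit:
  assumes h: "h \<in> car H" and z: "\<zeta> \<in> S"
  shows "((\<lambda>r. hdist H (act r h (\<zeta> r)) h) \<longlongrightarrow> 0) (at_right 0)"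
proof (rule Lim_null_comparison)
  show "((\<lambda>r. hnorm H h * hdist (fib E r) (\<zeta> r) (\<xi> r) + hdist H (act r h (\<xi> r)) h) \<longlongrightarrow> 0) (at_right 0)"
    using tendsto_add[OF tendsto_mult_right_zero[OF unit_near[OF z]] right_shift[OF h]] by simp
  show "\<forall>\<^sub>F r in at_right 0. norm (hdist H (act r h (\<zeta> r)) h) \<le> hnorm H h * hdist (fib E r) (\<zeta> r) (\<xi> r) + hdist H (act r h (\<xi> r)) h" (is "\<forall>\<^sub>F r in _. ?P r")
    using ev_pos
  proof eventually_elim
    fix r :: real assume r: "r > 0"
    have m: "act r h (\<zeta> r) \<in> car H" "act r h (\<xi> r) \<in> car H" using h r z by auto
    show "?P r"
      using H.hdist_triangle[OF m h] act_hdist_right[of r h "\<zeta> r" "\<xi> r"] h r z by simp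
  qed
qed

text \<open>The Lipschitz constant of \<theta>_t(a) is independent of t, so pointwise convergence
  extends from a total set by linearity and limits.\<close>

lemma theta_conv_total:
  fixes F :: "'x filter"
  assumes a: "adjointable H a" and f: "\<forall>\<^sub>F r in F. f r \<ge> 0" and t: "t \<ge> 0"
    and A: "A \<subseteq> car H" "closed_span H A = car H"
    and conv: "\<And>k. k \<in> A \<Longrightarrow> ((\<lambda>r. hdist H (\<theta> (f r) a k) (\<theta> t a k)) \<longlongrightarrow> 0) F"
    and k: "k \<in> car H"
  shows "((\<lambda>r. hdist H (\<theta> (f r) a k) (\<theta> t a k)) \<longlongrightarrow> 0) F"
proof -
  note mem = theta_props(3)[OF a]
  obtain C where C: "C \<ge> 0" "\<And>t h k. t \<ge> 0 \<Longrightarrow> h \<in> car H \<Longrightarrow> k \<in> car H \<Longrightarrow> hdist H (\<theta> t a h) (\<theta> t a k) \<le> C * hdist H h k"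
    using theta_props(1)[OF a] by blast
  have "k \<in> closed_span H A" using A k by simp
  with A(1) show ?thesis
  proof (induction rule: H.closed_span_induct)
    case zero
    have z: "\<theta> s a (hzero H) = hzero H" if "s \<ge> 0" for s
      using theta_props(5)[OF a that, of "hzero H" 0] mem[OF that, of "hzero H"] by (simp add: H.ract_0)
    show ?case
      by (rule Lim_transform_eventually[OF tendsto_const[of 0]]) (use f in eventually_elim, use t z in simp)
  next
    case (add x y)
    show ?case
    proof (rule Lim_null_comparison)
      show "((\<lambda>r. hdist H (\<theta> (f r) a x) (\<theta> t a x) + hdist H (\<theta> (f r) a y) (\<theta> t a y)) \<longlongrightarrow> 0) F"
        using tendsto_add[OF add.IH] by simp
      show "\<forall>\<^sub>F r in F. norm (hdist H (\<theta> (f r) a (hadd H x y)) (\<theta> t a (hadd H x y))) \<le> hdist H (\<theta> (f r) a x) (\<theta> t a x) + hdist H (\<theta> (f r) a y) (\<theta> t a y)"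
        using f by eventually_elim (use add.hyps t mem in \<open>simp add: theta_props(4)[OF a] H.hdist_add\<close>)
    qed
  next
    case (scale x c)
    show ?case
    proof (rule Lim_null_comparison)
      show "((\<lambda>r. hdist H (\<theta> (f r) a x) (\<theta> t a x) * norm (c *\<^sub>C (1::'b))) \<longlongrightarrow> 0) F"
        using tendsto_mult_left_zero[OF scale.IH] by simp
      show "\<forall>\<^sub>F r in F. norm (hdist H (\<theta> (f r) a (ract H x (c *\<^sub>C 1))) (\<theta> t a (ract H x (c *\<^sub>C 1)))) \<le> hdist H (\<theta> (f r) a x) (\<theta> t a x) * norm (c *\<^sub>C (1::'b))"
        using f by eventually_elim (use scale.hyps t mem in \<open>simp add: theta_props(5)[OF a] H.hdist_ract\<close>)
    qed
  next
    case (lim X x)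
    show ?case
    proof (rule tendsto_null_approx)
      fix e :: real assume e: "e > 0"
      then obtain n where n: "hdist H (X n) x < e / (2 * (C + 1))"
        using order_tendstoD(2)[OF lim.hyps(3), of "e / (2 * (C + 1))"] C by (auto simp: eventually_sequentially)
      have Cn: "C * hdist H (X n) x \<le> e / 2"
      proof -
        have "C * hdist H (X n) x \<le> (C + 1) * hdist H (X n) x" by (intro mult_right_mono) auto
        also have "\<dots> \<le> (C + 1) * (e / (2 * (C + 1)))" using n C by (intro mult_left_mono) auto
        also have "\<dots> = e / 2" using C by (simp add: field_simps)
        finally show ?thesis .
      qed
      have "\<forall>\<^sub>F r in F. \<bar>hdist H (\<theta> (f r) a x) (\<theta> t a x)\<bar> \<le> hdist H (\<theta> (f r) a (X n)) (\<theta> t a (X n)) + e"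
        using f
      proof eventually_elim
        fix r assume r: "f r \<ge> 0"
        note m = mem[OF r lim.hyps(2)] mem[OF r lim.hyps(1)[of n]] mem[OF t lim.hyps(2)] mem[OF t lim.hyps(1)[of n]]
        have "hdist H (\<theta> (f r) a x) (\<theta> (f r) a (X n)) \<le> e / 2"
          using C(2)[OF r lim.hyps(2) lim.hyps(1)[of n]] Cn H.hdist_commute[OF lim.hyps(2) lim.hyps(1)[of n]] by simp
        moreover have "hdist H (\<theta> t a (X n)) (\<theta> t a x) \<le> e / 2"
          using C(2)[OF t lim.hyps(1)[of n] lim.hyps(2)] Cn by simp
        ultimately show "\<bar>hdist H (\<theta> (f r) a x) (\<theta> t a x)\<bar> \<le> hdist H (\<theta> (f r) a (X n)) (\<theta> t a (X n)) + e"
          using H.hdist_triangle[OF m(1,2,3)] H.hdist_triangle[OF m(2,4,3)] by simp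
      qed
      with lim.IH[of n] show "\<exists>g. (g \<longlongrightarrow> 0) F \<and> (\<forall>\<^sub>F r in F. \<bar>hdist H (\<theta> (f r) a x) (\<theta> t a x)\<bar> \<le> g r + e)" by blast
    qed
  qed (use conv in blast)
qed

text \<open>On k = h y with y in E_s, compare with k' = h \<xi>_r y. It is close to k by
  \<open>right_shift\<close>, and \<theta>_(r+s)(a) k' = (a h) \<xi>_r y is close to (a h) y =
  \<theta>_s(a) k by \<open>right_shift\<close> for a h.\<close>

lemma theta_right_cont:
  assumes a: "adjointable H a" and s: "s \<ge> 0" and k: "k \<in> car H"
  shows "((\<lambda>r. hdist H (\<theta> (r + s) a k) (\<theta> s a k)) \<longlongrightarrow> 0) (at_right 0)"
proof (rule theta_conv_total[OF a _ s _ act_total[OF s] _ k])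
  show "\<forall>\<^sub>F r in at_right 0. r + s \<ge> 0" using ev_pos by eventually_elim (use s in simp)
  note am = theta_props(6)[OF a]
  obtain C where C: "C \<ge> 0" "\<And>t h k. t \<ge> 0 \<Longrightarrow> h \<in> car H \<Longrightarrow> k \<in> car H \<Longrightarrow> hdist H (\<theta> t a h) (\<theta> t a k) \<le> C * hdist H h k"
    using theta_props(1)[OF a] by blast
  fix k assume "k \<in> {act s h y |h y. h \<in> car H \<and> y \<in> car (fib E s)}"
  then obtain h y where k: "k = act s h y" and h: "h \<in> car H" and y: "y \<in> car (fib E s)" by blast
  have ah: "a h \<in> car H" using h by (rule am)
  define n where "n = hnorm (fib E s) y"
  show "((\<lambda>r. hdist H (\<theta> (r + s) a k) (\<theta> s a k)) \<longlongrightarrow> 0) (at_right 0)"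
  proof (rule Lim_null_comparison)
    show "((\<lambda>r. C * (hdist H (act r h (\<xi> r)) h * n) + hdist H (act r (a h) (\<xi> r)) (a h) * n) \<longlongrightarrow> 0) (at_right 0)"
      using tendsto_add[OF tendsto_mult_right_zero[OF tendsto_mult_left_zero[OF right_shift[OF h]]] tendsto_mult_left_zero[OF right_shift[OF ah]]] by simp
    show "\<forall>\<^sub>F r in at_right 0. norm (hdist H (\<theta> (r + s) a k) (\<theta> s a k))
        \<le> C * (hdist H (act r h (\<xi> r)) h * n) + hdist H (act r (a h) (\<xi> r)) (a h) * n" (is "\<forall>\<^sub>F r in _. ?P r")
      using ev_pos
    proof eventually_elim
      fix r :: real assume r0: "r > 0"
      then have r: "r \<ge> 0" by simp
      define k' where "k' = act s (act r h (\<xi> r)) y"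
      have hr: "act r h (\<xi> r) \<in> car H" "act r (a h) (\<xi> r) \<in> car H" using h ah r by auto
      have k': "k' = act (r + s) h (pmul E r s (\<xi> r) y)" unfolding k'_def using h y r s by (intro act_assoc) auto
      have km: "k \<in> car H" "k' \<in> car H" using h y hr s by (auto simp: k k'_def)
      have "\<theta> (r + s) a k' = act (r + s) (a h) (pmul E r s (\<xi> r) y)"
        unfolding k' using h y r s by (intro theta_props(2)[OF a]) auto
      also have "\<dots> = act s (act r (a h) (\<xi> r)) y" using act_assoc[OF r s ah _ y, of "\<xi> r"] r by simp
      finally have 1: "\<theta> (r + s) a k' = act s (act r (a h) (\<xi> r)) y" .
      have 2: "\<theta> s a k = act s (a h) y" unfolding k using h y s by (intro theta_props(2)[OF a]) auto
      have "hdist H (\<theta> (r + s) a k) (\<theta> (r + s) a k') \<le> C * hdist H k k'"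
        using r s km by (intro C(2)) auto
      also have "\<dots> = C * hdist H k' k" using H.hdist_commute[OF km] by simp
      also have "\<dots> \<le> C * (hdist H (act r h (\<xi> r)) h * n)"
        unfolding k k'_def n_def using h y s hr C(1) by (intro mult_left_mono act_hdist_left) auto
      finally have 3: "hdist H (\<theta> (r + s) a k) (\<theta> (r + s) a k') \<le> C * (hdist H (act r h (\<xi> r)) h * n)" .
      have 4: "hdist H (\<theta> (r + s) a k') (\<theta> s a k) \<le> hdist H (act r (a h) (\<xi> r)) (a h) * n"
        unfolding 1 2 n_def using ah y s hr by (intro act_hdist_left) auto
      have m: "\<theta> (r + s) a k \<in> car H" "\<theta> (r + s) a k' \<in> car H" "\<theta> s a k \<in> car H"
        using r s km by (auto intro!: theta_props(3)[OF a])
      show "?P r"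
        using H.hdist_triangle[OF m] 3 4 by simp
    qed
  qed
qed (use s in auto)

text \<open>Replaces general right factors by words, whose leading unit can be split; this is what
  continuity from the left requires.\<close>

lemma act_words_total:
  assumes t: "t \<ge> 0"
  shows "closed_span H {act t h w | h w. h \<in> car H \<and> unit_word E S t w} = car H"
proof (rule H.total_of_approx[OF _ act_total[OF t]])
  interpret T: hilbert_module "fib E t" by (rule fib_hilbert[OF t])
  have W: "{x. unit_word E S t x} \<subseteq> car (fib E t)" using unit_word_mem by auto
  fix k and e :: real assume "k \<in> {act t h y |h y. h \<in> car H \<and> y \<in> car (fib E t)}" and e: "e > 0"
  then obtain h y where k: "k = act t h y" and h: "h \<in> car H" and y: "y \<in> car (fib E t)" by blast
  let ?B = "{act t h w | h w. h \<in> car H \<and> unit_word E S t w}"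
  have span: "act t h w \<in> clin_span H ?B" if "w \<in> clin_span (fib E t) {x. unit_word E S t x}" for w
    using that
  proof induction
    case zero
    have "act t h (hzero (fib E t)) = hzero H"
      using act_ract_right[of t h "hzero (fib E t)" 0] h t by (simp add: H.ract_0 T.ract_0)
    then show ?case by (simp add: clin_span.zero)
  next
    case (base w)
    then show ?case using h by (intro clin_span.base) auto
  next
    case (add v w)
    then have "v \<in> car (fib E t)" "w \<in> car (fib E t)" using T.clin_span_subset[OF W] by auto
    then show ?case using add h t by (simp add: act_add_right clin_span.add)
  next
    case (scale w c)
    then have "w \<in> car (fib E t)" using T.clin_span_subset[OF W] by auto
    then show ?case using scale h t by (simp add: act_ract_right clin_span.scale)
  qed
  define n where "n = hnorm H h + 1"
  have n: "n > 0" using hnorm_ge_0[of H h] unfolding n_def by linarith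
  have "y \<in> closed_span (fib E t) {x. unit_word E S t x}" using words_total[OF t] y by simp
  moreover have "e / n > 0" using e n by simp
  ultimately obtain w where w: "w \<in> clin_span (fib E t) {x. unit_word E S t x}" "hdist (fib E t) y w < e / n"
    unfolding closed_span_def by blast
  have wm: "w \<in> car (fib E t)" using w(1) T.clin_span_subset[OF W] by auto
  have "hdist H k (act t h w) \<le> hnorm H h * hdist (fib E t) y w"
    unfolding k using h y wm t by (intro act_hdist_right) auto
  also have "\<dots> \<le> n * hdist (fib E t) y w" by (intro mult_right_mono) (auto simp: n_def)
  also have "\<dots> < e" using w(2) n by (simp add: less_divide_eq mult.commute)
  finally show "\<exists>y\<in>clin_span H ?B. hdist H k y < e" using span[OF w(1)] by blast
qed (use t unit_word_mem in auto)

text \<open>For k = h \<zeta>_u y and r < u, the elements \<theta>_(t-r)(a) k and \<theta>_t(a) k are a(h \<zeta>_r) and (a h) \<zeta>_r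
  multiplied by the same factor \<zeta>_(u-r) y.\<close>

lemma theta_left_cont:
  assumes a: "adjointable H a" and t: "t > 0" and k: "k \<in> car H"
  shows "((\<lambda>r. hdist H (\<theta> (t - r) a k) (\<theta> t a k)) \<longlongrightarrow> 0) (at_right 0)"
proof (rule theta_conv_total[OF a _ less_imp_le[OF t] _ act_words_total[OF less_imp_le[OF t]] _ k])
  have ev_lt: "\<forall>\<^sub>F r in at_right (0::real). r < u" if "u > 0" for u
    using that by (simp add: eventually_at_right_field) (metis)
  show "\<forall>\<^sub>F r in at_right 0. t - r \<ge> 0" using ev_lt[OF t] by eventually_elim simp
  note am = theta_props(6)[OF a]
  obtain C where C: "C \<ge> 0" "\<And>h k. h \<in> car H \<Longrightarrow> k \<in> car H \<Longrightarrow> hdist H (a h) (a k) \<le> C * hdist H h k"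
    using theta_props(1)[OF a] by blast
  fix k assume "k \<in> {act t h w |h w. h \<in> car H \<and> unit_word E S t w}"
  then obtain h0 w where k0: "k = act t h0 w" and h0: "h0 \<in> car H" and w: "unit_word E S t w" by blast
  \<comment> \<open>As t > 0 the word is not empty. It starts with a coefficient b in front of a
    unit, and b is absorbed into the left factor by h = h0 b.\<close>
  from w obtain \<zeta> u v y b where wy: "unit_word E S v y" "\<zeta> \<in> S" "u > 0" "t = u + v"
      "w = lact (fib E (u + v)) b (pmul E u v (\<zeta> u) y)"
    using t by (cases rule: unit_word.cases) auto
  have v: "v \<ge> 0" and y: "y \<in> car (fib E v)" using unit_word_mem[OF wy(1)] by auto
  have u: "u \<ge> 0" using wy(3) by simp
  define h where "h = ract H h0 b"
  have h: "h \<in> car H" and ah: "a h \<in> car H" using h0 am by (auto simp: h_def)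
  have k: "k = act t h (pmul E u v (\<zeta> u) y)"
    unfolding k0 wy(5) h_def using act_ract_left[of t h0 "pmul E u v (\<zeta> u) y" b] t h0 u v y wy(2,4) by simp
  \<comment> \<open>The common right factor \<zeta>_(u-r) y depends on r, so its norm has to be
    bounded for all small r at once.\<close>
  obtain B where B: "B \<ge> 0" "\<And>x. x \<in> {0..u} \<Longrightarrow> hnorm (fib E x) (\<zeta> x) \<le> B" using unit_bounded[OF wy(2), of u] by blast
  define n where "n = B * hnorm (fib E v) y"
  have n: "n \<ge> 0" using B(1) by (simp add: n_def)
  show "((\<lambda>r. hdist H (\<theta> (t - r) a k) (\<theta> t a k)) \<longlongrightarrow> 0) (at_right 0)"
  proof (rule Lim_null_comparison)
    show "((\<lambda>r. (C * hdist H (act r h (\<zeta> r)) h + hdist H (act r (a h) (\<zeta> r)) (a h)) * n) \<longlongrightarrow> 0) (at_right 0)"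
      by (rule tendsto_mult_left_zero)
        (use tendsto_add[OF tendsto_mult_right_zero[OF right_shift_unit[OF h wy(2)]] right_shift_unit[OF ah wy(2)]] in simp)
    show "\<forall>\<^sub>F r in at_right 0. norm (hdist H (\<theta> (t - r) a k) (\<theta> t a k))
        \<le> (C * hdist H (act r h (\<zeta> r)) h + hdist H (act r (a h) (\<zeta> r)) (a h)) * n" (is "\<forall>\<^sub>F r in _. ?P r")
      using ev_pos ev_lt[OF wy(3)]
    proof eventually_elim
      fix r :: real assume r0: "r > 0" and ru: "r < u"
      then have r: "r \<ge> 0" "u - r \<ge> 0" "t - r \<ge> 0" using wy(4) v by auto
      define q where "q = pmul E (u - r) v (\<zeta> (u - r)) y"
      have q: "q \<in> car (fib E (t - r))" using r v y wy by (simp add: q_def)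
      have "pmul E u v (\<zeta> u) y = pmul E (r + (u - r)) v (pmul E r (u - r) (\<zeta> r) (\<zeta> (u - r))) y"
        using S_mult[OF wy(2) r(1,2)] by simp
      also have "\<dots> = pmul E r (t - r) (\<zeta> r) q"
        unfolding q_def using pmul_assoc[of r "u - r" v "\<zeta> r" "\<zeta> (u - r)" y] r v y wy(2,4)
        by (simp add: diff_add_eq)
      finally have split: "pmul E u v (\<zeta> u) y = pmul E r (t - r) (\<zeta> r) q" .
      have hr: "act r h (\<zeta> r) \<in> car H" "act r (a h) (\<zeta> r) \<in> car H" using h ah r wy(2) by auto
      have shift: "act t g (pmul E u v (\<zeta> u) y) = act (t - r) (act r g (\<zeta> r)) q" if "g \<in> car H" for g
        using act_assoc[OF r(1,3) that _ q, of "\<zeta> r"] r(1) wy(2) by (simp add: split)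
      have 1: "\<theta> (t - r) a k = act (t - r) (a (act r h (\<zeta> r))) q"
        unfolding k shift[OF h] by (rule theta_props(2)[OF a r(3) hr(1) q])
      have 2: "\<theta> t a k = act (t - r) (act r (a h) (\<zeta> r)) q"
        unfolding shift[OF ah, symmetric] unfolding k using t h u v y wy by (intro theta_props(2)[OF a]) auto
      have "hnorm (fib E (t - r)) q \<le> hnorm (fib E (u - r)) (\<zeta> (u - r)) * hnorm (fib E v) y"
        using pmul_hnorm[of "u - r" v "\<zeta> (u - r)" y] r v y wy(2,4) by (simp add: q_def diff_add_eq)
      also have "\<dots> \<le> n" unfolding n_def using r r0 by (intro mult_right_mono B) auto
      finally have qn: "hnorm (fib E (t - r)) q \<le> n" .
      have "hdist H (a (act r h (\<zeta> r))) (act r (a h) (\<zeta> r))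
          \<le> hdist H (a (act r h (\<zeta> r))) (a h) + hdist H (a h) (act r (a h) (\<zeta> r))"
        using H.hdist_triangle[OF am[OF hr(1)] ah hr(2)] .
      also have "\<dots> \<le> C * hdist H (act r h (\<zeta> r)) h + hdist H (act r (a h) (\<zeta> r)) (a h)"
        using C(2)[OF hr(1) h] H.hdist_commute[OF ah hr(2)] by simp
      finally have d: "hdist H (a (act r h (\<zeta> r))) (act r (a h) (\<zeta> r))
          \<le> C * hdist H (act r h (\<zeta> r)) h + hdist H (act r (a h) (\<zeta> r)) (a h)" .
      have "hdist H (\<theta> (t - r) a k) (\<theta> t a k) \<le> hdist H (a (act r h (\<zeta> r))) (act r (a h) (\<zeta> r)) * hnorm (fib E (t - r)) q"
        unfolding 1 2 using r hr q by (intro act_hdist_left am) auto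
      also have "\<dots> \<le> (C * hdist H (act r h (\<zeta> r)) h + hdist H (act r (a h) (\<zeta> r)) (a h)) * n"
        using d qn C(1) by (intro mult_mono) auto
      finally show "?P r" by simp
    qed
  qed
qed (use t unit_word_mem in auto)

text \<open>Both one-sided limits are rewritten with increments r decreasing to 0, the form in which
  the estimates for units are available.\<close>

lemma tendsto_half_line:
  fixes f :: "real \<Rightarrow> 'z::topological_space"
  assumes p: "p \<ge> 0" and right: "((\<lambda>r. f (r + p)) \<longlongrightarrow> l) (at_right 0)"
    and left: "p > 0 \<Longrightarrow> ((\<lambda>r. f (p - r)) \<longlongrightarrow> l) (at_right 0)"
  shows "(f \<longlongrightarrow> l) (at p within {0..})"
proof (cases "p = 0")
  case True
  then show ?thesis using right by (simp add: at_within_Ici_at_right)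
next
  case False
  have "(f \<longlongrightarrow> l) (at_right p)" using right by (subst filterlim_at_right_to_0)
  moreover have "(f \<longlongrightarrow> l) (at_left p)"
    using left p False by (subst filterlim_at_left_to_right, subst filterlim_at_right_to_0) (simp add: algebra_simps)
  ultimately have "(f \<longlongrightarrow> l) (at p)" by (simp add: filterlim_split_at)
  then show ?thesis by (rule tendsto_within_subset) simp
qed

lemma theta_continuous:
  assumes a: "adjointable H a" and k: "k \<in> car H"
  shows "hcontinuous_on H {0..} (\<lambda>t. \<theta> t a k)"
  unfolding hcontinuous_on_def
proof (intro conjI ballI)
  show "(\<lambda>t. \<theta> t a k) \<in> {0..} \<rightarrow> car H" using theta_props(3)[OF a _ k] by auto
  fix p :: real assume "p \<in> {0..}"
  then show "((\<lambda>t. hdist H (\<theta> t a k) (\<theta> p a k)) \<longlongrightarrow> 0) (at p within {0..})"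
    using theta_right_cont[OF a _ k] theta_left_cont[OF a _ k] by (intro tendsto_half_line) auto
qed

lemma strongly_continuous: "strongly_continuous_vartheta E \<xi>"
  unfolding strongly_continuous_vartheta_def using theta_continuous by blast

end


section \<open>The induced continuous structure\<close>

text \<open>The limit at p ignores the value at p, while \<open>g q\<close> may be equal to p; there
  the distance is zero.\<close>

lemma hcontinuous_on_compose:
  fixes f :: "'p::metric_space \<Rightarrow> 'e" and g :: "'q::topological_space \<Rightarrow> 'p"
  assumes M: "prehilbert M" and f: "hcontinuous_on M A f" and g: "(g \<longlongrightarrow> p) (at p0 within B)"
    and p: "p \<in> A" and gB: "\<forall>\<^sub>F q in at p0 within B. g q \<in> A"
  shows "((\<lambda>q. hdist M (f (g q)) (f p)) \<longlongrightarrow> 0) (at p0 within B)"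
proof (rule tendstoI)
  interpret M: prehilbert M by fact
  fix e :: real assume e: "e > 0"
  have fp: "f p \<in> car M" using f p by (auto simp: hcontinuous_on_def)
  obtain d where d: "d > 0" "\<And>x. x \<in> A \<Longrightarrow> 0 < dist x p \<Longrightarrow> dist x p < d \<Longrightarrow> dist (hdist M (f x) (f p)) 0 < e"
    using f p e unfolding hcontinuous_on_def Lim_within by meson
  have "\<forall>\<^sub>F q in at p0 within B. dist (g q) p < d" using tendstoD[OF g d(1)] .
  with gB show "\<forall>\<^sub>F q in at p0 within B. dist (hdist M (f (g q)) (f p)) 0 < e"
  proof eventually_elim
    fix q assume "g q \<in> A" "dist (g q) p < d"
    then show "dist (hdist M (f (g q)) (f p)) 0 < e"
      using d(2)[of "g q"] fp e by (cases "g q = p") auto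
  qed
qed

lemma eventually_within: "\<forall>\<^sub>F q in at p within B. q \<in> B"
  by (simp add: eventually_at_filter)

context generating_units
begin

text \<open>Both vectors have the form \<xi> x with x in E_(r+s): one comes from \<zeta>_r
  \<zeta>_s, the other from \<xi>_r \<zeta>_s.\<close>

lemma unit_step:
  assumes z: "\<zeta> \<in> S" and r: "r \<ge> 0" and s: "s \<ge> 0"
  shows "hdist H (j (r + s) (\<zeta> (r + s))) (j s (\<zeta> s)) \<le> hdist (fib E r) (\<zeta> r) (\<xi> r) * hnorm (fib E s) (\<zeta> s)"
proof -
  have "hdist H (j (r + s) (\<zeta> (r + s))) (j s (\<zeta> s))
      = hdist H (j (r + s) (pmul E r s (\<zeta> r) (\<zeta> s))) (j (r + s) (pmul E r s (\<xi> r) (\<zeta> s)))"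
    using j_shift[OF r s, of "\<zeta> s"] S_mult[OF z r s] z s by simp
  also have "\<dots> = hdist (fib E (r + s)) (pmul E r s (\<zeta> r) (\<zeta> s)) (pmul E r s (\<xi> r) (\<zeta> s))"
    using z r s by (intro isometric_embedding_hdist fib_prehilbert j_isometric) auto
  also have "\<dots> \<le> hdist (fib E r) (\<zeta> r) (\<xi> r) * hnorm (fib E s) (\<zeta> s)"
    using z r s by (intro pmul_hdist_left) auto
  finally show ?thesis .
qed

text \<open>\<open>unit_step\<close> gives both one-sided limits at p. From the left it is applied
  with s = p - r, hence the bound on [0, p].\<close>

lemma unit_section:
  assumes z: "\<zeta> \<in> S"
  shows "\<zeta> \<in> cont_sections E H j"
proof -
  have "((\<lambda>t. hdist H (j t (\<zeta> t)) (j p (\<zeta> p))) \<longlongrightarrow> 0) (at p within {0..})" if p: "p \<ge> 0" for p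
  proof (rule tendsto_half_line[OF p])
    show "((\<lambda>r. hdist H (j (r + p) (\<zeta> (r + p))) (j p (\<zeta> p))) \<longlongrightarrow> 0) (at_right 0)"
    proof (rule Lim_null_comparison)
      show "\<forall>\<^sub>F r in at_right 0. norm (hdist H (j (r + p) (\<zeta> (r + p))) (j p (\<zeta> p)))
          \<le> hdist (fib E r) (\<zeta> r) (\<xi> r) * hnorm (fib E p) (\<zeta> p)"
        using ev_pos by eventually_elim (use unit_step[OF z _ p] in simp)
    qed (rule tendsto_mult_left_zero[OF unit_near[OF z]])
    assume p0: "p > 0"
    obtain B where B: "B \<ge> 0" "\<And>v. v \<in> {0..p} \<Longrightarrow> hnorm (fib E v) (\<zeta> v) \<le> B" using unit_bounded[OF z, of p] by blast
    show "((\<lambda>r. hdist H (j (p - r) (\<zeta> (p - r))) (j p (\<zeta> p))) \<longlongrightarrow> 0) (at_right 0)"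
    proof (rule Lim_null_comparison)
      have lt: "\<forall>\<^sub>F r in at_right 0. r < p" using p0 by (auto simp: eventually_at_right_field)
      show "\<forall>\<^sub>F r in at_right 0. norm (hdist H (j (p - r) (\<zeta> (p - r))) (j p (\<zeta> p))) \<le> hdist (fib E r) (\<zeta> r) (\<xi> r) * B" (is "\<forall>\<^sub>F r in _. ?P r")
        using ev_pos lt
      proof eventually_elim
        fix r :: real assume r: "r > 0" "r < p"
        have "hdist H (j (p - r) (\<zeta> (p - r))) (j p (\<zeta> p)) = hdist H (j p (\<zeta> p)) (j (p - r) (\<zeta> (p - r)))"
          using r z by (intro H.hdist_commute) auto
        also have "\<dots> \<le> hdist (fib E r) (\<zeta> r) (\<xi> r) * hnorm (fib E (p - r)) (\<zeta> (p - r))"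
          using unit_step[OF z, of r "p - r"] r by simp
        also have "\<dots> \<le> hdist (fib E r) (\<zeta> r) (\<xi> r) * B" using r by (intro mult_left_mono B) auto
        finally show "?P r" by simp
      qed
    qed (rule tendsto_mult_left_zero[OF unit_near[OF z]])
  qed
  then show ?thesis using z by (auto simp: cont_sections_def hcontinuous_on_def)
qed

section \<open>Sections and products through rank-one operators\<close>

definition rank_one :: "'e ilim \<Rightarrow> 'e ilim \<Rightarrow> 'e ilim \<Rightarrow> 'e ilim" where
  "rank_one h k z = ract H h (ip H k z)"

lemma rank_one_adjointable: "h \<in> car H \<Longrightarrow> k \<in> car H \<Longrightarrow> adjointable H (rank_one h k)"
  unfolding adjointable_def is_adjoint_def
  by (intro exI[of _ "rank_one k h"]) (simp add: rank_one_def H.ip_sym mult.assoc)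

lemma theta_rank_one:
  assumes "t \<ge> 0" "h \<in> car H" "k \<in> car H" "g \<in> car H" "y \<in> car (fib E t)"
  shows "\<theta> t (rank_one h k) (act t g y) = act t h (lact (fib E t) (ip H k g) y)"
  using theta_props(2)[OF rank_one_adjointable[OF assms(2,3)] assms(1,4,5)] assms
  by (simp add: rank_one_def act_ract_left)

text \<open>The vector g y is sent to \<xi> <\<xi>, g> y, which lies in \<xi> E_t. These g y are
  total, and \<xi> E_t is closed as the isometric image of a complete module.\<close>

lemma theta_projection_range:
  assumes t: "t \<ge> 0" and k: "k \<in> car H"
  shows "\<theta> t (rank_one \<xi>v \<xi>v) k \<in> j t ` car (fib E t)"
proof -
  define a where "a = rank_one \<xi>v \<xi>v"
  have a: "adjointable H a" unfolding a_def by (rule rank_one_adjointable) auto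
  note mem = theta_props(3)[OF a t] and iso = isometric_embeddingD[OF j_isometric[OF t]]
  obtain C where C: "C \<ge> 0" "\<And>h k. h \<in> car H \<Longrightarrow> k \<in> car H \<Longrightarrow> hdist H (\<theta> t a h) (\<theta> t a k) \<le> C * hdist H h k"
    using theta_props(1)[OF a] t by blast
  interpret F: hilbert_module "fib E t" by (rule fib_hilbert[OF t])
  have A: "{act t h y |h y. h \<in> car H \<and> y \<in> car (fib E t)} \<subseteq> car H" using t by auto
  have "k \<in> closed_span H {act t h y |h y. h \<in> car H \<and> y \<in> car (fib E t)}" using act_total[OF t] k by simp
  with A have "\<theta> t a k \<in> j t ` car (fib E t)"
  proof (induction rule: H.closed_span_induct)
    case zero
    have "\<theta> t a (hzero H) = hzero H"
      using theta_props(5)[OF a t, of "hzero H" 0] mem[of "hzero H"] by (simp add: H.ract_0)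
    also have "\<dots> = j t (hzero (fib E t))"
      using isometric_embedding_hzero[OF F.prehilbert_axioms H.hilbert_module_axioms j_isometric[OF t]] by simp
    finally show ?case by (auto simp: F.zero_mem)
  next
    case (base k)
    then obtain h y where "k = act t h y" "h \<in> car H" "y \<in> car (fib E t)" by blast
    then show ?case using t by (simp add: a_def theta_rank_one act_\<xi>v)
  next
    case (add x y)
    then obtain u v where "u \<in> car (fib E t)" "v \<in> car (fib E t)" "\<theta> t a x = j t u" "\<theta> t a y = j t v" by blast
    then have "\<theta> t a (hadd H x y) = j t (hadd (fib E t) u v)" "hadd (fib E t) u v \<in> car (fib E t)"
      using theta_props(4)[OF a t add.hyps] by (simp_all add: iso)
    then show ?case by blast
  next
    case (scale x c)
    then obtain u where "u \<in> car (fib E t)" "\<theta> t a x = j t u" by blast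
    then have "\<theta> t a (ract H x (c *\<^sub>C 1)) = j t (ract (fib E t) u (c *\<^sub>C 1))" "ract (fib E t) u (c *\<^sub>C 1) \<in> car (fib E t)"
      using theta_props(5)[OF a t scale.hyps] by (simp_all add: iso)
    then show ?case by blast
  next
    case (lim X x)
    then have "\<forall>n. \<exists>y. y \<in> car (fib E t) \<and> \<theta> t a (X n) = j t y" by blast
    then obtain Y where Y: "\<And>n. Y n \<in> car (fib E t)" "\<And>n. \<theta> t a (X n) = j t (Y n)" by metis
    have l: "(\<lambda>n. hdist H (j t (Y n)) (\<theta> t a x)) \<longlonglongrightarrow> 0"
    proof (rule Lim_null_comparison[OF always_eventually], rule allI)
      show "norm (hdist H (j t (Y n)) (\<theta> t a x)) \<le> C * hdist H (X n) x" for n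
        using C(2)[OF lim.hyps(1)[of n] lim.hyps(2)] Y(2)[of n] by simp
    qed (rule tendsto_mult_right_zero[OF lim.hyps(3)])
    have jm: "j t (Y n) \<in> car H" for n using Y t by simp
    have "hCauchy H (\<lambda>n. j t (Y n))" by (rule H.convergent_imp_hCauchy[OF jm mem[OF lim.hyps(2)] l])
    then have "hCauchy (fib E t) Y"
      using Y(1) by (simp add: hCauchy_def isometric_embedding_hdist[OF F.prehilbert_axioms j_isometric[OF t]])
    then obtain y where y: "y \<in> car (fib E t)" "(\<lambda>n. hdist (fib E t) (Y n) y) \<longlonglongrightarrow> 0" using F.complete by blast
    have "(\<lambda>n. hdist H (j t (Y n)) (j t y)) \<longlonglongrightarrow> 0"
      using y Y(1) by (simp add: isometric_embedding_hdist[OF F.prehilbert_axioms j_isometric[OF t]])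
    then have "\<theta> t a x = j t y"
      using H.lim_unique[OF mem[OF lim.hyps(2)] _ jm l] y t by simp
    then show ?case using y by blast
  qed
  then show ?thesis by (simp add: a_def)
qed

text \<open>Take x_t with \<xi> x_t = \<theta>_t(p)(\<xi> y), where p is the rank-one projection
  onto \<xi>. Strong continuity makes this continuous in t, and x_s = y because \<theta>_s(p) fixes
  \<xi> E_s.\<close>

lemma section_through:
  assumes s: "s \<ge> 0" and y: "y \<in> car (fib E s)"
  shows "\<exists>x\<in>cont_sections E H j. x s = y"
proof -
  define a where "a = rank_one \<xi>v \<xi>v"
  have a: "adjointable H a" unfolding a_def by (rule rank_one_adjointable) auto
  have k: "j s y \<in> car H" using s y by simp
  have "\<forall>t. \<exists>x. t \<ge> 0 \<longrightarrow> x \<in> car (fib E t) \<and> j t x = \<theta> t a (j s y)"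
  proof
    fix t show "\<exists>x. t \<ge> 0 \<longrightarrow> x \<in> car (fib E t) \<and> j t x = \<theta> t a (j s y)"
    proof (cases "t \<ge> 0")
      case True
      then show ?thesis using theta_projection_range[OF True k] unfolding a_def by (metis imageE)
    qed simp
  qed
  then obtain x where x: "\<And>t. t \<ge> 0 \<Longrightarrow> x t \<in> car (fib E t)" "\<And>t. t \<ge> 0 \<Longrightarrow> j t (x t) = \<theta> t a (j s y)" by metis
  have "j s (x s) = j s y"
  proof -
    have "\<theta> s a (act s \<xi>v y) = act s \<xi>v y" unfolding a_def using s y by (simp add: theta_rank_one)
    then show ?thesis using x(2)[OF s] s y by (simp add: act_\<xi>v)
  qed
  then have "hdist (fib E s) (x s) y = 0"
    using isometric_embedding_hdist[OF fib_prehilbert[OF s] j_isometric[OF s] x(1)[OF s] y] k by simp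
  then have "x s = y" using hilbert_module.hdist_0_imp_eq[OF fib_hilbert[OF s] x(1)[OF s] y] by simp
  moreover have "((\<lambda>t. hdist H (j t (x t)) (j p (x p))) \<longlongrightarrow> 0) (at p within {0..})" if p: "p \<ge> 0" for p
  proof (rule Lim_transform_eventually)
    show "((\<lambda>t. hdist H (\<theta> t a (j s y)) (\<theta> p a (j s y))) \<longlongrightarrow> 0) (at p within {0..})"
      using theta_continuous[OF a k] p by (auto simp: hcontinuous_on_def)
    show "\<forall>\<^sub>F t in at p within {0..}. hdist H (\<theta> t a (j s y)) (\<theta> p a (j s y)) = hdist H (j t (x t)) (j p (x p))"
      using eventually_within[of "{0..}" p] by eventually_elim (use x p in simp)
  qed
  ultimately show ?thesis using x(1) by (intro bexI[of _ x]) (auto simp: cont_sections_def hcontinuous_on_def)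
qed

text \<open>Near (s0, t0), put h = \<xi> x_(s0). Replacing \<xi> x_s by h in (\<xi> x_s) y_t costs
  little. The operator a sending \<xi> to h gives h y_t = \<theta>_t(a)(\<xi> y_t), where the
  operators are strongly continuous and uniformly bounded and the vector moves continuously.\<close>

lemma product_continuous:
  assumes x: "x \<in> cont_sections E H j" and y: "y \<in> cont_sections E H j"
  shows "hcontinuous_on H ({0..} \<times> {0..}) (\<lambda>(s, t). j (s + t) (pmul E s t (x s) (y t)))"
  unfolding hcontinuous_on_def
proof (intro conjI ballI)
  have xm: "\<And>t. t \<ge> 0 \<Longrightarrow> x t \<in> car (fib E t)" and xc: "hcontinuous_on H {0..} (\<lambda>t. j t (x t))"
    and ym: "\<And>t. t \<ge> 0 \<Longrightarrow> y t \<in> car (fib E t)" and yc: "hcontinuous_on H {0..} (\<lambda>t. j t (y t))"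
    using x y by (auto simp: cont_sections_def)
  show "(\<lambda>(s, t). j (s + t) (pmul E s t (x s) (y t))) \<in> {0..} \<times> {0..} \<rightarrow> car H" using xm ym by auto
  fix p :: "real \<times> real" assume p: "p \<in> {0..} \<times> {0..}"
  obtain s0 t0 where p0: "p = (s0, t0)" by (cases p)
  have s0: "s0 \<ge> 0" and t0: "t0 \<ge> 0" using p by (auto simp: p0)
  let ?F = "at p within {0..} \<times> {0..}"
  define h where "h = j s0 (x s0)"
  have h: "h \<in> car H" using xm s0 by (simp add: h_def)
  define a where "a = rank_one h \<xi>v"
  have a: "adjointable H a" unfolding a_def using h by (rule rank_one_adjointable) simp
  obtain C where C: "C \<ge> 0" "\<And>t h k. t \<ge> 0 \<Longrightarrow> h \<in> car H \<Longrightarrow> k \<in> car H \<Longrightarrow> hdist H (\<theta> t a h) (\<theta> t a k) \<le> C * hdist H h k"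
    using theta_props(1)[OF a] by blast
  define k where "k = j t0 (y t0)"
  have k: "k \<in> car H" using ym t0 by (simp add: k_def)
  have ah: "act t h (y t) = \<theta> t a (j t (y t))" if "t \<ge> 0" for t
    using theta_rank_one[OF that h \<xi>v_mem \<xi>v_mem ym[OF that]] that ym by (simp add: a_def act_\<xi>v)
  have f: "((\<lambda>q. fst q) \<longlongrightarrow> s0) ?F" "((\<lambda>q. snd q) \<longlongrightarrow> t0) ?F"
    using tendsto_fst[OF tendsto_ident_at, of p "{0..} \<times> {0..}"] tendsto_snd[OF tendsto_ident_at, of p "{0..} \<times> {0..}"]
    by (simp_all add: p0)
  have ev: "\<forall>\<^sub>F q in ?F. fst q \<ge> 0 \<and> snd q \<ge> 0" using eventually_within[of "{0..} \<times> {0..}" p] by eventually_elim auto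
  have 1: "((\<lambda>q. hdist H (j (fst q) (x (fst q))) h) \<longlongrightarrow> 0) ?F" unfolding h_def
    by (rule hcontinuous_on_compose[OF H.prehilbert_axioms xc f(1)]) (use s0 in simp, use ev in eventually_elim, simp)
  have 2: "((\<lambda>q. hdist H (j (snd q) (y (snd q))) k) \<longlongrightarrow> 0) ?F" unfolding k_def
    by (rule hcontinuous_on_compose[OF H.prehilbert_axioms yc f(2)]) (use t0 in simp, use ev in eventually_elim, simp)
  have 3: "((\<lambda>q. hdist H (\<theta> (snd q) a k) (\<theta> t0 a k)) \<longlongrightarrow> 0) ?F"
    by (rule hcontinuous_on_compose[OF H.prehilbert_axioms theta_continuous[OF a k] f(2)])
      (use t0 in simp, use ev in eventually_elim, simp)
  have 4: "((\<lambda>q. hnorm H (j (snd q) (y (snd q)))) \<longlongrightarrow> hnorm H k) ?F"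
    by (rule H.tendsto_hnorm[OF _ k 2]) (use ev in eventually_elim, use ym in simp)
  have lim: "((\<lambda>q. hdist H (j (fst q) (x (fst q))) h * hnorm H (j (snd q) (y (snd q)))
      + (C * hdist H (j (snd q) (y (snd q))) k + hdist H (\<theta> (snd q) a k) (\<theta> t0 a k))) \<longlongrightarrow> 0) ?F"
    using tendsto_add[OF tendsto_mult[OF 1 4] tendsto_add[OF tendsto_mult_right_zero[OF 2, of C] 3]] by simp
  have ev2: "\<forall>\<^sub>F q in ?F. norm (hdist H (case q of (s, t) \<Rightarrow> j (s + t) (pmul E s t (x s) (y t))) (case p of (s, t) \<Rightarrow> j (s + t) (pmul E s t (x s) (y t))))
      \<le> hdist H (j (fst q) (x (fst q))) h * hnorm H (j (snd q) (y (snd q)))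
      + (C * hdist H (j (snd q) (y (snd q))) k + hdist H (\<theta> (snd q) a k) (\<theta> t0 a k))"
    using ev
  proof eventually_elim
    fix q :: "real \<times> real" assume "fst q \<ge> 0 \<and> snd q \<ge> 0"
    then obtain s t where q: "q = (s, t)" "s \<ge> 0" "t \<ge> 0" by (cases q) auto
    note m = xm[OF q(2)] ym[OF q(3)] xm[OF s0] ym[OF t0]
    have "hdist H (act t (j s (x s)) (y t)) (act t h (y t)) \<le> hdist H (j s (x s)) h * hnorm (fib E t) (y t)"
      using q m h by (intro act_hdist_left) auto
    moreover have "hnorm (fib E t) (y t) = hnorm H (j t (y t))"
      using isometric_embedding_hnorm[OF j_isometric[OF q(3)] m(2)] by simp
    moreover have "hdist H (act t h (y t)) (act t0 h (y t0)) \<le> C * hdist H (j t (y t)) k + hdist H (\<theta> t a k) (\<theta> t0 a k)"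
    proof -
      have jm: "j t (y t) \<in> car H" using q m by simp
      have "hdist H (act t h (y t)) (act t0 h (y t0)) = hdist H (\<theta> t a (j t (y t))) (\<theta> t0 a k)"
        using ah[OF q(3)] ah[OF t0] by (simp add: k_def)
      also have "\<dots> \<le> hdist H (\<theta> t a (j t (y t))) (\<theta> t a k) + hdist H (\<theta> t a k) (\<theta> t0 a k)"
        using theta_props(3)[OF a q(3) jm] theta_props(3)[OF a q(3) k] theta_props(3)[OF a t0 k] by (rule H.hdist_triangle)
      finally show ?thesis using C(2)[OF q(3) jm k] by simp
    qed
    moreover have "hdist H (act t (j s (x s)) (y t)) (act t0 h (y t0))
        \<le> hdist H (act t (j s (x s)) (y t)) (act t h (y t)) + hdist H (act t h (y t)) (act t0 h (y t0))"
      using q m h t0 by (intro H.hdist_triangle) auto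
    moreover have "act t (j s (x s)) (y t) = j (s + t) (pmul E s t (x s) (y t))"
      "act t0 h (y t0) = j (s0 + t0) (pmul E s0 t0 (x s0) (y t0))"
      using q m s0 t0 by (simp_all add: act_j h_def)
    ultimately show "norm (hdist H (case q of (s, t) \<Rightarrow> j (s + t) (pmul E s t (x s) (y t))) (case p of (s, t) \<Rightarrow> j (s + t) (pmul E s t (x s) (y t))))
      \<le> hdist H (j (fst q) (x (fst q))) h * hnorm H (j (snd q) (y (snd q)))
      + (C * hdist H (j (snd q) (y (snd q))) k + hdist H (\<theta> (snd q) a k) (\<theta> t0 a k))"
      by (simp add: q(1) p0)
  qed
  show "((\<lambda>q. hdist H (case q of (s, t) \<Rightarrow> j (s + t) (pmul E s t (x s) (y t))) (case p of (s, t) \<Rightarrow> j (s + t) (pmul E s t (x s) (y t)))) \<longlongrightarrow> 0) ?F"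
    by (rule Lim_null_comparison[OF ev2 lim])
qed

lemma induced_continuous_structure: "continuous_structure E H j"
proof -
  have "{x s | x. x \<in> cont_sections E H j} = car (fib E s)" if "s \<ge> 0" for s
    using section_through[OF that] that by (auto simp: cont_sections_def)
  then show ?thesis
    unfolding continuous_structure_def
    using H.hilbert_module_axioms j_isometric product_continuous by blast
qed

section \<open>Uniqueness\<close>

text \<open>Continuity at the single time t: sections through a word are controlled only at the
  length of that word.\<close>

definition section_cont :: "('b, 'h) hmod \<Rightarrow> (real \<Rightarrow> 'e \<Rightarrow> 'h) \<Rightarrow> real \<Rightarrow> (real \<Rightarrow> 'e) \<Rightarrow> bool" where
  "section_cont K i t d \<longleftrightarrow> ((\<lambda>q. hdist K (i q (d q)) (i t (d t))) \<longlongrightarrow> 0) (at t within {0..})"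

text \<open>Choose a continuous section X with X_0 = \<open>iota E b\<close>. Then b \<zeta>_q = X_0
  \<zeta>_q, and joint continuity of products is used along the first index 0.\<close>

lemma lact_section:
  fixes K :: "('b, 'h) hmod"
  assumes cs: "continuous_structure E K i" and z: "\<zeta> \<in> cont_sections E K i"
  shows "(\<lambda>q. lact (fib E q) b (\<zeta> q)) \<in> cont_sections E K i"
proof -
  have K: "prehilbert K" using cs by (auto simp: continuous_structure_def intro: hilbert_imp_prehilbert)
  have zm: "\<And>t. t \<ge> 0 \<Longrightarrow> \<zeta> t \<in> car (fib E t)" using z by (simp add: cont_sections_def)
  have im: "\<And>t x. t \<ge> 0 \<Longrightarrow> x \<in> car (fib E t) \<Longrightarrow> i t x \<in> car K"
    using cs by (auto simp: continuous_structure_def isometric_embedding_def)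
  have "iota E b \<in> {x 0 | x. x \<in> cont_sections E K i}" using cs by (simp add: continuous_structure_def)
  then obtain X where X: "X \<in> cont_sections E K i" "X 0 = iota E b" by force
  have pc: "hcontinuous_on K ({0..} \<times> {0..}) (\<lambda>(s, t). i (s + t) (pmul E s t (X s) (\<zeta> t)))"
    using cs X(1) z by (simp add: continuous_structure_def)
  have "((\<lambda>q. hdist K (i q (lact (fib E q) b (\<zeta> q))) (i p (lact (fib E p) b (\<zeta> p)))) \<longlongrightarrow> 0) (at p within {0..})" if p: "p \<ge> 0" for p
  proof (rule Lim_transform_eventually)
    show "((\<lambda>q. hdist K (case (0, q) of (s, t) \<Rightarrow> i (s + t) (pmul E s t (X s) (\<zeta> t))) (case (0, p) of (s, t) \<Rightarrow> i (s + t) (pmul E s t (X s) (\<zeta> t)))) \<longlongrightarrow> 0) (at p within {0..})"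
    proof (rule hcontinuous_on_compose[OF K pc])
      show "((\<lambda>q. (0::real, q)) \<longlongrightarrow> (0, p)) (at p within {0..})" by (intro tendsto_intros)
      show "\<forall>\<^sub>F q in at p within {0..}. (0::real, q) \<in> {0..} \<times> {0..}"
        using eventually_within[of "{0..}" p] by eventually_elim simp
    qed (use p in simp)
    show "\<forall>\<^sub>F q in at p within {0..}. hdist K (case (0, q) of (s, t) \<Rightarrow> i (s + t) (pmul E s t (X s) (\<zeta> t))) (case (0, p) of (s, t) \<Rightarrow> i (s + t) (pmul E s t (X s) (\<zeta> t)))
        = hdist K (i q (lact (fib E q) b (\<zeta> q))) (i p (lact (fib E p) b (\<zeta> p)))"
      using eventually_within[of "{0..}" p] by eventually_elim (use p zm in \<open>simp add: X(2) pmul_left\<close>)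
  qed
  then show ?thesis using zm im by (auto simp: cont_sections_def hcontinuous_on_def)
qed

text \<open>A local section through a word, obtained by varying the length of its first factor; it does not
  depend on the continuous structure.\<close>

lemma word_section:
  assumes w: "unit_word E S t w"
  shows "\<exists>d. (\<forall>q\<ge>0. d q \<in> car (fib E q)) \<and> d t = w \<and>
    (\<forall>(K :: ('b, 'h) hmod) i. continuous_structure E K i \<and> S \<subseteq> cont_sections E K i \<longrightarrow> section_cont K i t d) \<and>
    (\<forall>(K :: ('b, 'k) hmod) i. continuous_structure E K i \<and> S \<subseteq> cont_sections E K i \<longrightarrow> section_cont K i t d)"
  using w
proof (cases rule: unit_word.cases)
  case (Nil b)
  define d where "d q = lact (fib E q) b (\<xi> q)" for q
  \<comment> \<open>Proved for an arbitrary type of the module, so that one \<open>d\<close> serves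
    structures on modules of two different types.\<close>
  have c: "section_cont K i 0 d" if "continuous_structure E K i" "S \<subseteq> cont_sections E K i"
    for K :: "('b, 'z) hmod" and i
    using lact_section[OF that(1), of \<xi> b] that(2) \<xi>_S by (auto simp: d_def section_cont_def cont_sections_def hcontinuous_on_def)
  have "d 0 = iota E b" using iota_lact[of b 1] by (simp add: d_def \<xi>_0)
  moreover have "\<forall>q\<ge>0. d q \<in> car (fib E q)" by (simp add: d_def)
  ultimately show ?thesis by (intro exI[of _ d]) (simp add: Nil c)
next
  case (Cons v y \<zeta> u b)
  have v: "v \<ge> 0" and y: "y \<in> car (fib E v)" using unit_word_mem[OF Cons(3)] by auto
  have tv: "t > v" using Cons by simp
  \<comment> \<open>Near \<open>t\<close> only q > v occurs; the value zero below \<open>v\<close>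
    merely keeps \<open>d\<close> in the fibres.\<close>
  define d where "d q = (if q \<ge> v then pmul E (q - v) v (lact (fib E (q - v)) b (\<zeta> (q - v))) y else hzero (fib E q))" for q
  have dm: "\<forall>q\<ge>0. d q \<in> car (fib E q)"
    using v y Cons(4) hilbert_module.zero_closed[OF fib_hilbert] by (auto simp: d_def)
  have dt: "d t = w" using Cons v y pmul_lact[of u v "\<zeta> u" y b] by (simp add: d_def)
  have c: "section_cont K i t d" if cs: "continuous_structure E K i" and SK: "S \<subseteq> cont_sections E K i"
    for K :: "('b, 'z) hmod" and i
  proof -
    have K: "prehilbert K" using cs by (auto simp: continuous_structure_def intro: hilbert_imp_prehilbert)
    define \<eta> where "\<eta> q = lact (fib E q) b (\<zeta> q)" for q
    have \<eta>: "\<eta> \<in> cont_sections E K i" unfolding \<eta>_def using lact_section[OF cs] SK Cons(4) by blast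
    have "y \<in> {x v | x. x \<in> cont_sections E K i}" using cs y v by (simp add: continuous_structure_def)
    then obtain Y where Y: "Y \<in> cont_sections E K i" "Y v = y" by force
    have pc: "hcontinuous_on K ({0..} \<times> {0..}) (\<lambda>(s, t). i (s + t) (pmul E s t (\<eta> s) (Y t)))"
      using cs \<eta> Y(1) by (simp add: continuous_structure_def)
    have ev: "\<forall>\<^sub>F q in at t within {0..}. q > v"
      by (rule order_tendstoD(1)[OF tendsto_ident_at tv])
    have "((\<lambda>q. hdist K (case (q - v, v) of (s, t) \<Rightarrow> i (s + t) (pmul E s t (\<eta> s) (Y t))) (case (t - v, v) of (s, t) \<Rightarrow> i (s + t) (pmul E s t (\<eta> s) (Y t)))) \<longlongrightarrow> 0) (at t within {0..})"
    proof (rule hcontinuous_on_compose[OF K pc])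
      show "((\<lambda>q. (q - v, v)) \<longlongrightarrow> (t - v, v)) (at t within {0..})" by (intro tendsto_intros)
      show "\<forall>\<^sub>F q in at t within {0..}. (q - v, v) \<in> {0..} \<times> {0..}"
        using ev by eventually_elim (use v in simp)
    qed (use tv v in simp)
    then show ?thesis unfolding section_cont_def
      by (rule Lim_transform_eventually) (use ev in eventually_elim, use tv in \<open>simp add: d_def \<eta>_def Y(2)\<close>)
  qed
  show ?thesis by (intro exI[of _ d]) (simp add: dm dt c)
qed

text \<open>Sums and multiples of sections are formed fibrewise, so the section through a linear
  combination of words is again common to both structures.\<close>

lemma span_section:
  fixes K1 :: "('b, 'h) hmod" and K2 :: "('b, 'k) hmod"
  assumes cs1: "continuous_structure E K1 i1" "S \<subseteq> cont_sections E K1 i1"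
    and cs2: "continuous_structure E K2 i2" "S \<subseteq> cont_sections E K2 i2"
    and t: "t \<ge> 0" and w: "w \<in> clin_span (fib E t) {x. unit_word E S t x}"
  shows "\<exists>d. (\<forall>q\<ge>0. d q \<in> car (fib E q)) \<and> d t = w \<and> section_cont K1 i1 t d \<and> section_cont K2 i2 t d"
proof -
  have sec_add: "section_cont K i t (\<lambda>q. hadd (fib E q) (d q) (d' q))"
    if "continuous_structure E K i" and d: "\<forall>q\<ge>0. d q \<in> car (fib E q)" "\<forall>q\<ge>0. d' q \<in> car (fib E q)"
      and c: "section_cont K i t d" "section_cont K i t d'"
    for K :: "('b, 'z) hmod" and i d d'
  proof -
    interpret K: hilbert_module K using that by (simp add: continuous_structure_def)
    have iso: "isometric_embedding (fib E q) K (i q)" if "q \<ge> 0" for q using \<open>continuous_structure E K i\<close> that by (simp add: continuous_structure_def)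
    show ?thesis unfolding section_cont_def
    proof (rule Lim_null_comparison)
      show "((\<lambda>q. hdist K (i q (d q)) (i t (d t)) + hdist K (i q (d' q)) (i t (d' t))) \<longlongrightarrow> 0) (at t within {0..})"
        using tendsto_add[OF c[unfolded section_cont_def]] by simp
      show "\<forall>\<^sub>F q in at t within {0..}. norm (hdist K (i q (hadd (fib E q) (d q) (d' q))) (i t (hadd (fib E t) (d t) (d' t))))
          \<le> hdist K (i q (d q)) (i t (d t)) + hdist K (i q (d' q)) (i t (d' t))"
        using eventually_within[of "{0..}" t]
        by eventually_elim (use d t in \<open>simp add: isometric_embeddingD[OF iso] K.hdist_add\<close>)
    qed
  qed
  have sec_scale: "section_cont K i t (\<lambda>q. ract (fib E q) (d q) b)"
    if "continuous_structure E K i" and d: "\<forall>q\<ge>0. d q \<in> car (fib E q)" and c: "section_cont K i t d"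
    for K :: "('b, 'z) hmod" and i d b
  proof -
    interpret K: hilbert_module K using that by (simp add: continuous_structure_def)
    have iso: "isometric_embedding (fib E q) K (i q)" if "q \<ge> 0" for q using \<open>continuous_structure E K i\<close> that by (simp add: continuous_structure_def)
    show ?thesis unfolding section_cont_def
    proof (rule Lim_null_comparison)
      show "((\<lambda>q. hdist K (i q (d q)) (i t (d t)) * norm b) \<longlongrightarrow> 0) (at t within {0..})"
        using tendsto_mult_left_zero[OF c[unfolded section_cont_def]] by simp
      show "\<forall>\<^sub>F q in at t within {0..}. norm (hdist K (i q (ract (fib E q) (d q) b)) (i t (ract (fib E t) (d t) b)))
          \<le> hdist K (i q (d q)) (i t (d t)) * norm b"
        using eventually_within[of "{0..}" t]
        by eventually_elim (use d t in \<open>simp add: isometric_embeddingD[OF iso] K.hdist_ract\<close>)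
    qed
  qed
  note [intro] = hilbert_module.add_closed[OF fib_hilbert] ract_mem
  show ?thesis using w
  proof induction
    case zero
    \<comment> \<open>The zero vector is reached as \<xi>_t times 0, which reduces this case to
      scaling a section.\<close>
    have \<xi>: "section_cont K1 i1 t \<xi>" "section_cont K2 i2 t \<xi>"
      using cs1(2) cs2(2) \<xi>_S t by (auto simp: section_cont_def cont_sections_def hcontinuous_on_def)
    have "ract (fib E t) (\<xi> t) 0 = hzero (fib E t)" using hilbert_module.ract_0[OF fib_hilbert[OF t]] t by simp
    then show ?case
      using sec_scale[OF cs1(1) _ \<xi>(1), of 0] sec_scale[OF cs2(1) _ \<xi>(2), of 0]
      by (intro exI[of _ "\<lambda>q. ract (fib E q) (\<xi> q) 0"]) simp
  next
    case (base w)
    then have "unit_word E S t w" by simp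
    from word_section[OF this, where 'h='h and 'k='k] show ?case using cs1 cs2 by blast
  next
    case (add x y)
    then obtain d d' where d: "\<forall>q\<ge>0. d q \<in> car (fib E q)" "d t = x" "section_cont K1 i1 t d" "section_cont K2 i2 t d"
      "\<forall>q\<ge>0. d' q \<in> car (fib E q)" "d' t = y" "section_cont K1 i1 t d'" "section_cont K2 i2 t d'" by blast
    show ?case
      using sec_add[OF cs1(1) d(1,5,3,7)] sec_add[OF cs2(1) d(1,5,4,8)] d
      by (intro exI[of _ "\<lambda>q. hadd (fib E q) (d q) (d' q)"]) auto
  next
    case (scale x c)
    then obtain d where d: "\<forall>q\<ge>0. d q \<in> car (fib E q)" "d t = x" "section_cont K1 i1 t d" "section_cont K2 i2 t d" by blast
    show ?case
      using sec_scale[OF cs1(1) d(1,3)] sec_scale[OF cs2(1) d(1,4)] d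
      by (intro exI[of _ "\<lambda>q. ract (fib E q) (d q) (c *\<^sub>C 1)"]) auto
  qed
qed

text \<open>At t, approximate x_t by a combination of words within e/2, and let d be the common
  local section through it. Continuity of x and d in the first structure keeps the fibre distance of
  x_q and d_q small for q near t. The second structure sees the same fibre distance, and there d is
  continuous, so x_q stays near x_t.\<close>

lemma cont_sections_subset:
  fixes K1 :: "('b, 'h) hmod" and K2 :: "('b, 'k) hmod"
  assumes cs1: "continuous_structure E K1 i1" "S \<subseteq> cont_sections E K1 i1"
    and cs2: "continuous_structure E K2 i2" "S \<subseteq> cont_sections E K2 i2"
  shows "cont_sections E K1 i1 \<subseteq> cont_sections E K2 i2"
proof
  interpret K1: hilbert_module K1 using cs1 by (simp add: continuous_structure_def)
  interpret K2: hilbert_module K2 using cs2 by (simp add: continuous_structure_def)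
  have iso1: "isometric_embedding (fib E q) K1 (i1 q)" and iso2: "isometric_embedding (fib E q) K2 (i2 q)"
    if "q \<ge> 0" for q using cs1 cs2 that by (auto simp: continuous_structure_def)
  fix x assume "x \<in> cont_sections E K1 i1"
  then have xm: "\<And>t. t \<ge> 0 \<Longrightarrow> x t \<in> car (fib E t)" and xc: "\<And>t. t \<ge> 0 \<Longrightarrow> section_cont K1 i1 t x"
    by (auto simp: cont_sections_def hcontinuous_on_def section_cont_def)
  have "section_cont K2 i2 t x" if t: "t \<ge> 0" for t
    unfolding section_cont_def
  proof (rule tendsto_null_approx)
    fix e :: real assume e: "e > 0"
    interpret T: hilbert_module "fib E t" by (rule fib_hilbert[OF t])
    have W: "{x. unit_word E S t x} \<subseteq> car (fib E t)" using unit_word_mem by auto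
    have "x t \<in> closed_span (fib E t) {x. unit_word E S t x}" "e / 2 > 0" using words_total[OF t] xm[OF t] e by auto
    then obtain w where w: "w \<in> clin_span (fib E t) {x. unit_word E S t x}" "hdist (fib E t) (x t) w < e / 2"
      unfolding closed_span_def by blast
    have wm: "w \<in> car (fib E t)" using w(1) T.clin_span_subset[OF W] by auto
    obtain d where d: "\<And>q. q \<ge> 0 \<Longrightarrow> d q \<in> car (fib E q)" "d t = w" "section_cont K1 i1 t d" "section_cont K2 i2 t d"
      using span_section[OF cs1 cs2 t w(1)] by blast
    let ?g = "\<lambda>q. hdist K1 (i1 q (x q)) (i1 t (x t)) + hdist K1 (i1 q (d q)) (i1 t (d t)) + hdist K2 (i2 q (d q)) (i2 t (d t))"
    have "(?g \<longlongrightarrow> 0) (at t within {0..})"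
      using tendsto_add[OF tendsto_add[OF xc[OF t, unfolded section_cont_def] d(3)[unfolded section_cont_def]] d(4)[unfolded section_cont_def]]
      by simp
    moreover have "\<forall>\<^sub>F q in at t within {0..}. \<bar>hdist K2 (i2 q (x q)) (i2 t (x t))\<bar> \<le> ?g q + e"
      using eventually_within[of "{0..}" t]
    proof eventually_elim
      fix q :: real assume "q \<in> {0..}"
      then have q: "q \<ge> 0" by simp
      interpret Q: hilbert_module "fib E q" by (rule fib_hilbert[OF q])
      note m1 = isometric_embeddingD(1)[OF iso1[OF q] xm[OF q]] isometric_embeddingD(1)[OF iso1[OF t] xm[OF t]]
        isometric_embeddingD(1)[OF iso1[OF t] wm] isometric_embeddingD(1)[OF iso1[OF q] d(1)[OF q]]
      note m2 = isometric_embeddingD(1)[OF iso2[OF q] xm[OF q]] isometric_embeddingD(1)[OF iso2[OF t] xm[OF t]]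
        isometric_embeddingD(1)[OF iso2[OF t] wm] isometric_embeddingD(1)[OF iso2[OF q] d(1)[OF q]]
      have a: "hdist K1 (i1 q (x q)) (i1 q (d q)) = hdist (fib E q) (x q) (d q)"
        "hdist K2 (i2 q (x q)) (i2 q (d q)) = hdist (fib E q) (x q) (d q)"
        using isometric_embedding_hdist[OF Q.prehilbert_axioms iso1[OF q] xm[OF q] d(1)[OF q]]
          isometric_embedding_hdist[OF Q.prehilbert_axioms iso2[OF q] xm[OF q] d(1)[OF q]] by simp_all
      have b: "hdist K1 (i1 t (x t)) (i1 t w) < e / 2" "hdist K2 (i2 t w) (i2 t (x t)) < e / 2"
        using isometric_embedding_hdist[OF T.prehilbert_axioms iso1[OF t] xm[OF t] wm]
          isometric_embedding_hdist[OF T.prehilbert_axioms iso2[OF t] wm xm[OF t]] w(2)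
          T.hdist_commute[OF wm xm[OF t]] by simp_all
      have "hdist K1 (i1 q (x q)) (i1 q (d q)) \<le> hdist K1 (i1 q (x q)) (i1 t (x t)) + e / 2 + hdist K1 (i1 q (d q)) (i1 t w)"
        using K1.hdist_triangle[OF m1(1,2,4)] K1.hdist_triangle[OF m1(2,3,4)] K1.hdist_commute[OF m1(3,4)] b(1) by linarith
      moreover have "hdist K2 (i2 q (x q)) (i2 t (x t)) \<le> hdist K2 (i2 q (x q)) (i2 q (d q)) + hdist K2 (i2 q (d q)) (i2 t w) + e / 2"
        using K2.hdist_triangle[OF m2(1,4,2)] K2.hdist_triangle[OF m2(4,3,2)] b(2) by linarith
      ultimately show "\<bar>hdist K2 (i2 q (x q)) (i2 t (x t))\<bar> \<le> ?g q + e" using a d(2) by simp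
    qed
    ultimately show "\<exists>g. (g \<longlongrightarrow> 0) (at t within {0..}) \<and>
        (\<forall>\<^sub>F q in at t within {0..}. \<bar>hdist K2 (i2 q (x q)) (i2 t (x t))\<bar> \<le> g q + e)" by blast
  qed
  then show "x \<in> cont_sections E K2 i2"
    using xm isometric_embeddingD(1)[OF iso2] by (auto simp: cont_sections_def hcontinuous_on_def section_cont_def)
qed

end

theorem theoremA1:
  fixes E :: "('b::unital_cstar_algebra, 'e) psys"
    and S :: "(real \<Rightarrow> 'e) set"
    and \<xi> :: "real \<Rightarrow> 'e"
  assumes "product_system E"
    and "\<forall>\<zeta>\<in>S. ps_unit E \<zeta>"
    and "generates E S"
    and "\<xi> \<in> S"
    and "unital_ps_unit E \<xi>"
    and "\<forall>\<zeta>\<in>S. \<forall>\<zeta>'\<in>S. \<forall>b.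
           continuous_on {0..} (\<lambda>t. ip (fib E t) (\<zeta> t) (lact (fib E t) b (\<zeta>' t)))"
  shows "strongly_continuous_vartheta E \<xi> \<and>
         continuous_structure E (indlim E \<xi>) (ilim_embed E \<xi>) \<and>
         S \<subseteq> cont_sections E (indlim E \<xi>) (ilim_embed E \<xi>) \<and>
         (\<forall>(H :: ('b, 'h) hmod) i.
            continuous_structure E H i \<and> S \<subseteq> cont_sections E H i \<longrightarrow>
            cont_sections E H i = cont_sections E (indlim E \<xi>) (ilim_embed E \<xi>))"
proof -
  interpret generating_units E \<xi> S
    using assms by (auto simp: generating_units_def generating_units_axioms_def unital_unit_def unital_unit_axioms_def)
  have S: "S \<subseteq> cont_sections E (indlim E \<xi>) (ilim_embed E \<xi>)" using unit_section by blast
  note cs = induced_continuous_structure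
  have "cont_sections E K i = cont_sections E (indlim E \<xi>) (ilim_embed E \<xi>)"
    if "continuous_structure E K i" "S \<subseteq> cont_sections E K i" for K :: "('b, 'h) hmod" and i
    using cont_sections_subset[OF that cs S] cont_sections_subset[OF cs S that] by blast
  then show ?thesis using strongly_continuous cs S by blast
qed


end
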